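(* Fix $s\in\mathbb{C}$ with $\sigma=\operatorname{Re}s>0$, and let $x\in\mathbb{R}^{+}$. Then \begin{align*} &\sum_{n=1}^{\infty}\frac{\sigma_s(n)}{\sqrt{n}}e^{-2\pi\sqrt{2nx}}\sin\left(\frac{\pi}{4}-2\pi\sqrt{2nx}\right)\\ &=4\pi\left(\frac{\sqrt{x}}{2}\zeta(-s)+\frac{\zeta\left(\frac12\right)}{4\pi\sqrt2}\zeta\left(\tfrac12-s\right)+\frac{\Gamma\left(s+\frac12\right)\zeta(-s)}{2^{s+3}\pi^{s+\frac32}x^{s+\frac12}}\right)\\ &\quad+\frac{\Gamma\left(s+\frac12\right)}{2^s\pi^{s+\frac12}}\Bigg\{\sum_{n<x}\frac{\sigma_s(n)}{n^{s+\frac12}}\Bigg[-\sin\left(\frac\pi4-\frac{\pi s}{2}\right)+\frac{n^{s+\frac12}}{2x^{s+\frac12}}\left(\left(1+\frac{in}{x}\right)^{-(s+\frac12)}+\left(1-\frac{in}{x}\right)^{-(s+\frac12)}\right)\Bigg]\\ &\quad+\frac12\sum_{n\ge x}\frac{\sigma_s(n)}{n^{s+\frac12}}\Bigg[\cos\left(\frac\pi4+\frac{\pi s}{2}\right)\left(\left(1+\frac{ix}{n}\right)^{-(s+\frac12)}+\left(1-\frac{ix}{n}\right)^{-(s+\frac12)}-2\right)\\ &\qquad+i\sin\left(\frac\pi4+\frac{\pi s}{2}\right)\left(\left(1+\frac{ix}{n}\right)^{-(s+\frac12)}-\left(1-\frac{ix}{n}\right)^{-(s+\frac12)}\right)\Bigg]\Bigg\}.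 \end{align*}
   Context: $\sigma_s(n)=\sum_{d\mid n}d^s$; $\zeta$ is the Riemann zeta function; complex powers are principal values. *)

theory Defs
  imports "HOL-Complex_Analysis.Complex_Analysis"
begin

definition divisor_sigma :: "complex \<Rightarrow> nat \<Rightarrow> complex" where
  "divisor_sigma s n = (\<Sum>d | d dvd n. of_nat d powr s)"

(* The Riemann zeta function: the holomorphic continuation to the plane without the point 1
   of the Dirichlet series. The value 0 at the pole is a convention that makes it unique. *)
definition riemann_zeta :: "complex \<Rightarrow> complex" where
  "riemann_zeta = (THE f.
     f holomorphic_on (- {1}) \<and>
     (\<forall>s. Re s > 1 \<longrightarrow> (\<lambda>n. 1 / of_nat (Suc n) powr s) sums f s) \<and>
     f 1 = 0)"

end

theory Submission
  imports Defs "HOL-Probability.Distributions" "HOL-Real_Asymp.Real_Asymp"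
begin

text \<open>
Writing \<open>n = d m\<close> turns the left-hand side into \<open>\<Sum>d. d powr (s - 1/2) * S(2 \<pi> x d)\<close>, up to a factor
\<open>1 / sqrt 2\<close>, where \<open>S(a) = \<Sum>m. sqrt (2 / m) exp (- r) sin (\<pi> / 4 - r)\<close> with \<open>r = 2 sqrt (\<pi> a m)\<close>.
Poisson summation of \<open>t powr (- 1/2) * exp (- a / t)\<close> on the half line gives
\<open>S(a) = \<Sum>d. d powr (- 1/2) * (exp (- a / d) - 1) + \<zeta>(1/2) + 2 sqrt (\<pi> a)\<close>.

With \<open>w = s + 1/2\<close>, the sum \<open>\<Sum>k. k powr (w - 1) * S(k X)\<close> is damped by a factor \<open>exp (- e k)\<close>, and
the corresponding integral is subtracted from it. The sums over \<open>k\<close> then become values of the remainder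
\<open>B(w, y) = \<Sum>k. k powr (w - 1) * exp (- k y) - \<Gamma>(w) * y powr (- w)\<close>, which tends to \<open>\<zeta>(1 - w)\<close> as
\<open>y\<close> tends to 0. By a regularized form of Lipschitz's formula, \<open>B(w, y) - \<zeta>(1 - w)\<close> equals
\<open>\<Gamma>(w) * \<Sum>m. (L m y - L m 0)\<close> with \<open>L m y = (y + 2 \<pi> i m) powr (- w) + (y - 2 \<pi> i m) powr (- w)\<close>.
Letting \<open>e\<close> tend to 0 yields the sum over \<open>d\<close> of \<open>d powr (- 1/2) * (B(w, X / d) - \<zeta>(1 - w))\<close>, which is the divisor sum on the right-hand
side, while the integral is a Mellin transform of \<open>S\<close>, evaluated by the functional equation of \<open>\<zeta>\<close>.
\<close>

section \<open>Poisson summation on the half line\<close>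

text \<open>The decomposition of S(a) cannot be summed over k piece by piece: with weights k powr (w
  - 1), the constant zeta(1/2), the term 2 sqrt(pi a) and the sum over d all diverge, although S
  decays faster than any power. After damping, the singular part of each piece is a Gamma factor
  times a negative power, with exponent w or w + 1/2, and the corresponding integral has exactly
  this value; hence the subtraction. Lipschitz's formula itself is available for Re w > 1, while w =
  s + 1/2 only has Re w > 1/2. Since the y-derivative of B(w, y) is - B(w + 1, y), the bounds near 0
  and the regularized formula are obtained at w + 1 and integrated back. The limit of B(w, y) at 0,
  holomorphic for Re w > 0, also continues zeta to the left half plane, and Lipschitz's formula at y
  = 0 is the functional equation. The split at n = x is one of notation: both brackets are values of
  one function, with x or with n factored out of the powers.\<close>

abbreviation half_line :: "real measure" where
  "half_line \<equiv> lebesgue_on {0<..}"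

section \<open>Integration and Laplace transforms on the half line\<close>

lemma integrable_half_line_continuous_bound:
  fixes f :: "real \<Rightarrow> complex"
  assumes "continuous_on {0<..} f" "integrable half_line g" "\<And>t. t > 0 \<Longrightarrow> norm (f t) \<le> (g t :: real)"
  shows "integrable half_line f"
proof (rule Bochner_Integration.integrable_bound[OF assms(2)])
  show "f \<in> borel_measurable half_line"
    by (rule continuous_imp_measurable_on_sets_lebesgue[OF assms(1)]) auto
  show "AE t in half_line. norm (f t) \<le> norm (g t)"
    using assms(3) by (intro AE_I2) (force)
qed

text \<open>Improper boundary values are allowed at both ends because integrability is assumed: the
  fundamental theorem is applied on the compact intervals \<open>{1 / Suc n..Suc n}\<close>, and
  dominated convergence with majorant \<open>norm (f t)\<close> exhausts the half line.\<close>

lemma integral_half_line_FTC: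
  fixes F f :: "real \<Rightarrow> complex"
  assumes int: "integrable half_line f"
    and deriv: "\<And>t. t > 0 \<Longrightarrow> (F has_vector_derivative f t) (at t)"
    and A: "(F \<longlongrightarrow> A) (at_right 0)" and B: "(F \<longlongrightarrow> B) at_top"
  shows "integral\<^sup>L half_line f = B - A"
proof -
  define s where "s = (\<lambda>n t. indicat_real {1 / real (Suc n)..real (Suc n)} t *\<^sub>R f t)"
  have sub: "{1 / real (Suc n)..real (Suc n)} \<subseteq> {0<..}" for n
  proof -
    have "0 < 1 / real (Suc n)" by simp
    thus ?thesis by (meson atLeastAtMost_iff greaterThan_iff less_le_trans subsetI)
  qed
  have sint: "integrable half_line (s n)" for n
    unfolding s_def using sub[of n]
    by (intro integrable_mult_indicator int) (auto simp: sets_restrict_space_iff simp del: of_nat_Suc)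
  have "integral\<^sup>L half_line (s n) = F (real (Suc n)) - F (1 / real (Suc n))" for n
  proof -
    have le: "1 / real (Suc n) \<le> real (Suc n)"
      by (rule order_trans[of _ 1]) auto
    have "(f has_integral (F (real (Suc n)) - F (1 / real (Suc n)))) {1 / real (Suc n)..real (Suc n)}"
    proof (rule fundamental_theorem_of_calculus[OF le])
      fix t assume "t \<in> {1 / real (Suc n)..real (Suc n)}"
      moreover have "0 < 1 / real (Suc n)" by simp
      ultimately have "t > 0" by (metis atLeastAtMost_iff less_le_trans)
      thus "(F has_vector_derivative f t) (at t within {1 / real (Suc n)..real (Suc n)})"
        using deriv has_vector_derivative_at_within by blast
    qed
    hence "((\<lambda>t. if t \<in> {1 / real (Suc n)..real (Suc n)} then f t else 0) has_integral
        (F (real (Suc n)) - F (1 / real (Suc n)))) {0<..}"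
      using sub[of n] by (subst has_integral_restrict)
    also have "(\<lambda>t. if t \<in> {1 / real (Suc n)..real (Suc n)} then f t else 0) = s n"
      by (auto simp: s_def fun_eq_iff)
    finally have 1: "(s n has_integral (F (real (Suc n)) - F (1 / real (Suc n)))) {0<..}" .
    have "(s n has_integral integral\<^sup>L half_line (s n)) {0<..}"
      by (rule has_integral_integral_lebesgue_on[OF sint]) auto
    with 1 show ?thesis using has_integral_unique by blast
  qed
  moreover have "(\<lambda>n. integral\<^sup>L half_line (s n)) \<longlonglongrightarrow> integral\<^sup>L half_line f"
  proof (rule integral_dominated_convergence[where w = "\<lambda>t. norm (f t)"])
    show "AE t in half_line. (\<lambda>n. s n t) \<longlonglongrightarrow> f t"
    proof (rule AE_I2)
      fix t :: real assume "t \<in> space half_line"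
      hence t: "t > 0" by simp
      have "eventually (\<lambda>n. 1 / real (Suc n) < t) sequentially"
        using order_tendstoD(2)[OF LIMSEQ_inverse_real_of_nat t] by (simp add: field_simps)
      moreover have "eventually (\<lambda>n. real (Suc n) \<ge> t) sequentially"
        by (metis (mono_tags, lifting) eventually_sequentiallyI le_SucI nat_ceiling_le_eq of_nat_mono)
      ultimately have "eventually (\<lambda>n. s n t = f t) sequentially"
        by eventually_elim (auto simp: s_def)
      thus "(\<lambda>n. s n t) \<longlonglongrightarrow> f t" by (rule tendsto_eventually)
    qed
    show "AE t in half_line. norm (s n t) \<le> norm (f t)" for n
      by (auto simp: s_def indicator_def)
  qed (use int sint in auto)
  moreover have "(\<lambda>n. F (real (Suc n)) - F (1 / real (Suc n))) \<longlonglongrightarrow> B - A"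
  proof (intro tendsto_diff)
    show "(\<lambda>n. F (real (Suc n))) \<longlonglongrightarrow> B"
      by (rule filterlim_compose[OF B])
         (rule filterlim_compose[OF filterlim_real_sequentially filterlim_Suc])
    show "(\<lambda>n. F (1 / real (Suc n))) \<longlonglongrightarrow> A"
    proof (rule filterlim_compose[OF A])
      show "filterlim (\<lambda>n. 1 / real (Suc n)) (at_right 0) sequentially"
        unfolding filterlim_at using LIMSEQ_inverse_real_of_nat
        by (simp add: inverse_eq_divide)
    qed
  qed
  ultimately show ?thesis using LIMSEQ_unique by simp
qed

text \<open>Links the two notions of integral in the development: the gauge integral over
  \<open>{0..D}\<close>, which occurs in the summation formula, and the Lebesgue integral over the
  open half line. The extra endpoint 0 is negligible.\<close>

lemma integral_Icc_tendsto_half_line: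
  fixes f :: "real \<Rightarrow> complex"
  assumes int: "integrable half_line f"
  shows "(\<lambda>D. integral {0..real D} f) \<longlonglongrightarrow> integral\<^sup>L half_line f"
proof -
  have "(\<lambda>D. integral\<^sup>L half_line (\<lambda>t. indicat_real {0<..real D} t *\<^sub>R f t)) \<longlonglongrightarrow> integral\<^sup>L half_line f"
  proof (rule integral_dominated_convergence[where w = "\<lambda>t. norm (f t)"])
    show "AE t in half_line. (\<lambda>D. indicat_real {0<..real D} t *\<^sub>R f t) \<longlonglongrightarrow> f t"
    proof (rule AE_I2)
      fix t :: real assume "t \<in> space half_line"
      hence t: "t > 0" by simp
      have "eventually (\<lambda>D. real D \<ge> t) sequentially"
        by (metis (mono_tags, lifting) eventually_sequentiallyI nat_ceiling_le_eq)
      hence "eventually (\<lambda>D. indicat_real {0<..real D} t *\<^sub>R f t = f t) sequentially"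
        by eventually_elim (use t in auto)
      thus "(\<lambda>D. indicat_real {0<..real D} t *\<^sub>R f t) \<longlonglongrightarrow> f t"
        by (rule tendsto_eventually)
    qed
    show "(\<lambda>t. indicat_real {0<..real D} t *\<^sub>R f t) \<in> borel_measurable half_line" for D
      by (intro borel_measurable_integrable integrable_mult_indicator int) (auto simp: sets_restrict_space_iff)
  qed (use int in \<open>auto simp: indicator_def\<close>)
  also have "(\<lambda>D. integral\<^sup>L half_line (\<lambda>t. indicat_real {0<..real D} t *\<^sub>R f t)) =
      (\<lambda>D. integral {0..real D} f)"
  proof
    fix D
    let ?g = "\<lambda>t. indicat_real {0<..real D} t *\<^sub>R f t"
    have "integrable half_line ?g"
      using int by (intro integrable_mult_indicator) (auto simp: sets_restrict_space_iff)
    hence "(?g has_integral integral\<^sup>L half_line ?g) {0<..}"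
      by (rule has_integral_integral_lebesgue_on) auto
    hence "((\<lambda>t. if t \<in> {0<..real D} then f t else 0) has_integral integral\<^sup>L half_line ?g) {0<..}"
      by (rule has_integral_eq[rotated]) auto
    hence "(f has_integral integral\<^sup>L half_line ?g) {0<..real D}"
      by (subst (asm) has_integral_restrict) auto
    hence "(f has_integral integral\<^sup>L half_line ?g) {0..real D}"
      by (subst has_integral_spike_set_eq[where T = "{0<..real D}"]) (auto intro: negligible_subset[of "{0}"])
    thus "integral\<^sup>L half_line ?g = integral {0..real D} f"
      by (rule integral_unique[symmetric])
  qed
  finally show ?thesis .
qed

text \<open>Half of the exponential decay pays for the factor \<open>t\<close>, since
  \<open>c * t / 2 \<le> exp (c * t / 2)\<close>.\<close>

lemma mult_exp_le:
  fixes c t :: real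
  assumes "c > 0"
  shows "t * exp (- (c * t)) \<le> 2 / c * exp (- (c / 2 * t))"
proof -
  have "c * t / 2 \<le> exp (c * t / 2)"
    using exp_ge_add_one_self[of "c * t / 2"] by linarith
  hence "t \<le> 2 / c * exp (c * t / 2)" using assms by (simp add: field_simps)
  hence "t * exp (- (c * t)) \<le> 2 / c * exp (c * t / 2) * exp (- (c * t))"
    by (intro mult_right_mono) auto
  also have "\<dots> = 2 / c * exp (- (c / 2 * t))"
    by (simp add: mult_exp_exp field_simps)
  finally show ?thesis .
qed

text \<open>Mean value inequality on the disc of radius \<open>Re b / 2\<close> about
  \<open>b\<close>, where real parts are at least \<open>Re b / 2\<close>. The derivative brings
  down a factor \<open>t\<close>; absorbing it by \<open>mult_exp_le\<close> halves the rate again,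
  whence \<open>4 / Re b\<close> and \<open>Re b / 4\<close>.\<close>

lemma norm_exp_diff_le:
  fixes x b :: complex and t :: real
  assumes "t > 0" "Re b > 0" "norm (x - b) \<le> Re b / 2"
  shows "norm (exp (- (x * of_real t)) - exp (- (b * of_real t)))
    \<le> 4 / Re b * exp (- (Re b / 4 * t)) * norm (x - b)"
proof -
  have "norm (exp (- (x * of_real t)) - exp (- (b * of_real t)))
    \<le> (t * exp (- (Re b / 2 * t))) * norm (x - b)"
  proof (rule field_differentiable_bound[of "cball b (Re b / 2)" _ "\<lambda>z. - of_real t * exp (- (z * of_real t))"])
    fix z assume z: "z \<in> cball b (Re b / 2)"
    show "((\<lambda>z. exp (- (z * of_real t))) has_field_derivative - of_real t * exp (- (z * of_real t)))
        (at z within cball b (Re b / 2))"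
      by (auto intro!: derivative_eq_intros)
    have "Re b - Re z \<le> Re b / 2"
      using z complex_Re_le_cmod[of "b - z"] by (auto simp: dist_norm)
    hence "Re b / 2 * t \<le> Re z * t" using assms by (intro mult_right_mono) auto
    thus "norm (- of_real t * exp (- (z * of_real t))) \<le> t * exp (- (Re b / 2 * t))"
      using assms by (simp add: norm_mult)
  qed (use assms in \<open>auto simp: dist_norm norm_minus_commute\<close>)
  also have "\<dots> \<le> 4 / Re b * exp (- (Re b / 4 * t)) * norm (x - b)"
    using mult_exp_le[of "Re b / 2" t] assms by (intro mult_right_mono) auto
  finally show ?thesis .
qed

text \<open>Differentiation under the integral sign. The difference quotients have the common
  integrable majorant supplied by \<open>norm_exp_diff_le\<close>, so dominated convergence applies
  along every sequence tending to \<open>b\<close>.\<close>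

lemma has_field_derivative_laplace_transform:
  fixes f :: "real \<Rightarrow> complex" and b :: complex
  assumes int: "\<And>c. c > 0 \<Longrightarrow> integrable half_line (\<lambda>t. f t * exp (- (of_real c * of_real t)))"
    and cont: "continuous_on {0<..} f"
    and b: "Re b > 0"
  shows "((\<lambda>b. integral\<^sup>L half_line (\<lambda>t. f t * exp (- (b * of_real t)))) has_field_derivative
           integral\<^sup>L half_line (\<lambda>t. f t * (- of_real t * exp (- (b * of_real t))))) (at b)"
proof -
  have int': "integrable half_line (\<lambda>t. f t * exp (- (b * of_real t)))" if "Re b > 0" for b
  proof (rule integrable_half_line_continuous_bound[OF _ integrable_norm[OF int[OF that]]])
    show "continuous_on {0<..} (\<lambda>t. f t * exp (- (b * of_real t)))"
      by (intro continuous_intros cont)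
  qed (auto simp: norm_mult)
  define D where "D = integral\<^sup>L half_line (\<lambda>t. f t * (- of_real t * exp (- (b * of_real t))))"
  let ?L = "\<lambda>b. integral\<^sup>L half_line (\<lambda>t. f t * exp (- (b * of_real t)))"
  have "((\<lambda>x. (?L x - ?L b) / (x - b)) \<longlongrightarrow> D) (at b)"
    unfolding tendsto_at_iff_sequentially
  proof (intro allI impI)
    fix X :: "nat \<Rightarrow> complex" assume X: "\<forall>i. X i \<in> UNIV - {b}" "X \<longlonglongrightarrow> b"
    have "eventually (\<lambda>n. dist (X n) b < Re b / 2) sequentially"
      using X(2) b tendstoD[of X b sequentially "Re b / 2"] by simp
    then obtain N where N: "\<And>n. n \<ge> N \<Longrightarrow> dist (X n) b < Re b / 2"
      by (auto simp: eventually_sequentially)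
    \<comment> \<open>The index is shifted by \<open>N\<close> so that all points lie in the disc
      where the majorant is valid.\<close>
    define q where "q = (\<lambda>n t. f t * ((exp (- (X (n + N) * of_real t)) - exp (- (b * of_real t))) / (X (n + N) - b)))"
    have RX: "Re (X (n + N)) > 0" for n
      using N[of "n + N"] complex_Re_le_cmod[of "b - X (n + N)"] b by (auto simp: dist_norm norm_minus_commute)
    have nX: "norm (X (n + N) - b) > 0" for n using X(1) by auto
    have "(\<lambda>n. integral\<^sup>L half_line (q n)) \<longlonglongrightarrow> D"
      unfolding D_def
    proof (rule integral_dominated_convergence[where w = "\<lambda>t. 4 / Re b * norm (f t * exp (- (of_real (Re b / 4) * of_real t)))"])
      show "(\<lambda>t. f t * (- of_real t * exp (- (b * of_real t)))) \<in> borel_measurable half_line"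
        by (rule continuous_imp_measurable_on_sets_lebesgue) (auto intro!: continuous_intros cont)
      show "q n \<in> borel_measurable half_line" for n
        unfolding q_def using nX[of n]
        by (intro continuous_imp_measurable_on_sets_lebesgue) (auto intro!: continuous_intros cont)
      show "integrable half_line (\<lambda>t. 4 / Re b * norm (f t * exp (- (of_real (Re b / 4) * of_real t))))"
        using b by (intro integrable_mult_right integrable_norm int) auto
      show "AE t in half_line. norm (q n t) \<le> 4 / Re b * norm (f t * exp (- (of_real (Re b / 4) * of_real t)))" for n
      proof (rule AE_I2)
        fix t :: real assume "t \<in> space half_line"
        hence t: "t > 0" by simp
        have "norm (exp (- (X (n + N) * of_real t)) - exp (- (b * of_real t)))
            \<le> 4 / Re b * exp (- (Re b / 4 * t)) * norm (X (n + N) - b)"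
          using N[of "n + N"] t b by (intro norm_exp_diff_le) (auto simp: dist_norm)
        hence "norm (exp (- (X (n + N) * of_real t)) - exp (- (b * of_real t))) / norm (X (n + N) - b)
            \<le> 4 / Re b * exp (- (Re b / 4 * t))"
          using nX[of n] by (simp add: pos_divide_le_eq)
        from mult_left_mono[OF this, of "norm (f t)"]
        show "norm (q n t) \<le> 4 / Re b * norm (f t * exp (- (of_real (Re b / 4) * of_real t)))"
          by (simp add: q_def norm_mult norm_divide mult_ac)
      qed
      show "AE t in half_line. (\<lambda>n. q n t) \<longlonglongrightarrow> f t * (- of_real t * exp (- (b * of_real t)))"
      proof (rule AE_I2)
        fix t :: real
        have "((\<lambda>z. exp (- (z * of_real t))) has_field_derivative - of_real t * exp (- (b * of_real t))) (at b)"
          by (auto intro!: derivative_eq_intros)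
        hence "((\<lambda>z. (exp (- (z * of_real t)) - exp (- (b * of_real t))) / (z - b)) \<longlongrightarrow>
            - of_real t * exp (- (b * of_real t))) (at b)"
          by (simp add: has_field_derivative_iff)
        hence "(\<lambda>n. (exp (- (X n * of_real t)) - exp (- (b * of_real t))) / (X n - b))
            \<longlonglongrightarrow> - of_real t * exp (- (b * of_real t))"
          using X unfolding tendsto_at_iff_sequentially o_def by blast
        from LIMSEQ_ignore_initial_segment[OF this, of N]
        show "(\<lambda>n. q n t) \<longlonglongrightarrow> f t * (- of_real t * exp (- (b * of_real t)))"
          unfolding q_def by (intro tendsto_mult tendsto_const)
      qed
    qed
    also have "(\<lambda>n. integral\<^sup>L half_line (q n)) = (\<lambda>n. (?L (X (n + N)) - ?L b) / (X (n + N) - b))"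
      unfolding q_def using int'[OF RX] int'[OF b]
      by (simp add: algebra_simps diff_divide_distrib)
    finally show "((\<lambda>x. (?L x - ?L b) / (x - b)) \<circ> X) \<longlonglongrightarrow> D"
      unfolding o_def by (rule LIMSEQ_offset)
  qed
  thus ?thesis by (simp add: has_field_derivative_iff D_def)
qed

lemma tendsto_suminf_dominated:
  fixes a :: "nat \<Rightarrow> 'b \<Rightarrow> 'a :: {real_normed_algebra, banach}"
  assumes lim: "\<And>k. ((\<lambda>n. a k n) \<longlongrightarrow> b k) F"
    and bound: "eventually (\<lambda>n. \<forall>k. norm (a k n) \<le> M k) F"
    and "summable M" and "F \<noteq> bot"
  shows "((\<lambda>n. \<Sum>k. a k n) \<longlongrightarrow> suminf b) F"
proof -
  have "eventually (\<lambda>(k, n). norm (a k n) \<le> M k) (at_top \<times>\<^sub>F F)"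
    unfolding eventually_prod_filter
    by (intro exI[of _ "\<lambda>_. True"] exI[of _ "\<lambda>n. \<forall>k. norm (a k n) \<le> M k"]) (use bound in auto)
  note T = tannerys_theorem[where a = a and b = b and F = F and M = M, OF lim this assms(3,4)]
  show ?thesis by (rule conjunct2[OF conjunct2[OF T]])
qed

section \<open>Abel means of the sawtooth Fourier series\<close>

text \<open>Imaginary part of the logarithm series. These are the Abel means of the Fourier series
  of \<open>pi * (1 / 2 - frac t)\<close>; for \<open>r < 1\<close> the series converges
  geometrically and may be integrated term by term.\<close>

lemma sawtooth_series:
  fixes r t :: real
  assumes "0 \<le> r" "r < 1"
  shows "(\<lambda>m. r ^ Suc m * sin (2 * pi * real (Suc m) * t) / real (Suc m)) sums
           (- Im (Ln (1 - of_real r * exp (2 * of_real pi * \<i> * of_real t))))"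
proof -
  define z where "z = of_real r * exp (2 * of_real pi * \<i> * of_real t)"
  have z: "norm (- z) < 1" using assms by (simp add: z_def norm_mult)
  from Ln_series'[OF z] have "(\<lambda>n. Im (- (z ^ n) / of_nat n)) sums Im (ln (1 - z))"
    by (intro sums_Im) simp
  hence "(\<lambda>n. - Im (- (z ^ n) / of_nat n)) sums (- Im (ln (1 - z)))"
    by (rule sums_minus)
  hence "(\<lambda>n. - Im (- (z ^ Suc n) / of_nat (Suc n))) sums (- Im (ln (1 - z)))"
    by (subst sums_Suc_iff) simp
  moreover have "- Im (- (z ^ Suc n) / of_nat (Suc n)) = r ^ Suc n * sin (2 * pi * real (Suc n) * t) / real (Suc n)" for n
  proof -
    have "z ^ Suc n = of_real (r ^ Suc n) * exp (\<i> * of_real (2 * pi * real (Suc n) * t))"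
      unfolding z_def power_mult_distrib exp_of_nat_mult[symmetric] of_real_power
      by (simp add: mult_ac del: power_Suc)
    hence "Im (z ^ Suc n) = r ^ Suc n * sin (2 * pi * real (Suc n) * t)"
      by (simp add: Im_exp del: power_Suc of_nat_Suc)
    thus ?thesis by (simp add: Im_divide_of_nat del: power_Suc of_nat_Suc)
  qed
  ultimately show ?thesis by (simp only: z_def)
qed

text \<open>For \<open>norm z < 1\<close> the point \<open>1 - z\<close> lies in the right half
  plane, so its argument is at most \<open>pi / 2\<close>. The bound is uniform in \<open>r\<close>,
  as dominated convergence for \<open>r\<close> tending to 1 requires.\<close>

lemma sawtooth_bound:
  fixes r t :: real
  assumes "0 \<le> r" "r < 1"
  shows "\<bar>Im (Ln (1 - of_real r * exp (2 * of_real pi * \<i> * of_real t)))\<bar> \<le> pi / 2"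
proof -
  define z where "z = of_real r * exp (2 * of_real pi * \<i> * of_real t)"
  have z: "norm z < 1" using assms by (simp add: z_def norm_mult)
  hence "Re (1 - z) > 0" using complex_Re_le_cmod[of z] by simp
  thus ?thesis
    using Re_Ln_pos_lt_imp[of "1 - z"] by (simp add: z_def)
qed

lemma sawtooth_limit:
  assumes "t \<notin> \<int>"
  shows "((\<lambda>r. Im (Ln (1 - of_real r * exp (2 * of_real pi * \<i> * of_real t)))) \<longlongrightarrow>
           pi * (frac t - 1 / 2)) (at_left 1)"
proof -
  define e where "e = exp (2 * of_real pi * \<i> * of_real t)"
  define \<theta> where "\<theta> = frac t"
  have \<theta>: "0 < \<theta>" "\<theta> < 1"
    using assms frac_ge_0[of t] frac_lt_1[of t] frac_eq_0_iff[of t] by (auto simp: \<theta>_def less_le)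
  have e: "e = exp (\<i> * of_real (2 * pi * \<theta>))"
  proof -
    have "exp (\<i> * of_real (2 * pi * \<theta>)) =
        exp (2 * of_real pi * \<i> * of_real t + \<i> * (of_int (- \<lfloor>t\<rfloor>) * (of_real pi * 2)))"
      by (rule arg_cong[where f = exp]) (simp add: \<theta>_def frac_def algebra_simps)
    also have "\<dots> = e"
      unfolding e_def by (rule exp_plus_2pin)
    finally show ?thesis ..
  qed
  have s: "sin (pi * \<theta>) > 0" using \<theta> by (intro sin_gt_zero) auto
  \<comment> \<open>Polar form of the chord from the point \<open>e\<close> of the unit circle to 1.
    Its argument \<open>pi * \<theta> - pi / 2\<close> lies in the principal range, so the logarithm
    can be read off.\<close>
  have "1 - e = of_real (2 * sin (pi * \<theta>)) * exp (\<i> * of_real (pi * \<theta> - pi / 2))"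
  proof (rule complex_eqI)
    have "1 - cos (2 * (pi * \<theta>)) = 2 * sin (pi * \<theta>) * sin (pi * \<theta>)"
      by (simp only: cos_double_sin power2_eq_square)
    thus "Re (1 - e) = Re (of_real (2 * sin (pi * \<theta>)) * exp (\<i> * of_real (pi * \<theta> - pi / 2)))"
      by (simp add: e Re_exp cos_diff mult_ac)
    show "Im (1 - e) = Im (of_real (2 * sin (pi * \<theta>)) * exp (\<i> * of_real (pi * \<theta> - pi / 2)))"
      using sin_double[of "pi * \<theta>"] by (simp add: e Im_exp sin_diff mult_ac)
  qed
  hence "Ln (1 - e) = of_real (ln (2 * sin (pi * \<theta>))) + \<i> * of_real (pi * \<theta> - pi / 2)"
  proof -
    have "pi * \<theta> \<le> pi * 1" "pi * \<theta> > 0" using \<theta> by auto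
    hence b: "- pi < pi * \<theta> - pi / 2" "pi * \<theta> - pi / 2 \<le> pi" using pi_gt_zero by linarith+
    have "Ln (of_real (2 * sin (pi * \<theta>))) = of_real (ln (2 * sin (pi * \<theta>)))"
      using s by (intro Ln_of_real) auto
    moreover have "Ln (exp (\<i> * of_real (pi * \<theta> - pi / 2))) = \<i> * of_real (pi * \<theta> - pi / 2)"
      using b by (intro Ln_exp) auto
    ultimately show ?thesis
      unfolding \<open>1 - e = _\<close> using s by (subst Ln_times_of_real) auto
  qed
  from arg_cong[OF this, of Im] have L: "Im (Ln (1 - e)) = pi * (\<theta> - 1 / 2)"
    by (simp add: right_diff_distrib)
  \<comment> \<open>\<open>Re e < 1\<close> keeps \<open>1 - e\<close> off the branch cut, which
    makes the logarithm continuous there.\<close>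
  have "sin (pi * \<theta>) ^ 2 > 0" using s by simp
  hence "Re e < 1" by (simp add: e Re_exp cos_double_sin[of "pi * \<theta>"] mult.assoc)
  hence "1 - e \<notin> \<real>\<^sub>\<le>\<^sub>0" by (auto simp: complex_nonpos_Reals_iff)
  hence "((\<lambda>r. Im (Ln (1 - of_real r * e))) \<longlongrightarrow> Im (Ln (1 - of_real 1 * e))) (at_left 1)"
    by (intro tendsto_intros) auto
  thus ?thesis using L by (simp add: e_def \<theta>_def)
qed

section \<open>First-order Euler-Maclaurin formula and Poisson summation\<close>

text \<open>Integration by parts on each unit interval, where \<open>frac t = t - D\<close>.
  Differentiability is assumed only for \<open>t > 0\<close>, so that functions singular at 0 are
  covered; continuity on the closed half line makes up for it at the first interval.\<close>

lemma frac_weighted_integral: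
  fixes f f' :: "real \<Rightarrow> complex"
  assumes deriv: "\<And>t. t > 0 \<Longrightarrow> (f has_vector_derivative f' t) (at t)"
    and cont: "continuous_on {0..} f"
  shows "((\<lambda>t. frac t *\<^sub>R f' t) has_integral ((\<Sum>k=1..D. f (real k)) - integral {0..real D} f)) {0..real D}"
proof (induction D)
  case 0
  show ?case using has_integral_refl(2)[of "\<lambda>t. frac t *\<^sub>R f' t" 0] by simp
next
  case (Suc D)
  have c1: "continuous_on {real D..real (Suc D)} f"
    by (rule continuous_on_subset[OF cont]) auto
  have c0: "continuous_on {0..real (Suc D)} f"
    by (rule continuous_on_subset[OF cont]) auto
  define F where "F = (\<lambda>t. (t - real D) *\<^sub>R f t - integral {real D..t} f)"
  have "((\<lambda>t. (t - real D) *\<^sub>R f' t) has_integral (F (real (Suc D)) - F (real D))) {real D..real (Suc D)}"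
  proof (rule fundamental_theorem_of_calculus_interior)
    show "continuous_on {real D..real (Suc D)} F"
      unfolding F_def by (intro continuous_intros c1 indefinite_integral_continuous_1 integrable_continuous_real)
    fix t assume t: "t \<in> {real D<..<real (Suc D)}"
    have t0: "t > 0" using t by auto
    have "((\<lambda>t. integral {real D..t} f) has_vector_derivative f t) (at t within {real D..real (Suc D)})"
      by (rule integral_has_vector_derivative[OF c1]) (use t in auto)
    hence "((\<lambda>t. integral {real D..t} f) has_vector_derivative f t) (at t)"
      using t by (simp add: at_within_Icc_at)
    thus "(F has_vector_derivative (t - real D) *\<^sub>R f' t) (at t)"
      unfolding F_def by (auto intro!: derivative_eq_intros deriv[OF t0])
  qed auto
  hence "((\<lambda>t. (t - real D) *\<^sub>R f' t) has_integral (f (real (Suc D)) - integral {real D..real (Suc D)} f)) {real D..real (Suc D)}"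
    by (simp add: F_def)
  \<comment> \<open>At the right endpoint \<open>frac\<close> jumps back to 0; this single point is
    discarded.\<close>
  hence "((\<lambda>t. frac t *\<^sub>R f' t) has_integral (f (real (Suc D)) - integral {real D..real (Suc D)} f)) {real D..real (Suc D)}"
  proof (rule has_integral_spike_finite[rotated 2])
    fix t assume "t \<in> {real D..real (Suc D)} - {real (Suc D)}"
    hence "frac t = t - real D" by (subst frac_unique_iff) auto
    thus "frac t *\<^sub>R f' t = (t - real D) *\<^sub>R f' t" by simp
  qed auto
  from has_integral_combine[OF _ _ Suc.IH this] have
    "((\<lambda>t. frac t *\<^sub>R f' t) has_integral ((\<Sum>k=1..D. f (real k)) - integral {0..real D} f +
      (f (real (Suc D)) - integral {real D..real (Suc D)} f))) {0..real (Suc D)}" by simp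
  moreover have "integral {0..real D} f + integral {real D..real (Suc D)} f = integral {0..real (Suc D)} f"
    by (rule Henstock_Kurzweil_Integration.integral_combine) (use c0 in \<open>auto intro: integrable_continuous_real\<close>)
  ultimately show ?case by (simp add: algebra_simps)
qed

text \<open>Only \<open>f'\<close> has to be integrable, not \<open>f\<close>, which is why the
  conclusion is a limit of sum minus integral: the function behind S(a) decays like
  \<open>t powr (- 1 / 2)\<close>. For integrable \<open>f\<close>, integration by parts identifies
  \<open>c m\<close> as twice the cosine integral of \<open>f\<close> at frequency
  \<open>Suc m\<close>. In the proof \<open>frac\<close> is replaced by \<open>frac - 1 / 2\<close>,
  which is expanded into its Fourier series in the Abel sense.\<close>

theorem poisson_summation_half_line:
  fixes f f' :: "real \<Rightarrow> complex"
  assumes deriv: "\<And>t. t > 0 \<Longrightarrow> (f has_vector_derivative f' t) (at t)"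
    and cont: "continuous_on {0..} f" and f0: "f 0 = 0"
    and lim: "(f \<longlongrightarrow> 0) at_top"
    and int: "integrable half_line f'"
    and coeff: "\<And>m. integral\<^sup>L half_line (\<lambda>t. of_real (sin (2 * pi * real (Suc m) * t)) * f' t) = - (of_real pi * of_nat (Suc m) * c m)"
    and summable: "summable (\<lambda>m. norm (c m))"
  shows "(\<lambda>D. (\<Sum>k=1..D. f (real k)) - integral {0..real D} f) \<longlonglongrightarrow> (\<Sum>m. c m)"
proof -
  have meas: "f' \<in> borel_measurable half_line" using int by auto
  have fracint: "integrable half_line (\<lambda>t. frac t *\<^sub>R f' t)"
  proof (rule Bochner_Integration.integrable_bound[OF int])
    have "(\<lambda>t::real. frac t) \<in> borel_measurable half_line"
    proof (rule measurable_restrict_space1)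
      have "(\<lambda>t::real. frac t) \<in> borel_measurable lborel" unfolding frac_def by measurable
      thus "(\<lambda>t::real. frac t) \<in> borel_measurable lebesgue" by (rule measurable_completion)
    qed
    thus "(\<lambda>t. frac t *\<^sub>R f' t) \<in> borel_measurable half_line" using meas by measurable
    have "norm (frac t *\<^sub>R f' t) \<le> norm (f' t)" for t
      using frac_lt_1[of t] frac_ge_0[of t] by (auto intro: mult_left_le_one_le)
    thus "AE t in half_line. norm (frac t *\<^sub>R f' t) \<le> norm (f' t)" by auto
  qed
  \<comment> \<open>Since \<open>f\<close> vanishes at both ends, subtracting the constant 1/2 from
    \<open>frac\<close> does not change the integral against \<open>f'\<close>.\<close>
  have zero: "integral\<^sup>L half_line f' = 0"
  proof -
    have "(f \<longlongrightarrow> f 0) (at 0 within {0..})" using cont by (auto simp: continuous_on)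
    hence "(f \<longlongrightarrow> 0) (at_right 0)" unfolding f0 by (rule tendsto_within_subset) auto
    from integral_half_line_FTC[OF int deriv this lim] show ?thesis by simp
  qed
  have "integral {0..real D} (\<lambda>t. frac t *\<^sub>R f' t) = (\<Sum>k=1..D. f (real k)) - integral {0..real D} f" for D
    by (rule integral_unique[OF frac_weighted_integral[OF deriv cont]])
  with integral_Icc_tendsto_half_line[OF fracint] have lim1: "(\<lambda>D. (\<Sum>k=1..D. f (real k)) - integral {0..real D} f) \<longlonglongrightarrow>
      integral\<^sup>L half_line (\<lambda>t. frac t *\<^sub>R f' t)" by simp
  \<comment> \<open>A sequence increasing to 1, because dominated convergence is sequential; the
    double \<open>Suc\<close> keeps its members positive.\<close>
  define r where "r = (\<lambda>n. 1 - 1 / real (Suc (Suc n)))"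
  have r: "0 \<le> r n" "r n < 1" for n by (auto simp: r_def)
  have rlim: "r \<longlonglongrightarrow> 1"
  proof -
    have "(\<lambda>n. 1 - inverse (real (Suc (Suc n)))) \<longlonglongrightarrow> 1 - 0"
      by (intro tendsto_diff tendsto_const LIMSEQ_Suc[OF LIMSEQ_inverse_real_of_nat])
    thus ?thesis unfolding r_def by (simp add: inverse_eq_divide)
  qed
  have rleft: "filterlim r (at_left 1) sequentially"
    unfolding filterlim_at using rlim r by (auto intro!: always_eventually simp: less_le)
  define S where "S = (\<lambda>r t. Im (Ln (1 - of_real r * exp (2 * of_real pi * \<i> * of_real t))))"
  have ser: "(\<Sum>m. c m * r n ^ Suc m) = integral\<^sup>L half_line (\<lambda>t. (S (r n) t / pi) *\<^sub>R f' t)"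
    (is ?ser1) and ser_meas: "(\<lambda>t. (S (r n) t / pi) *\<^sub>R f' t) \<in> borel_measurable half_line" (is ?ser2) for n
  proof -
    let ?u = "\<lambda>m t. (- (r n ^ Suc m * sin (2 * pi * real (Suc m) * t) / real (Suc m)) / pi) *\<^sub>R f' t"
    have sinint: "integrable half_line (\<lambda>t. sin (2 * pi * real (Suc m) * t) *\<^sub>R f' t)" for m
    proof (rule Bochner_Integration.integrable_bound[OF int])
      have "(\<lambda>t. sin (2 * pi * real (Suc m) * t)) \<in> borel_measurable half_line"
        by (intro continuous_imp_measurable_on_sets_lebesgue continuous_intros) auto
      thus "(\<lambda>t. sin (2 * pi * real (Suc m) * t) *\<^sub>R f' t) \<in> borel_measurable half_line"
        using meas by (rule borel_measurable_scaleR)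
      show "AE t in half_line. norm (sin (2 * pi * real (Suc m) * t) *\<^sub>R f' t) \<le> norm (f' t)"
        by (auto intro!: mult_left_le_one_le abs_sin_le_one simp del: of_nat_Suc)
    qed
    have ueq: "?u m = (\<lambda>t. (- (r n ^ Suc m / real (Suc m)) / pi) *\<^sub>R (sin (2 * pi * real (Suc m) * t) *\<^sub>R f' t))" for m
      by (auto simp: fun_eq_iff)
    have uint: "integrable half_line (?u m)" for m
      unfolding ueq by (intro integrable_scaleR_right sinint)
    have ubound: "norm (?u m t) \<le> r n ^ Suc m * norm (f' t)" for m t
    proof -
      have "\<bar>sin (2 * pi * real (Suc m) * t)\<bar> / real (Suc m) / pi \<le> 1 / 1 / 1"
        using pi_gt3 by (intro frac_le abs_sin_le_one) auto
      hence "r n ^ Suc m * (\<bar>sin (2 * pi * real (Suc m) * t)\<bar> / real (Suc m) / pi) * norm (f' t) \<le> r n ^ Suc m * 1 * norm (f' t)"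
        using r(1)[of n] by (intro mult_right_mono mult_left_mono) auto
      thus ?thesis using r(1)[of n] by (simp add: abs_mult del: of_nat_Suc power_Suc)
    qed
    have geo: "summable (\<lambda>m. r n ^ Suc m)" using r[of n]
      by (subst summable_Suc_iff) (auto intro: summable_geometric)
    have AEs: "AE t in half_line. summable (\<lambda>m. norm (?u m t))"
      by (intro AE_I2 summable_comparison_test'[where N = 0, OF summable_mult2[OF geo]]) (use ubound in auto)
    have sums: "summable (\<lambda>m. \<integral>t. norm (?u m t) \<partial>half_line)"
    proof (rule summable_comparison_test'[where N = 0, OF summable_mult2[OF geo]])
      fix m :: nat
      have "(\<integral>t. norm (?u m t) \<partial>half_line) \<le> (\<integral>t. r n ^ Suc m * norm (f' t) \<partial>half_line)"
        using ubound by (intro integral_mono integrable_norm uint integrable_mult_right int) auto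
      thus "norm (\<integral>t. norm (?u m t) \<partial>half_line) \<le> r n ^ Suc m * (\<integral>t. norm (f' t) \<partial>half_line)"
        by simp
    qed
    have pt: "(\<Sum>m. ?u m t) = (S (r n) t / pi) *\<^sub>R f' t" for t
    proof -
      have "(\<lambda>m. ?u m t) sums ((S (r n) t / pi) *\<^sub>R f' t)"
        using sums_scaleR_left[OF sums_divide[OF sums_minus[OF sawtooth_series[OF r(1)[of n] r(2)[of n], of t]]]]
        by (simp add: S_def)
      thus ?thesis by (simp add: sums_iff)
    qed
    from integrable_suminf[OF uint AEs sums] show ?ser2 unfolding pt by (rule borel_measurable_integrable)
    have "integral\<^sup>L half_line (\<lambda>t. (S (r n) t / pi) *\<^sub>R f' t) = (\<Sum>m. integral\<^sup>L half_line (?u m))"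
      using integral_suminf[OF uint AEs sums] unfolding pt .
    also have "(\<lambda>m. integral\<^sup>L half_line (?u m)) = (\<lambda>m. c m * r n ^ Suc m)"
    proof
      fix m
      have "integral\<^sup>L half_line (\<lambda>t. sin (2 * pi * real (Suc m) * t) *\<^sub>R f' t) = - (of_real pi * of_nat (Suc m) * c m)"
        using coeff[of m] by (simp add: scaleR_conv_of_real)
      hence "integral\<^sup>L half_line (?u m) = (- (r n ^ Suc m / real (Suc m)) / pi) *\<^sub>R (- (of_real pi * of_nat (Suc m) * c m))"
        unfolding ueq by (simp only: integral_scaleR_right)
      thus "integral\<^sup>L half_line (?u m) = c m * r n ^ Suc m"
        by (simp add: scaleR_conv_of_real field_simps del: of_nat_Suc power_Suc)
    qed
    finally show ?ser1 ..
  qed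
  have "(\<lambda>n. integral\<^sup>L half_line (\<lambda>t. (S (r n) t / pi) *\<^sub>R f' t)) \<longlonglongrightarrow>
      integral\<^sup>L half_line (\<lambda>t. (frac t - 1 / 2) *\<^sub>R f' t)"
  proof (rule integral_dominated_convergence[where w = "\<lambda>t. norm (f' t)"])
    have "(\<lambda>t. frac t *\<^sub>R f' t - (1 / 2) *\<^sub>R f' t) \<in> borel_measurable half_line"
      using fracint int by measurable
    thus "(\<lambda>t. (frac t - 1 / 2) *\<^sub>R f' t) \<in> borel_measurable half_line"
      by (simp add: scaleR_diff_left)
    show "AE t in half_line. norm ((S (r n) t / pi) *\<^sub>R f' t) \<le> norm (f' t)" for n
    proof (rule AE_I2)
      fix t
      have "\<bar>S (r n) t\<bar> \<le> pi / 2" unfolding S_def by (rule sawtooth_bound[OF r])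
      hence "\<bar>S (r n) t / pi\<bar> \<le> 1" using pi_gt_zero by (simp add: field_simps)
      thus "norm ((S (r n) t / pi) *\<^sub>R f' t) \<le> norm (f' t)"
        unfolding norm_scaleR by (intro mult_left_le_one_le) auto
    qed
    have "AE t in lebesgue. t \<notin> (\<int>::real set)"
    proof (rule AE_not_in)
      show "\<int> \<in> null_sets (lebesgue :: real measure)"
        using countable_imp_null_set_lborel[OF countable_int] by (rule null_sets_completionI)
    qed
    hence "AE t in half_line. t \<notin> \<int>"
      by (subst AE_restrict_space_iff) auto
    thus "AE t in half_line. (\<lambda>n. (S (r n) t / pi) *\<^sub>R f' t) \<longlonglongrightarrow> (frac t - 1 / 2) *\<^sub>R f' t"
    proof eventually_elim
      case (elim t)
      have "(\<lambda>n. (S (r n) t / pi) *\<^sub>R f' t) \<longlonglongrightarrow> (pi * (frac t - 1 / 2) / pi) *\<^sub>R f' t"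
        unfolding S_def by (intro tendsto_intros filterlim_compose[OF sawtooth_limit[OF elim] rleft]) auto
      thus ?case by simp
    qed
  qed (use int ser_meas in auto)
  also have "integral\<^sup>L half_line (\<lambda>t. (frac t - 1 / 2) *\<^sub>R f' t) =
      integral\<^sup>L half_line (\<lambda>t. frac t *\<^sub>R f' t) - integral\<^sup>L half_line (\<lambda>t. (1 / 2) *\<^sub>R f' t)"
    unfolding scaleR_diff_left using fracint int by (intro Bochner_Integration.integral_diff) auto
  also have "integral\<^sup>L half_line (\<lambda>t. (1 / 2) *\<^sub>R f' t) = 0"
    using zero by simp
  finally have "(\<lambda>n. \<Sum>m. c m * r n ^ Suc m) \<longlonglongrightarrow> integral\<^sup>L half_line (\<lambda>t. frac t *\<^sub>R f' t)"
    using ser by simp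
  \<comment> \<open>Abel's limit is immediate here since the coefficients are absolutely summable
    and serve as their own majorant.\<close>
  moreover have "(\<lambda>n. \<Sum>m. c m * r n ^ Suc m) \<longlonglongrightarrow> (\<Sum>m. c m)"
  proof -
    have "norm (c m * r n ^ Suc m) \<le> norm (c m)" for m n
      using r[of n] by (auto simp: norm_mult norm_power intro!: mult_right_le_one_le mult_le_one power_le_one)
    moreover have "(\<lambda>n. c m * r n ^ Suc m) \<longlonglongrightarrow> c m * of_real (1 ^ Suc m)" for m
      by (intro tendsto_intros rlim)
    ultimately have "(\<lambda>n. \<Sum>m. c m * r n ^ Suc m) \<longlonglongrightarrow> (\<Sum>m. c m * of_real (1 ^ Suc m))"
      by (intro tendsto_suminf_dominated[OF _ _ summable] always_eventually allI sequentially_bot)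
    thus ?thesis by simp
  qed
  ultimately have "integral\<^sup>L half_line (\<lambda>t. frac t *\<^sub>R f' t) = (\<Sum>m. c m)"
    by (rule LIMSEQ_unique)
  with lim1 show ?thesis by simp
qed

section \<open>The Lipschitz summation formula\<close>

text \<open>The modulus of \<open>z powr w\<close> contains the factor
  \<open>exp (- Im w * Arg z)\<close>, and \<open>\<bar>Arg z\<bar> \<le> pi / 2\<close> in the
  closed right half plane. The imaginary axis is included because the terms of Lipschitz's formula
  are needed at \<open>y = 0\<close>.\<close>

lemma norm_powr_half_plane_le:
  assumes "Re z \<ge> 0" "z \<noteq> 0"
  shows "norm (z powr w) \<le> norm z powr Re w * exp (pi / 2 * \<bar>Im w\<bar>)"
proof -
  have "\<bar>Arg z\<bar> \<le> pi / 2"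
    using Re_Ln_pos_le[of z] assms by (simp add: Arg_eq_Im_Ln)
  hence "\<bar>Im w * Arg z\<bar> \<le> \<bar>Im w\<bar> * (pi / 2)"
    unfolding abs_mult by (intro mult_left_mono) auto
  hence "- Im w * Arg z \<le> pi / 2 * \<bar>Im w\<bar>" by (simp add: mult_ac)
  thus ?thesis by (auto simp: norm_powr_complex intro!: mult_left_mono)
qed

lemma not_nonpos_Int_half_plane: "Re z > 0 \<Longrightarrow> z \<notin> \<int>\<^sub>\<le>\<^sub>0"
  by (auto elim!: nonpos_Ints_cases)

section \<open>Gamma integrals with a complex rate\<close>

lemma integrable_powr_exp:
  fixes w c :: complex
  assumes "Re w > 0" "Re c > 0"
  shows "integrable half_line (\<lambda>t. of_real t powr (w - 1) * exp (- (c * of_real t)))"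
proof (rule integrable_half_line_continuous_bound)
  have "set_integrable lebesgue {0<..} (\<lambda>t. complex_of_real t powr (w - 1) / of_real (exp (Re c * t)))"
    by (rule absolutely_integrable_Gamma_integral) fact+
  hence "integrable half_line (\<lambda>t. complex_of_real t powr (w - 1) / of_real (exp (Re c * t)))"
    by (simp add: set_integrable_def integrable_restrict_space)
  thus "integrable half_line (\<lambda>t. norm (complex_of_real t powr (w - 1) / of_real (exp (Re c * t))))"
    by (rule integrable_norm)
  show "norm (of_real t powr (w - 1) * exp (- (c * of_real t))) \<le>
    norm (complex_of_real t powr (w - 1) / of_real (exp (Re c * t)))" for t
  proof -
    have "norm (exp (- (c * of_real t))) = inverse (exp (Re c * t))" by (simp flip: exp_minus)
    thus ?thesis by (simp add: norm_mult norm_divide divide_inverse norm_inverse)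
  qed
qed (auto intro!: continuous_intros)

lemma powr_exp_tendsto_0:
  fixes w c :: complex
  assumes "Re w > 0"
  shows "((\<lambda>t. of_real t powr w * exp (- (c * of_real t))) \<longlongrightarrow> 0) (at_right 0)"
    and "Re c > 0 \<Longrightarrow> ((\<lambda>t. of_real t powr w * exp (- (c * of_real t))) \<longlongrightarrow> 0) at_top"
proof -
  have "((\<lambda>t. t powr Re w * exp (- (Re c * t))) \<longlongrightarrow> 0 * exp (- (Re c * 0))) (at_right 0)"
  proof (intro tendsto_intros)
    show "((\<lambda>t. t powr Re w) \<longlongrightarrow> 0) (at_right 0)" using assms by real_asymp
  qed
  hence lim: "((\<lambda>t. t powr Re w * exp (- (Re c * t))) \<longlongrightarrow> 0) (at_right 0)" by simp
  have ev: "eventually (\<lambda>t. t powr Re w * exp (- (Re c * t)) = norm (of_real t powr w * exp (- (c * of_real t)))) (at_right 0)"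
    using eventually_at_right_less[of 0] by eventually_elim (simp add: norm_mult norm_powr_real_powr)
  from Lim_transform_eventually[OF lim ev]
  show "((\<lambda>t. of_real t powr w * exp (- (c * of_real t))) \<longlongrightarrow> 0) (at_right 0)"
    by (rule tendsto_norm_zero_cancel)
  assume c: "Re c > 0"
  have lim: "((\<lambda>t. t powr Re w * exp (- (Re c * t))) \<longlongrightarrow> 0) at_top" using assms c by real_asymp
  have ev: "eventually (\<lambda>t. t powr Re w * exp (- (Re c * t)) = norm (of_real t powr w * exp (- (c * of_real t)))) at_top"
    using eventually_gt_at_top[of 0] by eventually_elim (simp add: norm_mult norm_powr_real_powr)
  from Lim_transform_eventually[OF lim ev]
  show "((\<lambda>t. of_real t powr w * exp (- (c * of_real t))) \<longlongrightarrow> 0) at_top"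
    by (rule tendsto_norm_zero_cancel)
qed

lemma has_vector_derivative_powr_exp:
  fixes w c :: complex
  assumes "t > 0"
  shows "((\<lambda>t. of_real t powr w * exp (- (c * of_real t))) has_vector_derivative
     (w * of_real t powr (w - 1) * exp (- (c * of_real t)) - c * (of_real t powr w * exp (- (c * of_real t))))) (at t)"
proof -
  have "((\<lambda>z. z powr w * exp (- (c * z))) has_field_derivative
     (w * of_real t powr (w - 1) * exp (- (c * of_real t)) - c * (of_real t powr w * exp (- (c * of_real t))))) (at (of_real t))"
    using assms by (auto intro!: derivative_eq_intros simp: complex_nonpos_Reals_iff algebra_simps)
  from has_vector_derivative_real_field[OF this] show ?thesis by simp
qed

text \<open>Takes the place of a rotation of the contour. With \<open>I\<close> the integral for
  \<open>w\<close> and \<open>I'\<close> the one for \<open>w + 1\<close>, integration by parts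
  gives \<open>w * I c = c * I' c\<close>, and differentiation in \<open>c\<close> gives
  \<open>- I'\<close>. Hence \<open>I z * z powr w\<close> has derivative 0 on the right half plane,
  and its value is Euler's integral at \<open>z = 1\<close>.\<close>

theorem Gamma_integral_half_line:
  fixes w c :: complex
  assumes w: "Re w > 0" and c: "Re c > 0"
  shows "integral\<^sup>L half_line (\<lambda>t. of_real t powr (w - 1) * exp (- (c * of_real t))) = Gamma w * c powr (- w)"
proof -
  define I where "I = (\<lambda>c. integral\<^sup>L half_line (\<lambda>t. of_real t powr (w - 1) * exp (- (c * of_real t))))"
  define I' where "I' = (\<lambda>c. integral\<^sup>L half_line (\<lambda>t. of_real t powr w * exp (- (c * of_real t))))"
  have int': "integrable half_line (\<lambda>t. of_real t powr w * exp (- (c * of_real t)))" if "Re c > 0" for c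
    using integrable_powr_exp[of "w + 1" c] that w by simp
  have rec: "w * I c = c * I' c" if c: "Re c > 0" for c
  proof -
    let ?f = "\<lambda>t. w * of_real t powr (w - 1) * exp (- (c * of_real t)) - c * (of_real t powr w * exp (- (c * of_real t)))"
    note ints = integrable_mult_right[OF integrable_powr_exp[OF w c], of w]
      integrable_mult_right[OF int'[OF c], of c]
    have "integral\<^sup>L half_line ?f = 0 - 0"
      by (rule integral_half_line_FTC[OF _ has_vector_derivative_powr_exp powr_exp_tendsto_0(1)[OF w] powr_exp_tendsto_0(2)[OF w c]])
         (use Bochner_Integration.integrable_diff[OF ints] in \<open>simp add: mult.assoc\<close>)
    also have "integral\<^sup>L half_line ?f = w * I c - c * I' c"
      using Bochner_Integration.integral_diff[OF ints] by (simp add: I_def I'_def mult.assoc)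
    finally show ?thesis by simp
  qed
  have deriv: "(I has_field_derivative (- I' c)) (at c)" if c: "Re c > 0" for c
  proof -
    have "(I has_field_derivative integral\<^sup>L half_line (\<lambda>t. of_real t powr (w - 1) * (- of_real t * exp (- (c * of_real t))))) (at c)"
      unfolding I_def
      by (rule has_field_derivative_laplace_transform[OF integrable_powr_exp[OF w] _ c])
         (auto intro!: continuous_intros)
    also have "integral\<^sup>L half_line (\<lambda>t. of_real t powr (w - 1) * (- of_real t * exp (- (c * of_real t)))) =
        integral\<^sup>L half_line (\<lambda>t. - (of_real t powr w * exp (- (c * of_real t))))"
      by (intro Bochner_Integration.integral_cong) (auto simp: powr_diff)
    also have "\<dots> = - I' c" by (simp add: I'_def)
    finally show ?thesis .
  qed
  have "\<exists>C. \<forall>z\<in>{z. Re z > 0}. I z * z powr w = C"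
  proof (rule has_field_derivative_zero_constant)
    fix z assume "z \<in> {z. Re z > 0}"
    hence z: "Re z > 0" by simp
    hence nz: "z \<noteq> 0" by auto
    have "((\<lambda>z. I z * z powr w) has_field_derivative (- I' z * z powr w + I z * (w * z powr (w - 1)))) (at z)"
      using z by (auto intro!: derivative_eq_intros deriv simp: complex_nonpos_Reals_iff)
    also have "- I' z * z powr w + I z * (w * z powr (w - 1)) = (w * I z - z * I' z) * z powr w / z"
      using nz by (simp add: powr_diff field_simps)
    also have "\<dots> = 0" using rec[OF z] by simp
    finally show "((\<lambda>z. I z * z powr w) has_field_derivative 0) (at z within {z. Re z > 0})"
      by (rule has_field_derivative_at_within)
  qed (rule convex_halfspace_Re_gt)
  then obtain C where C: "\<And>z. Re z > 0 \<Longrightarrow> I z * z powr w = C" by auto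
  have "I 1 = Gamma w"
  proof -
    have "((\<lambda>t. of_real t powr (w - 1) * exp (- (1 * of_real t))) has_integral I 1) {0<..}"
      unfolding I_def by (intro has_integral_integral_lebesgue_on integrable_powr_exp w) auto
    moreover have "((\<lambda>t. of_real t powr (w - 1) * exp (- (1 * of_real t))) has_integral Gamma w) {0<..}"
      using Gamma_integral_complex'[OF w]
      by (simp add: exp_minus divide_inverse exp_of_real)
    ultimately show ?thesis by (rule has_integral_unique)
  qed
  with C[of 1] have "C = Gamma w" by simp
  moreover have "c \<noteq> 0" using c by auto
  ultimately show ?thesis using C[OF c] by (simp add: I_def powr_minus field_simps)
qed

section \<open>The exponential series and Lipschitz's formula\<close>

text \<open>The polylogarithm of order \<open>1 - w\<close> at \<open>exp (- z)\<close>, for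
  \<open>Re z > 0\<close>.\<close>

definition exp_series :: "complex \<Rightarrow> complex \<Rightarrow> complex" where
  "exp_series w z = (\<Sum>k. of_nat (Suc k) powr (w - 1) * exp (- (of_nat (Suc k) * z)))"

lemma summable_powr_exp_real:
  fixes a c :: real
  assumes "c > 0"
  shows "summable (\<lambda>k. real (Suc k) powr a * exp (- (c * real (Suc k))))"
proof (rule summable_comparison_test_bigo)
  show "summable (\<lambda>k. norm (1 / real k ^ 2))"
    using inverse_power_summable[of 2, where ?'a = real] by (simp add: divide_inverse)
  show "(\<lambda>k. real (Suc k) powr a * exp (- (c * real (Suc k)))) \<in> O(\<lambda>k. 1 / real k ^ 2)"
    using assms by real_asymp
qed

lemma summable_exp_series:
  assumes "Re z > 0"
  shows "summable (\<lambda>k. norm (of_nat (Suc k) powr (w - 1) * exp (- (of_nat (Suc k) * z))))"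
proof -
  have "norm (of_nat (Suc k) powr (w - 1) * exp (- (of_nat (Suc k) * z))) =
      real (Suc k) powr (Re w - 1) * exp (- (Re z * real (Suc k)))" for k
    by (simp add: norm_mult norm_powr_real_powr mult_ac del: of_nat_Suc)
  thus ?thesis using summable_powr_exp_real[OF assms, of "Re w - 1"] by simp
qed

lemma powr_nat_summable:
  fixes a :: real
  assumes "a > 1"
  shows "summable (\<lambda>m. real (Suc m) powr - a)"
  using summable_Suc_iff[of "\<lambda>m. real m powr - a"] summable_real_powr_iff[of "- a"] assms by simp

text \<open>\<open>norm z\<close> is at least \<open>\<bar>Im z\<bar> = 2 * pi * Suc m\<close>,
  hence at least \<open>Suc m\<close>, whatever \<open>y \<ge> 0\<close> is. This uniformity in
  \<open>y\<close> makes the later limits at 0 possible.\<close>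

lemma norm_lipschitz_term_le:
  fixes w :: complex and y :: real
  assumes "y \<ge> 0" "Re w \<ge> 0" "z = of_real y + 2 * of_real pi * \<i> * of_nat (Suc m) \<or> z = of_real y - 2 * of_real pi * \<i> * of_nat (Suc m)"
  shows "norm (z powr (- w)) \<le> real (Suc m) powr - Re w * exp (pi / 2 * \<bar>Im w\<bar>)"
proof -
  have Im: "\<bar>Im z\<bar> = 2 * pi * real (Suc m)" and Re: "Re z = y" using assms(3) by auto
  have nz: "z \<noteq> 0" using Im pi_gt_zero by force
  have "real (Suc m) \<le> 2 * pi * real (Suc m)" using pi_gt3 by (simp add: mult_left_le)
  also have "\<dots> \<le> norm z" using Im abs_Im_le_cmod[of z] by simp
  finally have "norm z powr - Re w \<le> real (Suc m) powr - Re w"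
    using assms by (intro powr_mono2') auto
  moreover have "norm (z powr (- w)) \<le> norm z powr Re (- w) * exp (pi / 2 * \<bar>Im (- w)\<bar>)"
    by (rule norm_powr_half_plane_le) (use Re assms nz in auto)
  ultimately show ?thesis
    by (smt (verit) exp_gt_zero mult_right_mono uminus_complex.sel)
qed

text \<open>The contribution of the two frequencies \<open>Suc m\<close> and \<open>- Suc m\<close>
  to Lipschitz's formula, up to the factor \<open>Gamma w\<close>. Frequency 0 contributes
  \<open>Gamma w * z powr (- w)\<close>, which is kept on the other side.\<close>

definition lipschitz_term :: "complex \<Rightarrow> complex \<Rightarrow> nat \<Rightarrow> complex" where
  "lipschitz_term w z m = (z + 2 * of_real pi * \<i> * of_nat (Suc m)) powr (- w) + (z - 2 * of_real pi * \<i> * of_nat (Suc m)) powr (- w)"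

lemma norm_lipschitz_term_sum_le:
  fixes w :: complex and y :: real
  assumes "y \<ge> 0" "Re w \<ge> 0"
  shows "norm (lipschitz_term w (of_real y) m) \<le> 2 * exp (pi / 2 * \<bar>Im w\<bar>) * real (Suc m) powr - Re w"
proof -
  note b = norm_lipschitz_term_le[OF assms, of _ m]
  have "norm (lipschitz_term w (of_real y) m) \<le>
      real (Suc m) powr - Re w * exp (pi / 2 * \<bar>Im w\<bar>) + real (Suc m) powr - Re w * exp (pi / 2 * \<bar>Im w\<bar>)"
    unfolding lipschitz_term_def by (rule norm_triangle_mono[OF b[OF disjI1[OF refl]] b[OF disjI2[OF refl]]])
  thus ?thesis by (simp add: mult_ac)
qed

text \<open>Poisson summation for \<open>t powr (w - 1) * exp (- y t)\<close>. The condition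
  \<open>Re w > 1\<close> makes this function vanish at 0 and its derivative integrable. The sine
  coefficients are Laplace transforms of the derivative at the imaginary points
  \<open>2 pi i (m + 1)\<close> and their negatives.\<close>

theorem lipschitz_formula:
  fixes w :: complex and y :: real
  assumes w: "Re w > 1" and y: "y > 0"
  shows "exp_series w (of_real y) - Gamma w * of_real y powr (- w) = Gamma w * (\<Sum>m. lipschitz_term w (of_real y) m)"
proof -
  define f where "f = (\<lambda>t::real. of_real t powr (w - 1) * exp (- (of_real y * of_real t)))"
  define f' where "f' = (\<lambda>t::real. (w - 1) * of_real t powr (w - 1 - 1) * exp (- (of_real y * of_real t)) - of_real y * (of_real t powr (w - 1) * exp (- (of_real y * of_real t))))"
  have w': "Re (w - 1) > 0" using w by simp
  have y': "Re (of_real y) > 0" using y by simp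
  have w0: "Re w > 0" using w by simp
  \<comment> \<open>Both terms of \<open>f'\<close> are Gamma integrals of rate
    \<open>y + b\<close>. By the functional equation of \<open>Gamma\<close> they are multiples
    \<open>y + b\<close> and \<open>- y\<close> of the same value, which leaves the factor
    \<open>b\<close>.\<close>
  have laplace: "integrable half_line (\<lambda>t. f' t * exp (- (b * of_real t)))"
    "integral\<^sup>L half_line (\<lambda>t. f' t * exp (- (b * of_real t))) = b * (Gamma w * (of_real y + b) powr (- w))"
    if b: "Re b = 0" for b
  proof -
    have yb: "Re (of_real y + b) > 0" using b y by simp
    hence yb0: "of_real y + b \<noteq> 0" by (metis less_irrefl zero_complex.sel(1))
    have eq: "(\<lambda>t. f' t * exp (- (b * of_real t))) = (\<lambda>t. (w - 1) * (of_real t powr (w - 1 - 1) * exp (- ((of_real y + b) * of_real t)))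
        - of_real y * (of_real t powr (w - 1) * exp (- ((of_real y + b) * of_real t))))"
    proof
      fix t :: real
      have ring: "(A * P * X - Y * (Q * X)) * Z = A * (P * (X * Z)) - Y * (Q * (X * Z))" for A P X Y Q Z :: complex
        by (simp add: algebra_simps)
      have E: "exp (- ((of_real y + b) * of_real t)) = exp (- (of_real y * of_real t)) * exp (- (b * of_real t))"
        by (simp add: mult_exp_exp algebra_simps)
      show "f' t * exp (- (b * of_real t)) = (w - 1) * (of_real t powr (w - 1 - 1) * exp (- ((of_real y + b) * of_real t)))
        - of_real y * (of_real t powr (w - 1) * exp (- ((of_real y + b) * of_real t)))"
        unfolding f'_def E by (rule ring)
    qed
    note ints = integrable_mult_right[OF integrable_powr_exp[OF w' yb], of "w - 1"]
       integrable_mult_right[OF integrable_powr_exp[OF w0 yb], of "of_real y"]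
    show "integrable half_line (\<lambda>t. f' t * exp (- (b * of_real t)))"
      unfolding eq by (rule Bochner_Integration.integrable_diff[OF ints])
    have "integral\<^sup>L half_line (\<lambda>t. f' t * exp (- (b * of_real t))) =
        (w - 1) * (Gamma (w - 1) * (of_real y + b) powr (- (w - 1))) - of_real y * (Gamma w * (of_real y + b) powr (- w))"
      unfolding eq Bochner_Integration.integral_diff[OF ints] integral_mult_right_zero
      by (simp only: Gamma_integral_half_line[OF w' yb] Gamma_integral_half_line[OF w0 yb])
    also have "(w - 1) * (Gamma (w - 1) * (of_real y + b) powr (- (w - 1))) =
        (of_real y + b) * (Gamma w * (of_real y + b) powr (- w))"
    proof -
      have "(w - 1) * Gamma (w - 1) = Gamma w"
        using Gamma_plus1[OF not_nonpos_Int_half_plane[OF w']] by simp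
      moreover have "(of_real y + b) powr (- (w - 1)) = (of_real y + b) * (of_real y + b) powr (- w)"
        using yb0 by (simp add: powr_diff powr_minus field_simps)
      moreover have "(w - 1) * (Gamma (w - 1) * (of_real y + b) powr (- (w - 1))) =
          ((w - 1) * Gamma (w - 1)) * (of_real y + b) powr (- (w - 1))" by (rule mult.assoc[symmetric])
      ultimately show ?thesis by (simp only: mult.left_commute)
    qed
    finally show "integral\<^sup>L half_line (\<lambda>t. f' t * exp (- (b * of_real t))) = b * (Gamma w * (of_real y + b) powr (- w))"
      by (simp only: left_diff_distrib distrib_right) simp
  qed
  have "(\<lambda>D. (\<Sum>k=1..D. f (real k)) - integral {0..real D} f) \<longlonglongrightarrow> (\<Sum>m. Gamma w * lipschitz_term w (of_real y) m)"
  proof (rule poisson_summation_half_line)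
    show "(f has_vector_derivative f' t) (at t)" if "t > 0" for t
      unfolding f_def f'_def by (rule has_vector_derivative_powr_exp[OF that])
    show f0: "f 0 = 0" by (simp add: f_def)
    show "continuous_on {0..} f"
      unfolding continuous_on
    proof
      fix t :: real assume t: "t \<in> {0..}"
      show "(f \<longlongrightarrow> f t) (at t within {0..})"
      proof (cases "t = 0")
        case True
        have "(f \<longlongrightarrow> 0) (at_right 0)" unfolding f_def by (rule powr_exp_tendsto_0(1)[OF w'])
        hence "(f \<longlongrightarrow> 0) (at 0 within {0..})"
          by (metis at_within_Ici_at_right)
        thus ?thesis using True f0 by simp
      next
        case False
        hence "isCont f t" using t unfolding f_def
          by (intro continuous_intros) (auto simp: complex_nonpos_Reals_iff)
        thus ?thesis unfolding isCont_def by (rule tendsto_within_subset) auto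
      qed
    qed
    show "(f \<longlongrightarrow> 0) at_top" unfolding f_def by (rule powr_exp_tendsto_0(2)[OF w' y'])
    show "integrable half_line f'" using laplace(1)[of 0] by simp
    show "summable (\<lambda>m. norm (Gamma w * lipschitz_term w (of_real y) m))"
      unfolding norm_mult
    proof (intro summable_mult summable_comparison_test'[where N = 0, OF summable_mult[OF powr_nat_summable[OF w]]])
      show "norm (norm (lipschitz_term w (of_real y) m)) \<le> 2 * exp (pi / 2 * \<bar>Im w\<bar>) * real (Suc m) powr - Re w" for m
        using norm_lipschitz_term_sum_le[of y w m] w y by simp
    qed
    fix m :: nat
    define b where "b = 2 * of_real pi * \<i> * of_nat (Suc m)"
    have b: "Re b = 0" "Re (- b) = 0" by (auto simp: b_def)
    have "integral\<^sup>L half_line (\<lambda>t. of_real (sin (2 * pi * real (Suc m) * t)) * f' t) =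
        integral\<^sup>L half_line (\<lambda>t. (f' t * exp (- ((- b) * of_real t)) - f' t * exp (- (b * of_real t))) / (2 * \<i>))"
    proof (intro Bochner_Integration.integral_cong refl)
      fix t
      have "of_real (sin (2 * pi * real (Suc m) * t)) = (exp (b * of_real t) - exp (- (b * of_real t))) / (2 * \<i>)"
        unfolding sin_of_real[symmetric] sin_exp_eq by (simp add: b_def mult_ac)
      thus "of_real (sin (2 * pi * real (Suc m) * t)) * f' t =
          (f' t * exp (- ((- b) * of_real t)) - f' t * exp (- (b * of_real t))) / (2 * \<i>)"
        by (simp add: algebra_simps)
    qed
    also have "\<dots> = ((- b) * (Gamma w * (of_real y + (- b)) powr (- w)) - b * (Gamma w * (of_real y + b) powr (- w))) / (2 * \<i>)"
      unfolding integral_divide_zero Bochner_Integration.integral_diff[OF laplace(1)[OF b(2)] laplace(1)[OF b(1)]]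
        laplace(2)[OF b(1)] laplace(2)[OF b(2)] ..
    also have "\<dots> = - (of_real pi * of_nat (Suc m) * (Gamma w * lipschitz_term w (of_real y) m))"
      unfolding lipschitz_term_def b_def by (simp add: field_simps)
    finally show "integral\<^sup>L half_line (\<lambda>t. of_real (sin (2 * pi * real (Suc m) * t)) * f' t) =
       - (of_real pi * of_nat (Suc m) * (Gamma w * lipschitz_term w (of_real y) m))" .
  qed
  moreover have "(\<lambda>D. (\<Sum>k=1..D. f (real k)) - integral {0..real D} f) \<longlonglongrightarrow> exp_series w (of_real y) - Gamma w * of_real y powr (- w)"
  proof (rule tendsto_diff)
    have "summable (\<lambda>k. f (real (Suc k)))"
      using summable_norm_cancel[OF summable_exp_series[OF y', of w]] by (simp add: f_def mult_ac)
    hence "(\<lambda>k. f (real (Suc k))) sums exp_series w (of_real y)"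
      unfolding exp_series_def f_def by (simp add: sums_iff mult_ac)
    thus "(\<lambda>D. \<Sum>k=1..D. f (real k)) \<longlonglongrightarrow> exp_series w (of_real y)"
      unfolding sums_def by (simp add: sum.atLeast1_atMost_eq)
    show "(\<lambda>D. integral {0..real D} f) \<longlonglongrightarrow> Gamma w * of_real y powr (- w)"
      using integral_Icc_tendsto_half_line[OF integrable_powr_exp[OF w0 y']]
      unfolding Gamma_integral_half_line[OF w0 y'] f_def .
  qed
  ultimately have "exp_series w (of_real y) - Gamma w * of_real y powr (- w) = (\<Sum>m. Gamma w * lipschitz_term w (of_real y) m)"
    by (intro LIMSEQ_unique)
  also have "\<dots> = Gamma w * (\<Sum>m. lipschitz_term w (of_real y) m)"
  proof (rule suminf_mult, rule summable_norm_cancel)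
    show "summable (\<lambda>m. norm (lipschitz_term w (of_real y) m))"
    proof (intro summable_comparison_test'[where N = 0, OF summable_mult[OF powr_nat_summable[OF w]]])
      show "norm (norm (lipschitz_term w (of_real y) m)) \<le> 2 * exp (pi / 2 * \<bar>Im w\<bar>) * real (Suc m) powr - Re w" for m
        using norm_lipschitz_term_sum_le[of y w m] w y by simp
    qed
  qed
  finally show ?thesis .
qed

section \<open>The damped sine series\<close>

text \<open>\<open>G\<close> is the error function up to the factor \<open>sqrt pi / 2\<close>,
  obtained by restricting an entire primitive of \<open>exp (- z^2)\<close> to the real axis. It is
  complex-valued so that it fits \<open>integral_half_line_FTC\<close>.\<close>

lemma gaussian_primitive:
  obtains G :: "real \<Rightarrow> complex" where
    "\<And>x. (G has_vector_derivative of_real (exp (- x\<^sup>2))) (at x)" "G 0 = 0"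
    "(G \<longlongrightarrow> of_real (sqrt pi / 2)) at_top" "(G \<longlongrightarrow> - of_real (sqrt pi / 2)) at_bot"
proof -
  have hol: "(\<lambda>z::complex. exp (- z\<^sup>2)) holomorphic_on UNIV" by (intro holomorphic_intros)
  obtain g where "\<And>z::complex. z \<in> UNIV \<Longrightarrow> (g has_field_derivative exp (- z\<^sup>2)) (at z within UNIV)"
    using holomorphic_convex_primitive'[OF convex_UNIV open_UNIV hol] by blast
  hence g: "(g has_field_derivative exp (- z\<^sup>2)) (at z)" for z by simp
  define G where "G = (\<lambda>x. g (of_real x) - g 0)"
  have deriv: "(G has_vector_derivative of_real (exp (- x\<^sup>2))) (at x)" for x
  proof -
    have "((\<lambda>z. g z - g 0) has_field_derivative of_real (exp (- x\<^sup>2))) (at (of_real x))"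
      using g[of "of_real x"] by (auto intro!: derivative_eq_intros simp flip: exp_of_real)
    from has_vector_derivative_real_field[OF this] show ?thesis by (simp add: G_def)
  qed
  have G0: "G 0 = 0" by (simp add: G_def)
  have odd: "G (- x) = - G x" for x
  proof -
    have "((\<lambda>x. G (- x) + G x) has_vector_derivative 0) (at x within UNIV)" for x
    proof -
      have "((G \<circ> (\<lambda>x. - x)) has_vector_derivative (- 1) *\<^sub>R of_real (exp (- (- x)\<^sup>2))) (at x)"
        by (intro vector_diff_chain_at deriv) (auto intro!: derivative_eq_intros)
      from has_vector_derivative_add[OF this deriv[of x]] show ?thesis by (simp add: o_def)
    qed
    then obtain c where "\<And>x. G (- x) + G x = c"
      using has_vector_derivative_zero_constant[of UNIV "\<lambda>x. G (- x) + G x"] by auto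
    from this[of x] this[of 0] show ?thesis by (simp add: G0 eq_neg_iff_add_eq_0)
  qed
  have top: "(G \<longlongrightarrow> of_real (sqrt pi / 2)) at_top"
  proof -
    have hb: "has_bochner_integral lborel (\<lambda>x. indicator {0..} x *\<^sub>R exp (- x\<^sup>2)) (sqrt pi / 2)"
      by (rule gaussian_moment_0)
    have "((\<lambda>y. \<integral>x. indicator {..y::real} x *\<^sub>R (indicator {0..} x *\<^sub>R exp (- x\<^sup>2)) \<partial>lborel) \<longlongrightarrow>
        (\<integral>x. indicator {0..} x *\<^sub>R exp (- x\<^sup>2) \<partial>lborel)) at_top"
      by (rule tendsto_integral_at_top) (use hb in \<open>auto simp: has_bochner_integral_iff\<close>)
    hence lim: "((\<lambda>y. \<integral>x. indicator {..y::real} x *\<^sub>R (indicator {0..} x *\<^sub>R exp (- x\<^sup>2)) \<partial>lborel) \<longlongrightarrow> sqrt pi / 2) at_top"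
      unfolding has_bochner_integral_integral_eq[OF hb] .
    have eq: "complex_of_real (\<integral>x. indicator {..y} x *\<^sub>R (indicator {0..} x *\<^sub>R exp (- x\<^sup>2)) \<partial>lborel) = G y"
      if y: "y \<ge> 0" for y
    proof -
      have "(\<integral>x. indicator {..y} x *\<^sub>R (indicator {0..} x *\<^sub>R exp (- x\<^sup>2)) \<partial>lborel) =
          (\<integral>x. indicator {0..y} x *\<^sub>R exp (- x\<^sup>2) \<partial>lborel)"
        by (intro Bochner_Integration.integral_cong) (auto simp: indicator_def)
      also have "complex_of_real \<dots> = (\<integral>x. of_real (indicator {0..y} x *\<^sub>R exp (- x\<^sup>2)) \<partial>lborel)"
        by (rule integral_complex_of_real[symmetric])
      also have "\<dots> = (\<integral>x. indicator {0..y} x *\<^sub>R of_real (exp (- x\<^sup>2)) \<partial>lborel)"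
        by (intro Bochner_Integration.integral_cong) (auto simp: indicator_def)
      also have "\<dots> = G y - G 0"
        by (rule integral_FTC_Icc[OF y])
           (auto intro!: has_vector_derivative_at_within deriv continuous_intros)
      finally show ?thesis by (simp add: G_def)
    qed
    have "eventually (\<lambda>y. of_real (\<integral>x. indicator {..y} x *\<^sub>R (indicator {0..} x *\<^sub>R exp (- x\<^sup>2)) \<partial>lborel) = G y) at_top"
      using eventually_ge_at_top[of 0] by eventually_elim (rule eq)
    from Lim_transform_eventually[OF tendsto_of_real[OF lim] this] show ?thesis .
  qed
  have "((\<lambda>x. - G (- x)) \<longlongrightarrow> - of_real (sqrt pi / 2)) at_bot"
    by (intro tendsto_minus filterlim_compose[OF top] filterlim_uminus_at_top_at_bot)
  hence bot: "(G \<longlongrightarrow> - of_real (sqrt pi / 2)) at_bot" by (simp add: odd)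
  show ?thesis by (rule that[OF deriv _ top bot]) (simp add: G_def)
qed

context
  fixes a :: real
  assumes a: "a > 0"
begin

lemma integrable_exp_inverse:
  assumes b: "Re b > 0"
  shows "integrable half_line (\<lambda>t. of_real (t powr (- 1 / 2) * exp (- a / t)) * exp (- (b * of_real t)))"
proof (rule integrable_half_line_continuous_bound[OF _ integrable_norm[OF integrable_powr_exp[of "1/2" b]]])
  show "norm (of_real (t powr (- 1 / 2) * exp (- a / t)) * exp (- (b * of_real t))) \<le>
      norm (of_real t powr (1 / 2 - 1) * exp (- (b * of_real t)))" if "t > 0" for t
  proof -
    have "norm (complex_of_real t powr (1 / 2 - 1)) = t powr (- 1 / 2)"
      using that by (simp add: norm_powr_real_powr)
    moreover have "t powr (- 1 / 2) * exp (- a / t) \<le> t powr (- 1 / 2) * 1"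
      using a that by (intro mult_left_mono) auto
    ultimately show ?thesis by (simp only: norm_mult norm_of_real abs_mult) (auto intro!: mult_right_mono simp: abs_mult)
  qed
qed (use b in \<open>auto intro!: continuous_intros\<close>)

text \<open>An explicit primitive exists. With \<open>p\<close> and \<open>q\<close> equal to
  \<open>sqrt (b t)\<close> plus and minus \<open>sqrt (a / t)\<close>, the squares are
  \<open>b t + a / t\<close> plus and minus \<open>E\<close>, so the factors \<open>exp E\<close>
  and \<open>exp (- E)\<close> in \<open>F\<close> restore the same exponential, and
  \<open>p' + q' = sqrt b / sqrt t\<close> produces the power of \<open>t\<close>. The result comes
  from the different limits of \<open>q\<close> at the two ends.\<close>

lemma integral_exp_inverse_real:
  assumes b: "b > (0 :: real)"
  shows "integral\<^sup>L half_line (\<lambda>t. complex_of_real (t powr (- 1 / 2) * exp (- a / t)) * exp (- (of_real b * of_real t))) =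
    complex_of_real (sqrt pi / sqrt b * exp (- 2 * sqrt a * sqrt b))"
proof -
  from gaussian_primitive obtain G :: "real \<Rightarrow> complex" where G:
    "\<And>x. (G has_vector_derivative of_real (exp (- x\<^sup>2))) (at x)"
    "(G \<longlongrightarrow> of_real (sqrt pi / 2)) at_top" "(G \<longlongrightarrow> - of_real (sqrt pi / 2)) at_bot" by metis
  define p where "p = (\<lambda>t. sqrt b * sqrt t + sqrt a / sqrt t)"
  define q where "q = (\<lambda>t. sqrt b * sqrt t - sqrt a / sqrt t)"
  define E where "E = 2 * sqrt a * sqrt b"
  define F where "F = (\<lambda>t. (1 / (2 * sqrt b)) *\<^sub>R (2 * exp E) *\<^sub>R G (p t) + (1 / (2 * sqrt b)) *\<^sub>R (2 * exp (- E)) *\<^sub>R G (q t))"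
  have sb: "sqrt b > 0" and sa: "sqrt a > 0" using a b by auto
  have deriv: "(F has_vector_derivative of_real (t powr (- 1 / 2) * exp (- a / t)) * exp (- (of_real b * of_real t))) (at t)"
    if t: "t > 0" for t
  proof -
    have st: "sqrt t > 0" "sqrt t * sqrt t = t" using t by auto
    define p' where "p' = sqrt b / (2 * sqrt t) - sqrt a / (2 * t * sqrt t)"
    define q' where "q' = sqrt b / (2 * sqrt t) + sqrt a / (2 * t * sqrt t)"
    have p': "(p has_vector_derivative p') (at t)"
      unfolding p_def p'_def has_real_derivative_iff_has_vector_derivative[symmetric]
      using t st by (auto intro!: derivative_eq_intros simp: field_simps)
    have q': "(q has_vector_derivative q') (at t)"
      unfolding q_def q'_def has_real_derivative_iff_has_vector_derivative[symmetric]
      using t st by (auto intro!: derivative_eq_intros simp: field_simps)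
    have sq: "(p t)\<^sup>2 = b * t + a / t + E" "(q t)\<^sup>2 = b * t + a / t - E"
      using a b t by (simp_all add: p_def q_def E_def power2_sum power2_diff power_mult_distrib power_divide)
    have "(F has_vector_derivative
        ((1 / (2 * sqrt b)) *\<^sub>R (2 * exp E) *\<^sub>R (p' *\<^sub>R of_real (exp (- (p t)\<^sup>2))) +
         (1 / (2 * sqrt b)) *\<^sub>R (2 * exp (- E)) *\<^sub>R (q' *\<^sub>R of_real (exp (- (q t)\<^sup>2))))) (at t)"
      unfolding F_def
      using vector_diff_chain_at[OF p' G(1)] vector_diff_chain_at[OF q' G(1)]
      unfolding o_def
      by (intro has_vector_derivative_add bounded_linear.has_vector_derivative[OF bounded_linear_scaleR_right])
    also have "(1 / (2 * sqrt b)) *\<^sub>R (2 * exp E) *\<^sub>R (p' *\<^sub>R of_real (exp (- (p t)\<^sup>2))) +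
         (1 / (2 * sqrt b)) *\<^sub>R (2 * exp (- E)) *\<^sub>R (q' *\<^sub>R complex_of_real (exp (- (q t)\<^sup>2))) =
         of_real ((1 / (2 * sqrt b)) * (2 * exp E) * (p' * exp (- (p t)\<^sup>2)) + (1 / (2 * sqrt b)) * (2 * exp (- E)) * (q' * exp (- (q t)\<^sup>2)))"
      by (simp add: scaleR_conv_of_real)
    also have "(1 / (2 * sqrt b)) * (2 * exp E) * (p' * exp (- (p t)\<^sup>2)) + (1 / (2 * sqrt b)) * (2 * exp (- E)) * (q' * exp (- (q t)\<^sup>2)) =
        exp (- a / t) * exp (- (b * t)) * ((p' + q') / sqrt b)"
    proof -
      have "exp (- (p t)\<^sup>2) = exp (- a / t) * exp (- (b * t)) * exp (- E)"
           "exp (- (q t)\<^sup>2) = exp (- a / t) * exp (- (b * t)) * exp E"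
        unfolding sq by (simp_all add: mult_exp_exp)
      moreover have "exp E * exp (- E) = 1" by (simp add: mult_exp_exp)
      hence "1 / (2 * S) * (2 * exp E) * (p' * (X * exp (- E))) + 1 / (2 * S) * (2 * exp (- E)) * (q' * (X * exp E)) = X * ((p' + q') / S)"
        if "S > 0" for S X :: real
        using that by (simp add: exp_minus field_simps)
      ultimately show ?thesis using sb by simp
    qed
    also have "(p' + q') / sqrt b = t powr (- 1 / 2)"
      using sb st t by (simp add: p'_def q'_def powr_minus powr_half_sqrt field_simps)
    also have "exp (- a / t) * exp (- (b * t)) * t powr (- 1 / 2) = t powr (- 1 / 2) * exp (- a / t) * exp (- (b * t))"
      by simp
    also have "of_real \<dots> = of_real (t powr (- 1 / 2) * exp (- a / t)) * exp (- (of_real b * complex_of_real t))"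
      by (simp flip: exp_of_real)
    finally show ?thesis .
  qed
  have lim0: "(F \<longlongrightarrow> (1 / (2 * sqrt b)) *\<^sub>R (2 * exp E) *\<^sub>R of_real (sqrt pi / 2) + (1 / (2 * sqrt b)) *\<^sub>R (2 * exp (- E)) *\<^sub>R (- of_real (sqrt pi / 2))) (at_right 0)"
  proof -
    have "filterlim p at_top (at_right 0)" unfolding p_def using sa sb by real_asymp
    moreover have "filterlim q at_bot (at_right 0)" unfolding q_def using sa sb by real_asymp
    ultimately show ?thesis unfolding F_def
      by (intro tendsto_intros filterlim_compose[OF G(2)] filterlim_compose[OF G(3)])
  qed
  have liminf: "(F \<longlongrightarrow> (1 / (2 * sqrt b)) *\<^sub>R (2 * exp E) *\<^sub>R of_real (sqrt pi / 2) + (1 / (2 * sqrt b)) *\<^sub>R (2 * exp (- E)) *\<^sub>R (of_real (sqrt pi / 2))) at_top"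
  proof -
    have "filterlim p at_top at_top" unfolding p_def using sa sb by real_asymp
    moreover have "filterlim q at_top at_top" unfolding q_def using sa sb by real_asymp
    ultimately show ?thesis unfolding F_def
      by (intro tendsto_intros filterlim_compose[OF G(2)])
  qed
  have "Re (of_real b) > 0" using b by simp
  from integral_half_line_FTC[OF integrable_exp_inverse[OF this] deriv lim0 liminf]
  have "integral\<^sup>L half_line (\<lambda>t. complex_of_real (t powr (- 1 / 2) * exp (- a / t)) * exp (- (of_real b * of_real t))) =
    of_real ((1 / (2 * sqrt b)) * (2 * exp E) * (sqrt pi / 2) + (1 / (2 * sqrt b)) * (2 * exp (- E)) * (sqrt pi / 2) -
      ((1 / (2 * sqrt b)) * (2 * exp E) * (sqrt pi / 2) - (1 / (2 * sqrt b)) * (2 * exp (- E)) * (sqrt pi / 2)))"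
    by (simp only: scaleR_conv_of_real) simp
  also have "(1 / (2 * sqrt b)) * (2 * exp E) * (sqrt pi / 2) + (1 / (2 * sqrt b)) * (2 * exp (- E)) * (sqrt pi / 2) -
      ((1 / (2 * sqrt b)) * (2 * exp E) * (sqrt pi / 2) - (1 / (2 * sqrt b)) * (2 * exp (- E)) * (sqrt pi / 2)) =
      sqrt pi / sqrt b * exp (- E)" by simp
  finally show ?thesis by (simp add: E_def)
qed

text \<open>Both sides are holomorphic in \<open>b\<close> for \<open>Re b > 0\<close> and agree on
  the positive reals, so the identity theorem extends the real case.\<close>

lemma integral_exp_inverse:
  assumes b: "Re b > 0"
  shows "integral\<^sup>L half_line (\<lambda>t. of_real (t powr (- 1 / 2) * exp (- a / t)) * exp (- (b * of_real t))) =
    of_real (sqrt pi) / csqrt b * exp (- 2 * of_real (sqrt a) * csqrt b)"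
proof -
  define J where "J = (\<lambda>b. integral\<^sup>L half_line (\<lambda>t. complex_of_real (t powr (- 1 / 2) * exp (- a / t)) * exp (- (b * of_real t))))"
  define H where "H = (\<lambda>b. complex_of_real (sqrt pi) / csqrt b * exp (- 2 * of_real (sqrt a) * csqrt b))"
  have "J z - H z = 0" if z: "z \<in> {z. Re z > 0}" for z
  proof (rule analytic_continuation[of "\<lambda>z. J z - H z" "{z. Re z > 0}" "complex_of_real ` {0<..}" 1])
    have "J holomorphic_on {z. Re z > 0}"
    proof (rule holomorphic_onI)
      fix z assume z: "z \<in> {z. Re z > 0}"
      hence z': "Re z > 0" by simp
      have "continuous_on {0<..} (\<lambda>t. complex_of_real (t powr (- 1 / 2) * exp (- a / t)))"
        by (intro continuous_intros) auto
      from has_field_derivative_laplace_transform[OF integrable_exp_inverse this z']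
      show "J field_differentiable at z within {z. Re z > 0}"
        unfolding J_def using field_differentiable_at_within field_differentiable_def by fastforce
    qed
    moreover have "H holomorphic_on {z. Re z > 0}"
      unfolding H_def by (intro holomorphic_intros) (auto simp: complex_nonpos_Reals_iff)
    ultimately show "(\<lambda>z. J z - H z) holomorphic_on {z. Re z > 0}" by (rule holomorphic_on_diff)
    show "open {z. Re z > 0}" by (rule open_halfspace_Re_gt)
    show "connected {z. Re z > 0}" by (intro convex_connected convex_halfspace_Re_gt)
    show "(1::complex) islimpt complex_of_real ` {0<..}"
      unfolding islimpt_sequential
    proof (intro exI[of _ "\<lambda>n. complex_of_real (1 + inverse (real (Suc n)))"] conjI allI)
      have "(\<lambda>n. complex_of_real (1 + inverse (real (Suc n)))) \<longlonglongrightarrow> complex_of_real (1 + 0)"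
        by (intro tendsto_intros LIMSEQ_inverse_real_of_nat)
      thus "(\<lambda>n. complex_of_real (1 + inverse (real (Suc n)))) \<longlonglongrightarrow> 1" by simp
      fix n
      have "1 + inverse (real (Suc n)) \<noteq> 1" "1 + inverse (real (Suc n)) > 0" by (auto simp: add_pos_pos)
      thus "complex_of_real (1 + inverse (real (Suc n))) \<in> complex_of_real ` {0<..} - {1}"
        by (metis DiffI greaterThan_iff imageI of_real_eq_1_iff singletonD)
    qed
    fix z assume "z \<in> complex_of_real ` {0<..}"
    then obtain b where b: "z = of_real b" "b > 0" by auto
    thus "J z - H z = 0"
      using integral_exp_inverse_real[of b] by (simp add: J_def H_def exp_of_real[symmetric] of_real_sqrt[symmetric])
  qed (use z in auto)
  thus ?thesis using b by (simp add: J_def H_def)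
qed

end

section \<open>Poisson summation for S(a)\<close>

lemma integrable_half_line_decay: "integrable half_line (\<lambda>t::real. (1 + t) powr (- 3 / 2))"
proof -
  have "set_integrable lborel (einterval 0 \<infinity>) (\<lambda>t. (1 + t) powr (- 3 / 2))"
  proof (rule interval_integral_FTC_nonneg(1))
    show "((\<lambda>t. - 2 * (1 + t) powr (- 1 / 2)) has_real_derivative (1 + t) powr (- 3 / 2)) (at t)"
      if "0 < ereal t" for t
      using that by (auto intro!: derivative_eq_intros)
    show "isCont (\<lambda>t. (1 + t) powr (- 3 / 2)) t" if "0 < ereal t" for t :: real
      using that by (intro continuous_intros) auto
    have "((\<lambda>t::real. - 2 * (1 + t) powr (- 1 / 2)) \<longlongrightarrow> - 2) (at_right 0)" by real_asymp
    thus "(((\<lambda>t. - 2 * (1 + t) powr (- 1 / 2)) \<circ> real_of_ereal) \<longlongrightarrow> - 2) (at_right 0)"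
      using ereal_tendsto_simps(2)[of "\<lambda>t::real. - 2 * (1 + t) powr (- 1 / 2)" "- 2" 0] by (simp add: zero_ereal_def)
    have "((\<lambda>t::real. - 2 * (1 + t) powr (- 1 / 2)) \<longlongrightarrow> 0) at_top" by real_asymp
    thus "(((\<lambda>t. - 2 * (1 + t) powr (- 1 / 2)) \<circ> real_of_ereal) \<longlongrightarrow> 0) (at_left \<infinity>)"
      by (simp add: ereal_tendsto_simps)
  qed auto
  also have "einterval 0 \<infinity> = {0<..}" by (auto simp: einterval_def)
  finally have "integrable lborel (\<lambda>t. indicat_real {0<..} t *\<^sub>R (1 + t) powr (- 3 / 2 :: real))"
    by (simp add: set_integrable_def)
  hence "integrable lebesgue (\<lambda>t. indicat_real {0<..} t *\<^sub>R (1 + t) powr (- 3 / 2 :: real))"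
    by (subst integrable_completion) auto
  thus ?thesis by (subst integrable_restrict_space) auto
qed

text \<open>The exponent 3 is what the bound on the derivative in \<open>f'_int\<close> consumes:
  two linear factors for the weight \<open>(1 + v) powr (3 / 2)\<close> and one for the factor
  \<open>a v - 1 / 2\<close>.\<close>

lemma cube_le_exp:
  fixes v :: real
  assumes "v \<ge> 0"
  shows "(1 + v / 3) ^ 3 \<le> exp v"
proof -
  have "(1 + v / 3) ^ 3 \<le> exp (v / 3) ^ 3"
    using assms by (intro power_mono) auto
  thus ?thesis by (simp add: exp_of_nat_mult[symmetric])
qed

definition damped_sine_series :: "real \<Rightarrow> real" where
  "damped_sine_series a = (\<Sum>m. sqrt 2 / sqrt (real (Suc m)) * exp (- 2 * sqrt (pi * a * real (Suc m))) *
     sin (pi / 4 - 2 * sqrt (pi * a * real (Suc m))))"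

text \<open>The exponential series dominates its single term of index \<open>2 * N\<close>; the even
  exponent removes the square root. This yields decay of S(a) faster than any power, in
  \<open>a\<close> and in the summation index alike.\<close>

lemma exp_sqrt_le:
  fixes a :: real
  assumes "a > 0" "x > 0"
  shows "exp (- 2 * sqrt (pi * a * x)) \<le> fact (2 * N) / (4 * pi * a * x) ^ N"
proof -
  define v where "v = 2 * sqrt (pi * a * x)"
  have v: "v > 0" using assms by (simp add: v_def)
  have "v ^ 2 = 4 * pi * a * x" using assms by (simp add: v_def power_mult_distrib)
  hence "v ^ (2 * N) = (4 * pi * a * x) ^ N" by (simp add: power_mult)
  moreover have "v ^ (2 * N) / fact (2 * N) \<le> exp v"
  proof -
    have "(\<Sum>n\<in>{2 * N}. v ^ n /\<^sub>R fact n) \<le> exp v"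
      unfolding exp_def using v by (intro sum_le_suminf summable_exp_generic) auto
    thus ?thesis by (simp add: divide_inverse mult_ac)
  qed
  ultimately have "(4 * pi * a * x) ^ N \<le> fact (2 * N) * exp v" by (simp add: field_simps)
  hence "exp (- v) \<le> fact (2 * N) / (4 * pi * a * x) ^ N" using assms by (simp add: exp_minus field_simps)
  thus ?thesis by (simp add: v_def)
qed

context
  fixes a :: real
  assumes a: "a > 0"
begin

text \<open>Not integrable at infinity, where it behaves like \<open>t powr (- 1 / 2)\<close>; its
  derivative \<open>f'\<close> is.\<close>

private definition f where "f = (\<lambda>t::real. complex_of_real (t powr (- 1 / 2) * exp (- a / t)))"
private definition f' where "f' = (\<lambda>t::real. complex_of_real (t powr (- 3 / 2) * exp (- a / t) * (a / t - 1 / 2)))"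

private lemma deriv:
  assumes t: "t > 0"
  shows "(f has_vector_derivative f' t) (at t)"
proof -
  have "((\<lambda>t. t powr (- 1 / 2) * exp (- a / t)) has_real_derivative
      (- 1 / 2 * t powr (- 1 / 2 - 1) * exp (- a / t) + t powr (- 1 / 2) * (exp (- a / t) * (a / t ^ 2)))) (at t)"
    using t by (auto intro!: derivative_eq_intros simp: power2_eq_square)
  also have "t powr (- 1 / 2) = t * t powr (- 3 / 2)"
    using t powr_add[of t 1 "- 3 / 2"] by simp
  also have "- 1 / 2 * t powr (- 1 / 2 - 1) * exp (- a / t) + t * t powr (- 3 / 2) * (exp (- a / t) * (a / t ^ 2)) =
      t powr (- 3 / 2) * exp (- a / t) * (a / t - 1 / 2)"
    using t by (simp add: field_simps power2_eq_square)
  finally show ?thesis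
    unfolding f_def f'_def by (rule has_vector_derivative_of_real[folded has_real_derivative_iff_has_vector_derivative])
qed

text \<open>By the convention \<open>0 powr _ = 0\<close>. It agrees with the limit at 0, where
  \<open>exp (- a / t)\<close> beats the power.\<close>

private lemma f0: "f 0 = 0" by (simp add: f_def)

private lemma lim0: "(f \<longlongrightarrow> 0) (at_right 0)"
proof -
  have "((\<lambda>t::real. t powr (- 1 / 2) * exp (- a / t)) \<longlongrightarrow> 0) (at_right 0)" using a by real_asymp
  from tendsto_of_real[OF this, where ?'a = complex] show ?thesis by (simp add: f_def)
qed

private lemma liminf: "(f \<longlongrightarrow> 0) at_top"
proof -
  have "((\<lambda>t::real. t powr (- 1 / 2) * exp (- a / t)) \<longlongrightarrow> 0) at_top" using a by real_asymp
  from tendsto_of_real[OF this, where ?'a = complex] show ?thesis by (simp add: f_def)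
qed

private lemma cont: "continuous_on {0..} f"
  unfolding continuous_on
proof
  fix t :: real assume t: "t \<in> {0..}"
  show "(f \<longlongrightarrow> f t) (at t within {0..})"
  proof (cases "t = 0")
    case True
    have "(f \<longlongrightarrow> 0) (at 0 within {0..})"
      using lim0 by (metis at_within_Ici_at_right)
    thus ?thesis using True f0 by simp
  next
    case False
    hence "isCont f t" using t deriv[of t]
      by (auto intro: has_vector_derivative_continuous)
    thus ?thesis unfolding isCont_def by (rule tendsto_within_subset) auto
  qed
qed

text \<open>One majorant covers both ends: \<open>f'\<close> decays like
  \<open>t powr (- 3 / 2)\<close> at infinity and exponentially in \<open>1 / t\<close> at 0. In
  terms of \<open>v = 1 / t\<close> the weight
  \<open>(1 + t) powr (3 / 2) * t powr (- 3 / 2)\<close> is \<open>(1 + v) powr (3 / 2)\<close>,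
  which \<open>exp (a v)\<close> dominates.\<close>

private lemma f'_int: "integrable half_line f'"
proof -
  \<comment> \<open>Chosen so that \<open>1 + v \<le> K * (1 + a * v / 3)\<close>, the form in which
    \<open>cube_le_exp\<close> applies.\<close>
  define K where "K = max 1 (3 / a)"
  show ?thesis
  proof (rule integrable_half_line_continuous_bound[OF _ integrable_mult_right[OF integrable_half_line_decay]])
    show "continuous_on {0<..} f'" unfolding f'_def by (intro continuous_intros) auto
    fix t :: real assume t: "t > 0"
    define v where "v = 1 / t"
    have v: "v > 0" using t by (simp add: v_def)
    have K: "K \<ge> 1" "K * a \<ge> 3"
      using a by (auto simp: K_def field_simps max_def)
    have v1: "1 + v \<le> K * (1 + a * v / 3)"
    proof -
      have "v * 1 \<le> v * (K * a / 3)" using K v by (intro mult_left_mono) auto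
      thus ?thesis using K by (simp add: algebra_simps)
    qed
    have "(1 + v) powr (3 / 2) \<le> (1 + v) powr 2" using v by (intro powr_mono) auto
    also have "\<dots> = (1 + v) ^ 2" using v by simp
    also have "\<dots> \<le> (K * (1 + a * v / 3)) ^ 2" using v1 v by (intro power_mono) auto
    finally have 1: "(1 + v) powr (3 / 2) \<le> K\<^sup>2 * (1 + a * v / 3)\<^sup>2" by (simp add: power_mult_distrib)
    have "0 \<le> a * v" using a v by simp
    hence 2: "\<bar>a * v - 1 / 2\<bar> \<le> 3 * (1 + a * v / 3)" by (simp add: abs_if)
    have "(1 + v) powr (3 / 2) * \<bar>a * v - 1 / 2\<bar> \<le> (K\<^sup>2 * (1 + a * v / 3)\<^sup>2) * (3 * (1 + a * v / 3))"
      using 1 2 by (intro mult_mono) auto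
    also have "\<dots> = 3 * K\<^sup>2 * (1 + a * v / 3) ^ 3" by (simp add: power2_eq_square power3_eq_cube)
    also have "\<dots> \<le> 3 * K\<^sup>2 * exp (a * v)"
      using cube_le_exp[of "a * v"] a v by (intro mult_left_mono) auto
    finally have "(1 + v) powr (3 / 2) * \<bar>a * v - 1 / 2\<bar> * exp (- (a * v)) \<le> 3 * K\<^sup>2"
      by (simp add: exp_minus field_simps)
    moreover have "(1 + v) powr (3 / 2) = (1 + t) powr (3 / 2) * t powr (- 3 / 2)"
    proof -
      have "1 + v = (1 + t) / t" using t by (simp add: v_def field_simps)
      thus ?thesis using t by (simp add: powr_divide powr_minus_divide)
    qed
    moreover have "norm (f' t) = t powr (- 3 / 2) * exp (- (a * v)) * \<bar>a * v - 1 / 2\<bar>"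
      unfolding f'_def norm_of_real abs_mult by (simp add: v_def)
    ultimately have "(1 + t) powr (3 / 2) * norm (f' t) \<le> 3 * K\<^sup>2"
      by (simp only: mult_ac)
    thus "norm (f' t) \<le> 3 * K\<^sup>2 * (1 + t) powr (- 3 / 2)"
      using t by (simp add: powr_minus_divide field_simps)
  qed
qed

private lemma f'_int_exp:
  assumes "Re b \<ge> 0"
  shows "integrable half_line (\<lambda>t. f' t * exp (- (b * of_real t)))"
proof (rule integrable_half_line_continuous_bound[OF _ integrable_norm[OF f'_int]])
  show "continuous_on {0<..} (\<lambda>t. f' t * exp (- (b * of_real t)))"
    unfolding f'_def by (intro continuous_intros) auto
  show "norm (f' t * exp (- (b * of_real t))) \<le> norm (f' t)" if "t > 0" for t
    using assms that by (auto simp: norm_mult intro!: mult_right_le_one_le)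
qed

text \<open>Integration by parts multiplies the transform of \<open>f\<close> by \<open>b\<close>.
  The real part of \<open>b\<close> is positive because \<open>f\<close> itself is not integrable
  without damping.\<close>

private lemma laplace_f':
  assumes b: "Re b > 0"
  shows "integral\<^sup>L half_line (\<lambda>t. f' t * exp (- (b * of_real t))) = of_real (sqrt pi) * csqrt b * exp (- 2 * of_real (sqrt a) * csqrt b)"
proof -
  have fint: "integrable half_line (\<lambda>t. f t * exp (- (b * of_real t)))"
    unfolding f_def by (rule integrable_exp_inverse[OF a b])
  have f'int: "integrable half_line (\<lambda>t. f' t * exp (- (b * of_real t)))"
    using b by (intro f'_int_exp) auto
  have bt: "((\<lambda>t. exp (- (b * of_real t))) has_vector_derivative - b * exp (- (b * of_real t))) (at t)" for t :: real
    by (rule has_vector_derivative_real_field) (auto intro!: derivative_eq_intros)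
  have bnd: "norm (f t * exp (- (b * of_real t))) \<le> norm (f t)" if "t > 0" for t
    using b that by (auto simp: norm_mult intro!: mult_right_le_one_le)
  have l0: "((\<lambda>t. f t * exp (- (b * of_real t))) \<longlongrightarrow> 0) (at_right 0)"
    by (rule Lim_null_comparison[OF _ tendsto_norm_zero[OF lim0]])
       (rule eventually_mono[OF eventually_at_right_less[of 0] bnd])
  have linf: "((\<lambda>t. f t * exp (- (b * of_real t))) \<longlongrightarrow> 0) at_top"
    by (rule Lim_null_comparison[OF _ tendsto_norm_zero[OF liminf]])
       (rule eventually_mono[OF eventually_gt_at_top[of 0] bnd])
  have "integral\<^sup>L half_line (\<lambda>t. f' t * exp (- (b * of_real t)) - b * (f t * exp (- (b * of_real t)))) = 0 - 0"
  proof (rule integral_half_line_FTC[OF _ _ l0 linf])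
    show "integrable half_line (\<lambda>t. f' t * exp (- (b * of_real t)) - b * (f t * exp (- (b * of_real t))))"
      by (intro Bochner_Integration.integrable_diff f'int integrable_mult_right fint)
    fix t :: real assume t: "t > 0"
    from has_vector_derivative_mult[OF deriv[OF t] bt[of t]]
    show "((\<lambda>t. f t * exp (- (b * of_real t))) has_vector_derivative
      f' t * exp (- (b * of_real t)) - b * (f t * exp (- (b * of_real t)))) (at t)"
      by (simp add: algebra_simps)
  qed
  also have "integral\<^sup>L half_line (\<lambda>t. f' t * exp (- (b * of_real t)) - b * (f t * exp (- (b * of_real t)))) =
     integral\<^sup>L half_line (\<lambda>t. f' t * exp (- (b * of_real t))) - b * integral\<^sup>L half_line (\<lambda>t. f t * exp (- (b * of_real t)))"
    by (subst Bochner_Integration.integral_diff[OF f'int integrable_mult_right[OF fint]]) simp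
  also have "integral\<^sup>L half_line (\<lambda>t. f t * exp (- (b * of_real t))) =
      of_real (sqrt pi) / csqrt b * exp (- 2 * of_real (sqrt a) * csqrt b)"
    unfolding f_def by (rule integral_exp_inverse[OF a b])
  finally have "integral\<^sup>L half_line (\<lambda>t. f' t * exp (- (b * of_real t))) =
      b * (of_real (sqrt pi) / csqrt b * exp (- 2 * of_real (sqrt a) * csqrt b))" by simp
  also have "b / csqrt b = csqrt b"
  proof -
    have "csqrt b \<noteq> 0" using b by auto
    thus ?thesis by (metis nonzero_eq_divide_eq power2_csqrt power2_eq_square)
  qed
  hence "b * (of_real (sqrt pi) / csqrt b * exp (- 2 * of_real (sqrt a) * csqrt b)) =
      of_real (sqrt pi) * csqrt b * exp (- 2 * of_real (sqrt a) * csqrt b)"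
    by (metis (no_types, lifting) mult.assoc mult.commute times_divide_eq_right)
  finally show ?thesis .
qed

text \<open>The imaginary axis is reached from the right half plane along \<open>b + 1 / n\<close>:
  the integrals converge since \<open>norm (f' t)\<close> dominates, the closed form since
  \<open>csqrt\<close> is continuous off the negative axis. The factor \<open>1 + \<i>\<close> is
  the direction of the square root of a positive imaginary number.\<close>

private lemma fourier_f':
  "integral\<^sup>L half_line (\<lambda>t. f' t * exp (- (2 * of_real pi * \<i> * of_nat (Suc m) * of_real t))) =
     of_real (pi * sqrt (real (Suc m))) * (1 + \<i>) * exp (- of_real (2 * sqrt (pi * a * real (Suc m))) * (1 + \<i>))"
proof -
  define b where "b = 2 * of_real pi * \<i> * of_nat (Suc m)"
  define r where "r = sqrt (pi * real (Suc m))"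
  have r: "r > 0" "r ^ 2 = pi * real (Suc m)" by (auto simp: r_def)
  have cs: "csqrt b = of_real r * (1 + \<i>)"
  proof (rule csqrt_unique)
    have "(of_real r * (1 + \<i>))\<^sup>2 = of_real (r ^ 2) * (2 * \<i>)"
      by (simp add: power_mult_distrib power2_sum)
    thus "(of_real r * (1 + \<i>))\<^sup>2 = b" by (simp add: r(2) b_def)
    show "0 < Re (of_real r * (1 + \<i>)) \<or> Re (of_real r * (1 + \<i>)) = 0 \<and> 0 \<le> Im (of_real r * (1 + \<i>))"
      using r by simp
  qed
  define B where "B = (\<lambda>n. b + of_real (inverse (real (Suc n))))"
  have "B \<longlonglongrightarrow> b + of_real 0"
    unfolding B_def by (intro tendsto_intros LIMSEQ_inverse_real_of_nat)
  hence Blim: "B \<longlonglongrightarrow> b" by simp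
  have ReB: "Re (B n) > 0" for n by (simp add: B_def b_def)
  have "b \<notin> \<real>\<^sub>\<le>\<^sub>0" using pi_gt_zero by (auto simp: b_def complex_nonpos_Reals_iff)
  hence "(\<lambda>n. of_real (sqrt pi) * csqrt (B n) * exp (- 2 * of_real (sqrt a) * csqrt (B n)))
      \<longlonglongrightarrow> of_real (sqrt pi) * csqrt b * exp (- 2 * of_real (sqrt a) * csqrt b)"
    by (intro tendsto_intros isCont_tendsto_compose[OF continuous_at_csqrt] Blim)
  moreover have "(\<lambda>n. integral\<^sup>L half_line (\<lambda>t. f' t * exp (- (B n * of_real t))))
      \<longlonglongrightarrow> integral\<^sup>L half_line (\<lambda>t. f' t * exp (- (b * of_real t)))"
  proof (rule integral_dominated_convergence[where w = "\<lambda>t. norm (f' t)"])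
    show "(\<lambda>t. f' t * exp (- (b * of_real t))) \<in> borel_measurable half_line"
      using f'_int_exp[of b] by (auto simp: b_def)
    show "(\<lambda>t. f' t * exp (- (B n * of_real t))) \<in> borel_measurable half_line" for n
      using f'_int_exp[of "B n"] ReB[of n] by auto
    show "AE t in half_line. norm (f' t * exp (- (B n * of_real t))) \<le> norm (f' t)" for n
      using ReB[of n] by (intro AE_I2) (auto simp: norm_mult intro!: mult_right_le_one_le mult_nonneg_nonneg)
    show "AE t in half_line. (\<lambda>n. f' t * exp (- (B n * of_real t))) \<longlonglongrightarrow> f' t * exp (- (b * of_real t))"
      by (intro AE_I2 tendsto_intros Blim)
  qed (use f'_int in auto)
  hence "(\<lambda>n. of_real (sqrt pi) * csqrt (B n) * exp (- 2 * of_real (sqrt a) * csqrt (B n)))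
      \<longlonglongrightarrow> integral\<^sup>L half_line (\<lambda>t. f' t * exp (- (b * of_real t)))"
    by (simp only: laplace_f'[OF ReB])
  ultimately have "integral\<^sup>L half_line (\<lambda>t. f' t * exp (- (b * of_real t))) =
      of_real (sqrt pi) * csqrt b * exp (- 2 * of_real (sqrt a) * csqrt b)"
    using LIMSEQ_unique by blast
  also have "of_real (sqrt pi) * csqrt b = of_real (sqrt pi * r) * (1 + \<i>)" by (simp add: cs)
  also have "sqrt pi * r = pi * sqrt (real (Suc m))" by (simp add: r_def real_sqrt_mult)
  also have "- 2 * of_real (sqrt a) * csqrt b = - of_real (2 * (sqrt a * r)) * (1 + \<i>)" by (simp add: cs)
  also have "sqrt a * r = sqrt (pi * a * real (Suc m))" by (simp add: r_def real_sqrt_mult)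
  finally show ?thesis by (simp only: b_def)
qed

private definition c :: "nat \<Rightarrow> real" where
  "c m = sqrt 2 / sqrt (real (Suc m)) * exp (- 2 * sqrt (pi * a * real (Suc m))) * sin (pi / 4 - 2 * sqrt (pi * a * real (Suc m)))"

text \<open>As \<open>f'\<close> is real, the sine integral is minus the imaginary part of the
  Fourier integral; the phase \<open>pi / 4\<close> of S(a) comes from
  \<open>cos v - sin v = sqrt 2 * sin (pi / 4 - v)\<close>.\<close>

private lemma sine_coeff_f':
  "integral\<^sup>L half_line (\<lambda>t. of_real (sin (2 * pi * real (Suc m) * t)) * f' t) = - (of_real pi * of_nat (Suc m) * of_real (c m))"
proof -
  define v where "v = 2 * sqrt (pi * a * real (Suc m))"
  have int: "integrable half_line (\<lambda>t. f' t * exp (- (2 * of_real pi * \<i> * of_nat (Suc m) * of_real t)))"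
    by (rule f'_int_exp) auto
  have "integral\<^sup>L half_line (\<lambda>t. of_real (sin (2 * pi * real (Suc m) * t)) * f' t) =
      integral\<^sup>L half_line (\<lambda>t. of_real (- Im (f' t * exp (- (2 * of_real pi * \<i> * of_nat (Suc m) * of_real t)))))"
    by (intro Bochner_Integration.integral_cong refl) (simp add: f'_def Im_exp mult_ac)
  also have "\<dots> = of_real (- Im (integral\<^sup>L half_line (\<lambda>t. f' t * exp (- (2 * of_real pi * \<i> * of_nat (Suc m) * of_real t)))))"
    by (simp only: integral_complex_of_real Bochner_Integration.integral_minus integral_Im[OF int])
  also have "Im (integral\<^sup>L half_line (\<lambda>t. f' t * exp (- (2 * of_real pi * \<i> * of_nat (Suc m) * of_real t)))) =
      pi * sqrt (real (Suc m)) * exp (- v) * (cos v - sin v)"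
    unfolding fourier_f' v_def[symmetric]
    by (simp add: Re_exp Im_exp algebra_simps)
  also have "cos v - sin v = sqrt 2 * sin (pi / 4 - v)"
    by (simp add: sin_diff sin_45 cos_45 algebra_simps)
  also have "pi * sqrt (real (Suc m)) * exp (- v) * (sqrt 2 * sin (pi / 4 - v)) = pi * real (Suc m) * c m"
  proof -
    define q where "q = sqrt (real (Suc m))"
    have "q > 0" "real (Suc m) = q * q" by (simp_all add: q_def)
    hence "pi * q * exp (- v) * (sqrt 2 * sin (pi / 4 - v)) = pi * real (Suc m) * (sqrt 2 / q * exp (- v) * sin (pi / 4 - v))"
      by simp
    thus ?thesis by (simp add: c_def v_def q_def)
  qed
  finally show ?thesis by simp
qed

private lemma abs_c_le: "\<bar>c m\<bar> \<le> sqrt 2 / sqrt (real (Suc m)) * exp (- 2 * sqrt (pi * a * real (Suc m)))"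
  unfolding c_def abs_mult by (rule order_trans[OF mult_left_mono[OF abs_sin_le_one]]) auto

private lemma summable_c: "summable (\<lambda>m. norm (complex_of_real (c m)))"
proof (rule summable_comparison_test_bigo)
  show "summable (\<lambda>k. norm (1 / real k ^ 2))"
    using inverse_power_summable[of 2, where ?'a = real] by (simp add: divide_inverse)
  have "(\<lambda>m. sqrt 2 / sqrt (real (Suc m)) * exp (- 2 * sqrt (pi * a * real (Suc m)))) \<in> O(\<lambda>k. 1 / real k ^ 2)"
    using a pi_gt_zero by real_asymp
  moreover have "(\<lambda>m. norm (complex_of_real (c m))) \<in> O(\<lambda>m. sqrt 2 / sqrt (real (Suc m)) * exp (- 2 * sqrt (pi * a * real (Suc m))))"
    using abs_c_le by (intro bigoI[of _ 1] always_eventually) auto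
  ultimately show "(\<lambda>m. norm (complex_of_real (c m))) \<in> O(\<lambda>k. 1 / real k ^ 2)"
    by (rule landau_o.big_trans[rotated])
qed

text \<open>The primitive \<open>2 sqrt t exp (- a / t) + 4 sqrt a G (sqrt (a / t))\<close> tends to
  \<open>L = 2 sqrt (pi a)\<close> at 0 and is asymptotic to \<open>2 sqrt t\<close> at infinity,
  where the \<open>G\<close> term vanishes.\<close>

private lemma integral_f_asymptotics:
  "(\<lambda>D. integral {0..real D} f - of_real (2 * sqrt (real D))) \<longlonglongrightarrow> - of_real (2 * sqrt (pi * a))"
proof -
  from gaussian_primitive obtain G :: "real \<Rightarrow> complex" where G:
    "\<And>x. (G has_vector_derivative of_real (exp (- x\<^sup>2))) (at x)" "G 0 = 0"
    "(G \<longlongrightarrow> of_real (sqrt pi / 2)) at_top" by metis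
  have Gcont: "isCont G x" for x using G(1) has_vector_derivative_continuous by blast
  define L where "L = (4 * sqrt a) *\<^sub>R complex_of_real (sqrt pi / 2)"
  \<comment> \<open>The value at 0 is set to the limit by hand: with division by zero the formula
    would give \<open>G 0 = 0\<close> there and break continuity.\<close>
  define H where "H = (\<lambda>t. if t = 0 then L else of_real (2 * sqrt t * exp (- a / t)) + (4 * sqrt a) *\<^sub>R G (sqrt a / sqrt t))"
  have Hderiv: "(H has_vector_derivative f t) (at t)" if t: "t > 0" for t
  proof -
    have 1: "((\<lambda>t. 2 * sqrt t * exp (- a / t)) has_real_derivative
        exp (- a / t) / sqrt t + 2 * sqrt t * (exp (- a / t) * (a / t ^ 2))) (at t)"
      using t by (auto intro!: derivative_eq_intros simp: power2_eq_square field_simps)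
    have 2: "((\<lambda>t. sqrt a / sqrt t) has_vector_derivative (- sqrt a / (2 * t * sqrt t))) (at t)"
      unfolding has_real_derivative_iff_has_vector_derivative[symmetric]
      using t by (auto intro!: derivative_eq_intros simp: field_simps)
    have 3: "((\<lambda>t. G (sqrt a / sqrt t)) has_vector_derivative
        (- sqrt a / (2 * t * sqrt t)) *\<^sub>R of_real (exp (- (sqrt a / sqrt t)\<^sup>2))) (at t)"
      using vector_diff_chain_at[OF 2 G(1)] by (simp only: o_def)
    note 4 = has_vector_derivative_of_real[folded has_real_derivative_iff_has_vector_derivative, OF 1]
    have "((\<lambda>t. complex_of_real (2 * sqrt t * exp (- a / t)) + (4 * sqrt a) *\<^sub>R G (sqrt a / sqrt t)) has_vector_derivative
        of_real (exp (- a / t) / sqrt t + 2 * sqrt t * (exp (- a / t) * (a / t ^ 2))) +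
        (4 * sqrt a) *\<^sub>R ((- sqrt a / (2 * t * sqrt t)) *\<^sub>R of_real (exp (- (sqrt a / sqrt t)\<^sup>2)))) (at t)"
      by (rule has_vector_derivative_add[OF 4 bounded_linear.has_vector_derivative[OF bounded_linear_scaleR_right 3]])
    also have "of_real (exp (- a / t) / sqrt t + 2 * sqrt t * (exp (- a / t) * (a / t ^ 2))) +
        (4 * sqrt a) *\<^sub>R ((- sqrt a / (2 * t * sqrt t)) *\<^sub>R complex_of_real (exp (- (sqrt a / sqrt t)\<^sup>2))) =
        of_real (exp (- a / t) / sqrt t + 2 * sqrt t * (exp (- a / t) * (a / t ^ 2)) +
          (4 * sqrt a) * ((- sqrt a / (2 * t * sqrt t)) * exp (- (sqrt a / sqrt t)\<^sup>2)))"
      by (simp add: scaleR_conv_of_real)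
    also have "exp (- a / t) / sqrt t + 2 * sqrt t * (exp (- a / t) * (a / t ^ 2)) +
          (4 * sqrt a) * ((- sqrt a / (2 * t * sqrt t)) * exp (- (sqrt a / sqrt t)\<^sup>2)) = exp (- a / t) / sqrt t"
    proof -
      have e: "exp (- (sqrt a / sqrt t)\<^sup>2) = exp (- a / t)" using a t by (simp add: power_divide)
      have s: "sqrt t / t ^ 2 = 1 / (t * sqrt t)" using t by (simp add: field_simps power2_eq_square)
      have "2 * sqrt t * (exp (- a / t) * (a / t ^ 2)) = 2 * a * exp (- a / t) * (sqrt t / t ^ 2)" by simp
      also have "\<dots> = 2 * a * exp (- a / t) / (t * sqrt t)" unfolding s by simp
      finally have A: "2 * sqrt t * (exp (- a / t) * (a / t ^ 2)) = 2 * a * exp (- a / t) / (t * sqrt t)" .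
      have "(4 * sqrt a) * ((- sqrt a / (2 * t * sqrt t)) * X) = - (2 * (sqrt a * sqrt a) * X / (t * sqrt t))" for X
        by simp
      also have "sqrt a * sqrt a = a" using a by simp
      finally have B: "(4 * sqrt a) * ((- sqrt a / (2 * t * sqrt t)) * X) = - (2 * a * X / (t * sqrt t))" for X .
      show ?thesis unfolding e A B by simp
    qed
    also have "complex_of_real (exp (- a / t) / sqrt t) = f t"
    proof -
      have "t powr (- 1 / 2) = 1 / sqrt t" using t by (simp add: powr_minus_divide powr_half_sqrt)
      thus ?thesis by (simp add: f_def)
    qed
    finally show ?thesis
    proof (rule has_vector_derivative_transform_within_open)
      show "open {0::real<..}" "t \<in> {0<..}" using t by auto
    qed (simp add: H_def)
  qed
  have H0: "(H \<longlongrightarrow> L) (at_right 0)"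
  proof -
    have "((\<lambda>t. 2 * sqrt t * exp (- a / t)) \<longlongrightarrow> 0) (at_right 0)" using a by real_asymp
    moreover have "filterlim (\<lambda>t. sqrt a / sqrt t) at_top (at_right 0)" using a by real_asymp
    ultimately have "((\<lambda>t. of_real (2 * sqrt t * exp (- a / t)) + (4 * sqrt a) *\<^sub>R G (sqrt a / sqrt t)) \<longlongrightarrow>
       of_real 0 + L) (at_right 0)"
      unfolding L_def by (intro tendsto_add tendsto_of_real tendsto_scaleR tendsto_const filterlim_compose[OF G(3)])
    hence lim: "((\<lambda>t. of_real (2 * sqrt t * exp (- a / t)) + (4 * sqrt a) *\<^sub>R G (sqrt a / sqrt t)) \<longlongrightarrow> L) (at_right 0)" by simp
    show ?thesis
      by (rule Lim_transform_eventually[OF lim]) (auto simp: H_def eventually_at_filter)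
  qed
  have Hcont: "continuous_on {0..} H"
    unfolding continuous_on
  proof
    fix t :: real assume t: "t \<in> {0..}"
    show "(H \<longlongrightarrow> H t) (at t within {0..})"
    proof (cases "t = 0")
      case True
      have "(H \<longlongrightarrow> L) (at 0 within {0..})"
        using H0 by (metis at_within_Ici_at_right)
      thus ?thesis using True by (simp add: H_def)
    next
      case False
      hence "isCont H t" using t Hderiv[of t]
        by (auto intro: has_vector_derivative_continuous)
      thus ?thesis unfolding isCont_def by (rule tendsto_within_subset) auto
    qed
  qed
  have int: "integral {0..real D} f = H (real D) - L" for D
  proof -
    have "(f has_integral (H (real D) - H 0)) {0..real D}"
      by (rule fundamental_theorem_of_calculus_interior)
         (auto intro!: continuous_on_subset[OF Hcont] Hderiv)
    thus ?thesis by (simp add: integral_unique H_def)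
  qed
  have "(\<lambda>D. of_real (2 * sqrt (real D) * exp (- a / real D) - 2 * sqrt (real D)) + (4 * sqrt a) *\<^sub>R G (sqrt a / sqrt (real D)) - L)
      \<longlonglongrightarrow> of_real 0 + (4 * sqrt a) *\<^sub>R G 0 - L"
  proof (intro tendsto_intros isCont_tendsto_compose[OF Gcont])
    show "(\<lambda>D. 2 * sqrt (real D) * exp (- a / real D) - 2 * sqrt (real D)) \<longlonglongrightarrow> 0" using a by real_asymp
    show "(\<lambda>D. sqrt a / sqrt (real D)) \<longlonglongrightarrow> 0" using a by real_asymp
  qed
  moreover have "eventually (\<lambda>D. of_real (2 * sqrt (real D) * exp (- a / real D) - 2 * sqrt (real D)) + (4 * sqrt a) *\<^sub>R G (sqrt a / sqrt (real D)) - L =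
      integral {0..real D} f - of_real (2 * sqrt (real D))) sequentially"
    using eventually_gt_at_top[of 0] unfolding int by eventually_elim (simp add: H_def)
  ultimately have "(\<lambda>D. integral {0..real D} f - of_real (2 * sqrt (real D))) \<longlonglongrightarrow> of_real 0 + (4 * sqrt a) *\<^sub>R G 0 - L"
    by (rule Lim_transform_eventually)
  thus ?thesis by (simp add: G(2) L_def scaleR_conv_of_real real_sqrt_mult mult_ac)
qed

text \<open>Normalised by \<open>2 sqrt D\<close>, the counterterm that also regularizes the
  divergent series for zeta(1/2), so that subtracting the two leaves a convergent series.\<close>

theorem damped_sine_series_limit:
  "(\<lambda>D. (\<Sum>k=1..D. real k powr (- 1 / 2) * exp (- a / real k)) - 2 * sqrt (real D))
     \<longlonglongrightarrow> damped_sine_series a - 2 * sqrt (pi * a)"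
proof -
  have "(\<lambda>D. (\<Sum>k=1..D. f (real k)) - integral {0..real D} f) \<longlonglongrightarrow> (\<Sum>m. complex_of_real (c m))"
    by (rule poisson_summation_half_line[OF deriv cont f0 liminf f'_int sine_coeff_f' summable_c])
  also have "(\<Sum>m. complex_of_real (c m)) = of_real (damped_sine_series a)"
    unfolding damped_sine_series_def c_def[symmetric]
    by (rule suminf_of_real[symmetric]) (use summable_norm_cancel[of c] summable_c in simp)
  finally have "(\<lambda>D. ((\<Sum>k=1..D. f (real k)) - integral {0..real D} f) + (integral {0..real D} f - of_real (2 * sqrt (real D))))
     \<longlonglongrightarrow> of_real (damped_sine_series a) + - of_real (2 * sqrt (pi * a))"
    by (intro tendsto_add integral_f_asymptotics)
  hence "(\<lambda>D. complex_of_real ((\<Sum>k=1..D. real k powr (- 1 / 2) * exp (- a / real k)) - 2 * sqrt (real D)))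
     \<longlonglongrightarrow> complex_of_real (damped_sine_series a - 2 * sqrt (pi * a))"
    by (simp add: f_def)
  thus ?thesis by (simp only: tendsto_of_real_iff)
qed

end

section \<open>The remainder of the exponential series and the zeta function\<close>

lemma has_field_derivative_exp_series:
  assumes z: "Re z > 0"
  shows "(exp_series w has_field_derivative - exp_series (w + 1) z) (at z)"
proof -
  \<comment> \<open>A half plane staying away from the imaginary axis, where the rate
    \<open>Re z / 2\<close> majorises the derivatives uniformly.\<close>
  define S where "S = {x. Re x > Re z / 2}"
  have zS: "z \<in> interior S" "z \<in> S"
    using z interior_open[of S] open_halfspace_Re_gt[of "Re z / 2"] by (auto simp: S_def)
  let ?f = "\<lambda>k x. of_nat (Suc k) powr (w - 1) * exp (- (of_nat (Suc k) * x))"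
  let ?f' = "\<lambda>k x. - (of_nat (Suc k) powr (w + 1 - 1) * exp (- (of_nat (Suc k) * x)))"
  have "((\<lambda>x. \<Sum>k. ?f k x) has_field_derivative (\<Sum>k. ?f' k z)) (at z)"
  proof (rule has_field_derivative_series'[of S _ _ z])
    show "convex S" unfolding S_def by (rule convex_halfspace_Re_gt)
    show "(?f k has_field_derivative ?f' k x) (at x within S)" for k x
    proof -
      have "(?f k has_field_derivative of_nat (Suc k) powr (w - 1) * (exp (- (of_nat (Suc k) * x)) * - of_nat (Suc k))) (at x within S)"
        by (auto intro!: derivative_eq_intros simp del: of_nat_Suc)
      also have "of_nat (Suc k) powr (w - 1) * (exp (- (of_nat (Suc k) * x)) * - of_nat (Suc k)) = ?f' k x"
        by (simp add: powr_diff field_simps del: of_nat_Suc)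
      finally show ?thesis .
    qed
    show "uniformly_convergent_on S (\<lambda>n x. \<Sum>i<n. ?f' i x)"
    proof (rule Weierstrass_m_test'[OF _ summable_powr_exp_real[of "Re z / 2" "Re w"]])
      fix k x assume "x \<in> S"
      hence "Re z / 2 * real (Suc k) \<le> Re x * real (Suc k)" by (intro mult_right_mono) (auto simp: S_def)
      thus "norm (?f' k x) \<le> real (Suc k) powr Re w * exp (- (Re z / 2 * real (Suc k)))"
        by (simp add: norm_mult norm_powr_real_powr mult_ac mult_left_mono del: of_nat_Suc)
    qed (use z in auto)
    show "summable (\<lambda>k. ?f k z)" by (rule summable_norm_cancel[OF summable_exp_series[OF z]])
  qed (use zS in auto)
  also have "(\<lambda>x. \<Sum>k. ?f k x) = exp_series w" by (simp add: exp_series_def fun_eq_iff)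
  also have "(\<Sum>k. ?f' k z) = - exp_series (w + 1) z"
    unfolding exp_series_def by (rule suminf_minus[OF summable_norm_cancel[OF summable_exp_series[OF z]]])
  finally show ?thesis .
qed

definition exp_remainder :: "complex \<Rightarrow> complex \<Rightarrow> complex" where
  "exp_remainder w z = exp_series w z - Gamma w * z powr (- w)"

text \<open>The pole part differentiates like the series because
  \<open>Gamma (w + 1) = w * Gamma w\<close>. Raising \<open>w\<close> by one leads from
  \<open>Re w > 0\<close> into the range of Lipschitz's formula.\<close>

lemma has_field_derivative_exp_remainder:
  assumes z: "Re z > 0" and w: "Re w > 0"
  shows "(exp_remainder w has_field_derivative - exp_remainder (w + 1) z) (at z)"
proof -
  have "z \<notin> \<real>\<^sub>\<le>\<^sub>0" using z by (auto simp: complex_nonpos_Reals_iff)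
  hence "(exp_remainder w has_field_derivative (- exp_series (w + 1) z - Gamma w * (- w * z powr (- w - 1)))) (at z)"
    unfolding exp_remainder_def
    by (auto intro!: derivative_eq_intros has_field_derivative_exp_series[OF z])
  also have "- exp_series (w + 1) z - Gamma w * (- w * z powr (- w - 1)) = - exp_remainder (w + 1) z"
    using Gamma_plus1[OF not_nonpos_Int_half_plane[OF w]] by (simp add: exp_remainder_def)
  finally show ?thesis .
qed

lemma summable_lipschitz_term:
  fixes y :: real
  assumes "Re w > 1" "y \<ge> 0"
  shows "summable (\<lambda>m. norm (lipschitz_term w (of_real y) m))"
proof (rule summable_comparison_test'[where N = 0, OF summable_mult[OF powr_nat_summable[OF assms(1)]]])
  show "norm (norm (lipschitz_term w (of_real y) m)) \<le> 2 * exp (pi / 2 * \<bar>Im w\<bar>) * real (Suc m) powr - Re w" for m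
    using norm_lipschitz_term_sum_le[of y w m] assms by simp
qed

text \<open>For \<open>Re w > 1\<close>, a majorant of the right-hand side of Lipschitz's formula
  that does not depend on \<open>y\<close>.\<close>

definition lipschitz_bound :: "complex \<Rightarrow> real" where
  "lipschitz_bound w = norm (Gamma w) * (2 * exp (pi / 2 * \<bar>Im w\<bar>) * (\<Sum>m. real (Suc m) powr - Re w))"

lemma lipschitz_bound_nonneg: "Re w > 1 \<Longrightarrow> lipschitz_bound w \<ge> 0"
  unfolding lipschitz_bound_def by (intro mult_nonneg_nonneg suminf_nonneg powr_nat_summable) auto

lemma norm_exp_remainder_le:
  fixes y :: real
  assumes w: "Re w > 1" and y: "y > 0"
  shows "norm (exp_remainder w (of_real y)) \<le> lipschitz_bound w"
proof -
  have "norm (\<Sum>m. lipschitz_term w (of_real y) m) \<le> (\<Sum>m. norm (lipschitz_term w (of_real y) m))"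
    using summable_lipschitz_term[OF w, of y] y by (intro summable_norm) auto
  also have "\<dots> \<le> (\<Sum>m. 2 * exp (pi / 2 * \<bar>Im w\<bar>) * real (Suc m) powr - Re w)"
    using summable_lipschitz_term[OF w, of y] y w norm_lipschitz_term_sum_le[of y w]
    by (intro suminf_le summable_mult powr_nat_summable) auto
  also have "\<dots> = 2 * exp (pi / 2 * \<bar>Im w\<bar>) * (\<Sum>m. real (Suc m) powr - Re w)"
    by (rule suminf_mult[OF powr_nat_summable[OF w]])
  finally show ?thesis
    unfolding exp_remainder_def lipschitz_formula[OF w y] norm_mult lipschitz_bound_def
    by (rule mult_left_mono) auto
qed

text \<open>Mean value inequality: the derivative is a remainder at \<open>w + 1\<close>, bounded
  uniformly on the positive axis. Besides giving a limit at 0, this Lipschitz estimate later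
  dominates the sum over d while the damping tends to 0.\<close>

lemma exp_remainder_diff_le:
  fixes x y :: real
  assumes w: "Re w > 0" and xy: "x > 0" "y > 0"
  shows "norm (exp_remainder w (of_real x) - exp_remainder w (of_real y)) \<le> lipschitz_bound (w + 1) * \<bar>x - y\<bar>"
proof -
  let ?S = "closed_segment (complex_of_real x) (complex_of_real y)"
  have "norm (exp_remainder w (of_real x) - exp_remainder w (of_real y)) \<le> lipschitz_bound (w + 1) * norm (complex_of_real x - of_real y)"
  proof (rule field_differentiable_bound[of ?S _ "\<lambda>z. - exp_remainder (w + 1) z"])
    fix z assume "z \<in> ?S"
    then obtain u where u: "z = of_real u" "u \<in> closed_segment x y"
      by (auto simp: closed_segment_of_real)
    hence u0: "u > 0" using xy by (auto simp: closed_segment_eq_real_ivl split: if_splits)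
    show "(exp_remainder w has_field_derivative - exp_remainder (w + 1) z) (at z within ?S)"
      using u u0 w by (intro has_field_derivative_at_within[OF has_field_derivative_exp_remainder]) auto
    show "norm (- exp_remainder (w + 1) z) \<le> lipschitz_bound (w + 1)"
      unfolding u(1) norm_minus_cancel by (rule norm_exp_remainder_le[OF _ u0]) (use w in simp)
  qed auto
  thus ?thesis by (simp flip: of_real_diff)
qed

text \<open>The limit of the remainder at 0, taken along one sequence; for \<open>Re w > 0\<close>
  it exists by \<open>exp_remainder_diff_le\<close> and will be identified as
  \<open>riemann_zeta (1 - w)\<close>.\<close>

definition exp_constant :: "complex \<Rightarrow> complex" where
  "exp_constant w = lim (\<lambda>n. exp_remainder w (of_real (1 / real (Suc n))))"

lemma exp_remainder_minus_constant_le: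
  fixes y :: real
  assumes w: "Re w > 0" and y: "y > 0"
  shows "norm (exp_remainder w (of_real y) - exp_constant w) \<le> lipschitz_bound (w + 1) * y"
proof -
  define X where "X = (\<lambda>n. exp_remainder w (of_real (1 / real (Suc n))))"
  \<comment> \<open>One is added to make the constant strictly positive, since \<open>e / K\<close>
    occurs below.\<close>
  define K where "K = lipschitz_bound (w + 1) + 1"
  have K: "K > 0" "lipschitz_bound (w + 1) \<le> K"
    using lipschitz_bound_nonneg[of "w + 1"] w by (auto simp: K_def)
  have inv: "(\<lambda>n. 1 / real (Suc n)) \<longlonglongrightarrow> 0"
    using LIMSEQ_inverse_real_of_nat by (simp add: inverse_eq_divide)
  have "Cauchy X"
  proof (rule metric_CauchyI)
    fix e :: real assume e: "e > 0"
    from LIMSEQ_imp_Cauchy[OF inv] obtain M where M: "\<And>m n. m \<ge> M \<Longrightarrow> n \<ge> M \<Longrightarrow> dist (1 / real (Suc m)) (1 / real (Suc n)) < e / K"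
      using e K unfolding Cauchy_def by (metis divide_pos_pos)
    show "\<exists>M. \<forall>m\<ge>M. \<forall>n\<ge>M. dist (X m) (X n) < e"
    proof (intro exI allI impI)
      fix m n assume mn: "m \<ge> M" "n \<ge> M"
      have "dist (X m) (X n) \<le> lipschitz_bound (w + 1) * \<bar>1 / real (Suc m) - 1 / real (Suc n)\<bar>"
        unfolding X_def dist_norm by (rule exp_remainder_diff_le[OF w]) auto
      also have "\<dots> \<le> K * dist (1 / real (Suc m)) (1 / real (Suc n))"
        unfolding dist_real_def using K by (intro mult_right_mono) auto
      also have "\<dots> < e" using M[OF mn] K by (simp add: field_simps)
      finally show "dist (X m) (X n) < e" .
    qed
  qed
  hence X: "X \<longlonglongrightarrow> exp_constant w"
    unfolding exp_constant_def X_def[symmetric] by (simp add: Cauchy_convergent convergent_LIMSEQ_iff[symmetric])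
  have "(\<lambda>n. norm (exp_remainder w (of_real y) - X n)) \<longlonglongrightarrow> norm (exp_remainder w (of_real y) - exp_constant w)"
    by (intro tendsto_intros X)
  moreover have "(\<lambda>n. lipschitz_bound (w + 1) * \<bar>y - 1 / real (Suc n)\<bar>) \<longlonglongrightarrow> lipschitz_bound (w + 1) * \<bar>y - 0\<bar>"
    by (intro tendsto_intros inv)
  ultimately have "norm (exp_remainder w (of_real y) - exp_constant w) \<le> lipschitz_bound (w + 1) * \<bar>y - 0\<bar>"
  proof (rule LIMSEQ_le)
    show "\<exists>N. \<forall>n\<ge>N. norm (exp_remainder w (of_real y) - X n) \<le> lipschitz_bound (w + 1) * \<bar>y - 1 / real (Suc n)\<bar>"
      unfolding X_def by (intro exI allI impI exp_remainder_diff_le[OF w y]) auto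
  qed
  thus ?thesis using y by simp
qed

lemma exp_remainder_tendsto:
  assumes w: "Re w > 0"
  shows "((\<lambda>y. exp_remainder w (of_real y)) \<longlongrightarrow> exp_constant w) (at_right 0)"
proof -
  have "((\<lambda>y. exp_remainder w (of_real y) - exp_constant w) \<longlongrightarrow> 0) (at_right 0)"
  proof (rule Lim_null_comparison)
    show "eventually (\<lambda>y. norm (exp_remainder w (of_real y) - exp_constant w) \<le> lipschitz_bound (w + 1) * y) (at_right 0)"
      by (rule eventually_mono[OF eventually_at_right_less[of 0] exp_remainder_minus_constant_le[OF w]])
    show "((\<lambda>y. lipschitz_bound (w + 1) * y) \<longlongrightarrow> 0) (at_right 0)"
      by (auto intro!: tendsto_eq_intros)
  qed
  thus ?thesis by (simp add: LIM_zero_iff)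
qed

lemma holomorphic_exp_series:
  assumes z: "Re z > 0"
  shows "(\<lambda>w. exp_series w z) holomorphic_on UNIV"
proof (rule holomorphic_uniform_sequence)
  let ?f = "\<lambda>k w. of_nat (Suc k) powr (w - 1) * exp (- (of_nat (Suc k) * z))"
  show "(\<lambda>w. \<Sum>k<n. ?f k w) holomorphic_on UNIV" for n
    by (intro holomorphic_intros) (auto simp del: of_nat_Suc)
  show "\<exists>d>0. cball x d \<subseteq> UNIV \<and> uniform_limit (cball x d) (\<lambda>n w. \<Sum>k<n. ?f k w) (\<lambda>w. exp_series w z) sequentially" for x
  proof (intro exI[of _ 1] conjI)
    show "uniform_limit (cball x 1) (\<lambda>n w. \<Sum>k<n. ?f k w) (\<lambda>w. exp_series w z) sequentially"
      unfolding exp_series_def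
    proof (rule Weierstrass_m_test[OF _ summable_powr_exp_real[OF z, of "Re x"]])
      fix k w assume "w \<in> cball x 1"
      hence "Re w - 1 \<le> Re x" using complex_Re_le_cmod[of "w - x"] by (auto simp: dist_norm norm_minus_commute)
      hence "real (Suc k) powr (Re w - 1) \<le> real (Suc k) powr Re x" by (intro powr_mono) auto
      thus "norm (?f k w) \<le> real (Suc k) powr Re x * exp (- (Re z * real (Suc k)))"
        by (simp add: norm_mult norm_powr_real_powr mult_ac mult_left_mono del: of_nat_Suc)
    qed
  qed auto
qed auto

text \<open>A locally uniform limit of functions holomorphic in \<open>w\<close>. The rate of
  convergence is governed by \<open>lipschitz_bound (w + 1)\<close>, which has to be bounded on a
  disc around each point.\<close>

lemma holomorphic_exp_constant: "exp_constant holomorphic_on {w. Re w > 0}"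
proof (rule holomorphic_uniform_sequence)
  show "open {w. Re w > 0}" by (rule open_halfspace_Re_gt)
  show "(\<lambda>w. exp_remainder w (of_real (1 / real (Suc n)))) holomorphic_on {w. Re w > 0}" for n
    unfolding exp_remainder_def
  proof (intro holomorphic_on_diff holomorphic_on_mult)
    show "(\<lambda>w. exp_series w (of_real (1 / real (Suc n)))) holomorphic_on {w. Re w > 0}"
      by (rule holomorphic_on_subset[OF holomorphic_exp_series]) auto
    show "Gamma holomorphic_on {w. Re w > 0}"
      by (rule holomorphic_Gamma) (use not_nonpos_Int_half_plane in auto)
    show "(\<lambda>w. complex_of_real (1 / real (Suc n)) powr - w) holomorphic_on {w. Re w > 0}"
      by (intro holomorphic_intros)
  qed
  fix x assume "x \<in> {w. Re w > 0}"
  hence x: "Re x > 0" by simp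
  define d where "d = Re x / 2"
  have d: "d > 0" using x by (simp add: d_def)
  have Red: "Re w \<ge> d" "\<bar>Im w\<bar> \<le> \<bar>Im x\<bar> + d" if "w \<in> cball x d" for w
  proof -
    have "norm (x - w) \<le> d" using that by (simp add: dist_norm)
    thus "Re w \<ge> d" "\<bar>Im w\<bar> \<le> \<bar>Im x\<bar> + d"
      using complex_Re_le_cmod[of "x - w"] abs_Im_le_cmod[of "x - w"] by (auto simp: d_def)
  qed
  have "compact ((\<lambda>w. Gamma (w + 1)) ` cball x d)"
  proof (rule compact_continuous_image)
    show "continuous_on (cball x d) (\<lambda>w. Gamma (w + 1))"
    proof -
      have "Gamma holomorphic_on {w. Re w > 0}"
        by (rule holomorphic_Gamma) (use not_nonpos_Int_half_plane in auto)
      moreover have "(\<lambda>w. w + 1) holomorphic_on cball x d" by (intro holomorphic_intros)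
      moreover have "(\<lambda>w. w + 1) ` cball x d \<subseteq> {w. Re w > 0}" using Red(1) d by fastforce
      ultimately have "(Gamma \<circ> (\<lambda>w. w + 1)) holomorphic_on cball x d"
        by (intro holomorphic_on_compose_gen)
      thus ?thesis by (simp add: o_def holomorphic_on_imp_continuous_on)
    qed
  qed auto
  then obtain G where G: "\<And>w. w \<in> cball x d \<Longrightarrow> norm (Gamma (w + 1)) \<le> G"
    using compact_imp_bounded bounded_iff by (metis imageI)
  \<comment> \<open>The worst case of \<open>lipschitz_bound (w + 1)\<close> on the disc, where
    \<open>Re w \<ge> d\<close> and \<open>\<bar>Im w\<bar> \<le> \<bar>Im x\<bar> + d\<close>; the
    absolute value of \<open>G\<close> makes its sign evident.\<close>
  define K where "K = \<bar>G\<bar> * (2 * exp (pi / 2 * (\<bar>Im x\<bar> + d)) * (\<Sum>m. real (Suc m) powr - (1 + d)))"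
  have K: "lipschitz_bound (w + 1) \<le> K" if w: "w \<in> cball x d" for w
  proof -
    have "(\<Sum>m. real (Suc m) powr - Re (w + 1)) \<le> (\<Sum>m. real (Suc m) powr - (1 + d))"
      using Red[OF w] d by (intro suminf_le powr_nat_summable powr_mono) auto
    moreover have "(\<Sum>m. real (Suc m) powr - Re (w + 1)) \<ge> 0"
      using Red[OF w] d by (intro suminf_nonneg powr_nat_summable) auto
    moreover have "norm (Gamma (w + 1)) \<le> \<bar>G\<bar>" using G[OF w] by simp
    moreover have "exp (pi / 2 * \<bar>Im (w + 1)\<bar>) \<le> exp (pi / 2 * (\<bar>Im x\<bar> + d))"
      using Red(2)[OF w] by simp
    ultimately show ?thesis
      unfolding lipschitz_bound_def K_def by (intro mult_mono) (auto intro!: mult_nonneg_nonneg)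
  qed
  have "uniform_limit (cball x d) (\<lambda>n w. exp_remainder w (of_real (1 / real (Suc n)))) exp_constant sequentially"
  proof (rule uniform_limitI)
    fix e :: real assume e: "e > 0"
    have "(\<lambda>n. K * (1 / real (Suc n))) \<longlonglongrightarrow> K * 0"
      using LIMSEQ_inverse_real_of_nat by (intro tendsto_intros) (simp add: inverse_eq_divide)
    hence "eventually (\<lambda>n. K * (1 / real (Suc n)) < e) sequentially"
      using e by (intro order_tendstoD(2)) auto
    thus "eventually (\<lambda>n. \<forall>w\<in>cball x d. dist (exp_remainder w (of_real (1 / real (Suc n)))) (exp_constant w) < e) sequentially"
    proof eventually_elim
      case (elim n)
      show ?case
      proof
        fix w assume w: "w \<in> cball x d"
        have "dist (exp_remainder w (of_real (1 / real (Suc n)))) (exp_constant w) \<le> lipschitz_bound (w + 1) * (1 / real (Suc n))"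
          unfolding dist_norm using Red[OF w] d by (intro exp_remainder_minus_constant_le) auto
        also have "\<dots> \<le> K * (1 / real (Suc n))" by (intro mult_right_mono K[OF w]) auto
        also have "\<dots> < e" by fact
        finally show "dist (exp_remainder w (of_real (1 / real (Suc n)))) (exp_constant w) < e" .
      qed
    qed
  qed
  moreover have "cball x d \<subseteq> {w. Re w > 0}" using Red d by force
  ultimately show "\<exists>d>0. cball x d \<subseteq> {w. Re w > 0} \<and>
      uniform_limit (cball x d) (\<lambda>n w. exp_remainder w (of_real (1 / real (Suc n)))) exp_constant sequentially"
    using d by blast
qed

section \<open>Zeta for positive real part and its identification\<close>

text \<open>With \<open>N = Suc n\<close>, this is \<open>N powr - z\<close> minus the integral of
  \<open>u powr - z\<close> over the unit interval from \<open>N\<close> to \<open>N + 1\<close>.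
  The integrals telescope and account for the pole \<open>1 / (z - 1)\<close> in
  \<open>zeta_half_plane\<close>.\<close>

definition zeta_term :: "complex \<Rightarrow> nat \<Rightarrow> complex" where
  "zeta_term z n = of_nat (Suc n) powr - z - (of_nat (Suc n) powr (1 - z) - of_nat (Suc (Suc n)) powr (1 - z)) / (z - 1)"

definition zeta_half_plane :: "complex \<Rightarrow> complex" where
  "zeta_half_plane z = 1 / (z - 1) + (\<Sum>n. zeta_term z n)"

text \<open>Two mean value estimates. On the unit interval \<open>u powr - z\<close> differs from
  its value at \<open>N\<close> by at most \<open>B\<close>; the function \<open>H\<close> has this
  difference as derivative, up to sign, and its increment over the interval is the term in
  question.\<close>

lemma norm_zeta_term_le:
  assumes z: "Re z > 0" "z \<noteq> 1"
  shows "norm (zeta_term z n) \<le> norm z * real (Suc n) powr - (Re z + 1)"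
proof -
  define N where "N = real (Suc n)"
  have N: "N > 0" by (simp add: N_def)
  define S where "S = closed_segment (complex_of_real N) (complex_of_real (N + 1))"
  define B where "B = norm z * N powr - (Re z + 1)"
  have S: "\<exists>t. u = of_real t \<and> N \<le> t \<and> t \<le> N + 1" if "u \<in> S" for u
    using that unfolding S_def closed_segment_of_real closed_segment_eq_real_ivl by auto
  have NS: "of_real N \<in> S" "of_real (N + 1) \<in> S" by (auto simp: S_def)
  have 1: "norm (u powr - z - of_real N powr - z) \<le> B" if u: "u \<in> S" for u
  proof -
    from S[OF u] obtain t where t: "u = of_real t" "N \<le> t" "t \<le> N + 1" by blast
    have "norm (u powr - z - of_real N powr - z) \<le> B * norm (u - of_real N)"
    proof (rule field_differentiable_bound[of S _ "\<lambda>u. - z * u powr (- z - 1)"])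
      fix u assume "u \<in> S"
      from S[OF this] obtain t where t: "u = of_real t" "N \<le> t" by blast
      show "((\<lambda>u. u powr - z) has_field_derivative - z * u powr (- z - 1)) (at u within S)"
        by (rule has_field_derivative_at_within) (use t N in \<open>auto intro!: derivative_eq_intros simp: complex_nonpos_Reals_iff\<close>)
      have "norm (- z * u powr (- z - 1)) = norm z * t powr - (Re z + 1)"
        using t N by (simp add: norm_mult norm_powr_real_powr)
      also have "\<dots> \<le> B" unfolding B_def using t N z by (intro mult_left_mono powr_mono2') auto
      finally show "norm (- z * u powr (- z - 1)) \<le> B" .
    qed (use u NS in \<open>auto simp: S_def\<close>)
    also have "norm (u - of_real N) \<le> 1" using t by (simp add: t(1) flip: of_real_diff)
    hence "B * norm (u - of_real N) \<le> B * 1" unfolding B_def by (intro mult_left_mono) auto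
    finally show ?thesis by simp
  qed
  define H where "H = (\<lambda>u. of_real N powr - z * u + u powr (1 - z) / (z - 1))"
  have "norm (H (of_real (N + 1)) - H (of_real N)) \<le> B * norm (complex_of_real (N + 1) - of_real N)"
  proof (rule field_differentiable_bound[of S _ "\<lambda>u. of_real N powr - z - u powr - z"])
    fix u assume u: "u \<in> S"
    from S[OF u] obtain t where t: "u = of_real t" "N \<le> t" by blast
    have "(H has_field_derivative of_real N powr - z + (1 - z) * u powr (1 - z - 1) / (z - 1)) (at u within S)"
      unfolding H_def
      by (rule has_field_derivative_at_within) (use t N z in \<open>auto intro!: derivative_eq_intros simp: complex_nonpos_Reals_iff\<close>)
    also have "(1 - z) * u powr (1 - z - 1) / (z - 1) = - (u powr - z)"
      using z by (simp add: field_simps)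
    finally show "(H has_field_derivative of_real N powr - z - u powr - z) (at u within S)" by simp
    show "norm (of_real N powr - z - u powr - z) \<le> B" using 1[OF u] by (simp add: norm_minus_commute)
  qed (use NS in \<open>auto simp: S_def\<close>)
  also have "H (of_real (N + 1)) - H (of_real N) = zeta_term z n"
    by (simp add: H_def zeta_term_def N_def algebra_simps diff_divide_distrib)
  finally show ?thesis by (simp add: B_def N_def)
qed

lemma summable_zeta_term:
  assumes "Re z > 0" "z \<noteq> 1"
  shows "summable (\<lambda>n. norm (zeta_term z n))"
  by (rule summable_comparison_test'[where N = 0, OF summable_mult[OF powr_nat_summable[of "Re z + 1"]]])
     (use norm_zeta_term_le[OF assms] assms in auto)

lemma holomorphic_zeta_half_plane: "zeta_half_plane holomorphic_on {z. Re z > 0} - {1}"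
proof -
  have op: "open ({z. Re z > 0} - {1})" by (intro open_Diff open_halfspace_Re_gt) auto
  have "(\<lambda>z. \<Sum>n. zeta_term z n) holomorphic_on {z. Re z > 0} - {1}"
  proof (rule holomorphic_uniform_sequence[OF op])
    show "(\<lambda>z. \<Sum>k<n. zeta_term z k) holomorphic_on {z. Re z > 0} - {1}" for n
      unfolding zeta_term_def by (intro holomorphic_intros) (auto simp del: of_nat_Suc)
    fix x assume x: "x \<in> {z. Re z > 0} - {1}"
    then obtain e where e: "e > 0" "cball x e \<subseteq> {z. Re z > 0} - {1}"
      using op open_contains_cball by blast
    define d where "d = min e (Re x / 2)"
    have d: "d > 0" "cball x d \<subseteq> {z. Re z > 0} - {1}"
      using e x by (auto simp: d_def)
    have "uniform_limit (cball x d) (\<lambda>n z. \<Sum>k<n. zeta_term z k) (\<lambda>z. \<Sum>n. zeta_term z n) sequentially"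
    proof (rule Weierstrass_m_test)
      fix n z assume z: "z \<in> cball x d"
      hence nz: "norm (x - z) \<le> d" by (simp add: dist_norm)
      have "Re x - Re z \<le> d" using nz complex_Re_le_cmod[of "x - z"] by simp
      hence Rz: "Re z \<ge> Re x / 2" by (simp add: d_def)
      have "norm z \<le> norm x + d" using nz norm_triangle_ineq2[of z x] by (simp add: norm_minus_commute)
      moreover have "real (Suc n) powr - (Re z + 1) \<le> real (Suc n) powr - (Re x / 2 + 1)"
        using Rz by (intro powr_mono) auto
      moreover have "norm (zeta_term z n) \<le> norm z * real (Suc n) powr - (Re z + 1)"
        using z d by (intro norm_zeta_term_le) auto
      ultimately show "norm (zeta_term z n) \<le> (norm x + d) * real (Suc n) powr - (Re x / 2 + 1)"
        using d(1) by (smt (verit) mult_mono norm_ge_zero powr_ge_zero)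
    next
      show "summable (\<lambda>n. (norm x + d) * real (Suc n) powr - (Re x / 2 + 1))"
        using x by (intro summable_mult powr_nat_summable) auto
    qed
    thus "\<exists>d>0. cball x d \<subseteq> {z. Re z > 0} - {1} \<and> uniform_limit (cball x d) (\<lambda>n z. \<Sum>k<n. zeta_term z k) (\<lambda>z. \<Sum>n. zeta_term z n) sequentially"
      using d by blast
  qed
  thus ?thesis unfolding zeta_half_plane_def by (intro holomorphic_intros) auto
qed

text \<open>Telescoping of the subtracted integrals. For \<open>Re z > 1\<close> the boundary term
  vanishes in the limit; at \<open>z = 1 / 2\<close> it is the counterterm
  \<open>- 2 sqrt (N + 1)\<close>.\<close>

lemma zeta_half_plane_limit:
  assumes z: "Re z > 0" "z \<noteq> 1"
  shows "(\<lambda>N. (\<Sum>n<N. of_nat (Suc n) powr - z) + of_nat (Suc N) powr (1 - z) / (z - 1)) \<longlonglongrightarrow> zeta_half_plane z"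
proof -
  have "(\<Sum>n<N. zeta_term z n) = (\<Sum>n<N. of_nat (Suc n) powr - z) - (1 - of_nat (Suc N) powr (1 - z)) / (z - 1)" for N
    by (induction N) (simp_all add: zeta_term_def diff_divide_distrib)
  moreover have "(\<lambda>N. 1 / (z - 1) + (\<Sum>n<N. zeta_term z n)) \<longlonglongrightarrow> zeta_half_plane z"
    unfolding zeta_half_plane_def
    by (intro tendsto_intros summable_LIMSEQ summable_norm_cancel[OF summable_zeta_term[OF z]])
  ultimately show ?thesis by (simp add: diff_divide_distrib)
qed

lemma zeta_half_plane_sums:
  assumes z: "Re z > 1"
  shows "(\<lambda>n. of_nat (Suc n) powr - z) sums zeta_half_plane z"
proof -
  have z': "Re z > 0" "z \<noteq> 1" using z by auto
  have "(\<lambda>N. norm ((of_nat (Suc N) :: complex) powr (1 - z) / (z - 1))) \<longlonglongrightarrow> 0"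
  proof -
    have "norm ((of_nat (Suc N) :: complex) powr (1 - z) / (z - 1)) = real (Suc N) powr (1 - Re z) / norm (z - 1)" for N
      by (simp add: norm_divide norm_powr_real_powr del: of_nat_Suc)
    moreover have "(\<lambda>N. real (Suc N) powr (1 - Re z)) \<longlonglongrightarrow> 0" using z by real_asymp
    hence "(\<lambda>N. real (Suc N) powr (1 - Re z) / norm (z - 1)) \<longlonglongrightarrow> 0 / norm (z - 1)"
      using z' by (intro tendsto_intros) auto
    ultimately show ?thesis by simp
  qed
  from tendsto_diff[OF zeta_half_plane_limit[OF z'] tendsto_norm_zero_cancel[OF this]]
  show ?thesis by (simp add: sums_def)
qed

text \<open>Summation by parts reduces \<open>Re w > 0\<close> to \<open>w + 1\<close>, where Lipschitz's formula applies.\<close>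
lemma exp_series_decomposition:
  fixes y :: real
  assumes w: "0 < Re w" and y: "y > 0"
  shows "exp_series w (of_real y) = (\<Sum>n. zeta_term (1 - w) n * exp (- (of_nat (Suc n) * of_real y)))
     + ((exp (of_real y) - 1) * exp_series (w + 1) (of_real y) - 1) / w"
proof -
  have w0: "w \<noteq> 0" using w by auto
  have y': "Re (of_real y) > 0" using y by simp
  define E where "E = (\<lambda>n. exp (- (of_nat (Suc n) * complex_of_real y)))"
  define p where "p = (\<lambda>n. of_nat (Suc n) powr w)"
  have s0: "summable (\<lambda>n. of_nat (Suc n) powr (w - 1) * E n)"
    unfolding E_def by (rule summable_norm_cancel[OF summable_exp_series[OF y']])
  have s1: "summable (\<lambda>n. p n * E n)"
    using summable_norm_cancel[OF summable_exp_series[OF y', of "w + 1"]] by (simp add: E_def p_def)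
  have s2: "summable (\<lambda>n. p (Suc n) * E (Suc n))" using s1 by (subst summable_Suc_iff)
  have E: "E n = exp (of_real y) * E (Suc n)" for n
    by (simp add: E_def mult_exp_exp algebra_simps)
  \<comment> \<open>The two powers in \<open>zeta_term\<close> belong to consecutive indices;
    \<open>E n = exp y * E (Suc n)\<close> matches each with its own exponential.\<close>
  have zt: "zeta_term (1 - w) n * E n = of_nat (Suc n) powr (w - 1) * E n - (exp (of_real y) * (p (Suc n) * E (Suc n)) - p n * E n) / w" for n
  proof -
    have ring: "(A - (P - Q) / w) * X = A * X - (P * X - Q * X) / w" for A P Q X
      by (simp add: left_diff_distrib)
    have "zeta_term (1 - w) n = of_nat (Suc n) powr (w - 1) - (p (Suc n) - p n) / w"
      using w0 by (simp add: zeta_term_def p_def field_simps)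
    hence "zeta_term (1 - w) n * E n = of_nat (Suc n) powr (w - 1) * E n - (p (Suc n) * E n - p n * E n) / w"
      by (simp only: ring)
    also have "p (Suc n) * E n = exp (of_real y) * (p (Suc n) * E (Suc n))" by (simp add: E[of n])
    finally show ?thesis .
  qed
  have split: "(\<Sum>n. p (Suc n) * E (Suc n)) = exp_series (w + 1) (of_real y) - exp (- of_real y)"
    using suminf_split_head[OF s1] by (simp add: exp_series_def E_def p_def)
  have "(\<Sum>n. zeta_term (1 - w) n * E n) = (\<Sum>n. of_nat (Suc n) powr (w - 1) * E n) -
      (exp (of_real y) * (\<Sum>n. p (Suc n) * E (Suc n)) - (\<Sum>n. p n * E n)) / w"
    unfolding zt using s0 s1 s2
    by (intro sums_unique[symmetric] sums_diff sums_divide sums_mult summable_sums)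
  also have "(\<Sum>n. of_nat (Suc n) powr (w - 1) * E n) = exp_series w (of_real y)" by (simp add: exp_series_def E_def)
  also have "(\<Sum>n. p n * E n) = exp_series (w + 1) (of_real y)" by (simp add: exp_series_def E_def p_def)
  also have "exp (of_real y) * (\<Sum>n. p (Suc n) * E (Suc n)) - exp_series (w + 1) (of_real y) =
      (exp (of_real y) - 1) * exp_series (w + 1) (of_real y) - 1"
  proof -
    have "exp (of_real y) * exp (- complex_of_real y) = 1" by (simp add: mult_exp_exp)
    thus ?thesis unfolding split by (simp add: algebra_simps)
  qed
  finally show ?thesis by (simp add: E_def del: of_nat_Suc)
qed

text \<open>Let \<open>y\<close> tend to 0 in \<open>exp_series_decomposition\<close>. The series of
  \<open>zeta_term\<close>s converges by dominated convergence, the remainder at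
  \<open>w + 1\<close> is multiplied by \<open>exp y - 1\<close>, and the constant
  \<open>- 1 / w\<close> is the pole part \<open>1 / (z - 1)\<close> at
  \<open>z = 1 - w\<close>.\<close>

lemma exp_constant_strip:
  assumes w: "0 < Re w" "Re w < 1"
  shows "exp_constant w = zeta_half_plane (1 - w)"
proof -
  have w0: "w \<noteq> 0" using w by auto
  have z: "Re (1 - w) > 0" "1 - w \<noteq> 1" using w w0 by auto
  have 1: "((\<lambda>y. \<Sum>n. zeta_term (1 - w) n * exp (- (of_nat (Suc n) * of_real y))) \<longlongrightarrow> (\<Sum>n. zeta_term (1 - w) n * exp (- (of_nat (Suc n) * of_real 0)))) (at_right (0::real))"
  proof (rule tendsto_suminf_dominated[OF _ _ summable_zeta_term[OF z]])
    show "((\<lambda>y. zeta_term (1 - w) n * exp (- (of_nat (Suc n) * of_real y))) \<longlongrightarrow> zeta_term (1 - w) n * exp (- (of_nat (Suc n) * of_real 0))) (at_right (0::real))" for n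
      by (intro tendsto_intros)
    show "eventually (\<lambda>y. \<forall>k. norm (zeta_term (1 - w) k * exp (- (of_nat (Suc k) * of_real y))) \<le> norm (zeta_term (1 - w) k)) (at_right (0::real))"
      using eventually_at_right_less[of 0]
    proof eventually_elim
      case (elim y)
      have "0 \<le> real (Suc k) * y" for k using elim by (intro mult_nonneg_nonneg) auto
      thus ?case by (auto simp: norm_mult simp del: of_nat_Suc intro!: mult_right_le_one_le)
    qed
  qed auto
  have 2: "((\<lambda>y. (exp (complex_of_real y) - 1) * exp_remainder (w + 1) (of_real y)) \<longlongrightarrow> (exp (of_real 0) - 1) * exp_constant (w + 1)) (at_right 0)"
    using w by (intro tendsto_intros exp_remainder_tendsto) auto
  \<comment> \<open>What is left when the pole parts at \<open>w + 1\<close> and at \<open>w\<close>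
    cancel to leading order: a quantity of size \<open>y powr (1 - Re w)\<close>, which vanishes
    since \<open>Re w < 1\<close>.\<close>
  have 3: "((\<lambda>y. Gamma w * (of_real ((exp y - 1) / y - 1) * of_real y powr (- w))) \<longlongrightarrow> 0) (at_right (0::real))"
  proof (rule tendsto_mult_right_zero, rule tendsto_norm_zero_cancel)
    have lim: "((\<lambda>y::real. \<bar>(exp y - 1) / y - 1\<bar> * y powr - Re w) \<longlongrightarrow> 0) (at_right 0)"
      using w by real_asymp
    show "((\<lambda>y::real. norm (complex_of_real ((exp y - 1) / y - 1) * of_real y powr (- w))) \<longlongrightarrow> 0) (at_right 0)"
      by (rule Lim_transform_eventually[OF lim], rule eventually_mono[OF eventually_at_right_less[of 0]])
         (simp add: norm_mult norm_powr_real_powr del: of_real_diff of_real_divide)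
  qed
  have ev: "eventually (\<lambda>y. (\<Sum>n. zeta_term (1 - w) n * exp (- (of_nat (Suc n) * of_real y))) +
      (exp (complex_of_real y) - 1) * exp_remainder (w + 1) (of_real y) / w - 1 / w +
      Gamma w * (of_real ((exp y - 1) / y - 1) * of_real y powr (- w)) = exp_remainder w (of_real y)) (at_right 0)"
    using eventually_at_right_less[of 0]
  proof eventually_elim
    case (elim y)
    define P where "P = complex_of_real y powr (- w)"
    have y: "complex_of_real y \<noteq> 0" using elim by simp
    have G: "Gamma (w + 1) = w * Gamma w" by (rule Gamma_plus1[OF not_nonpos_Int_half_plane[OF w(1)]])
    have P: "complex_of_real y powr (- (w + 1)) = P / of_real y" using y by (simp add: P_def powr_diff)
    have "exp_series (w + 1) (of_real y) = exp_remainder (w + 1) (of_real y) + w * Gamma w * (P / of_real y)"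
      unfolding exp_remainder_def P G by simp
    hence "exp_remainder w (of_real y) = (\<Sum>n. zeta_term (1 - w) n * exp (- (of_nat (Suc n) * of_real y)))
     + ((exp (of_real y) - 1) * (exp_remainder (w + 1) (of_real y) + w * Gamma w * (P / of_real y)) - 1) / w - Gamma w * P"
      unfolding exp_remainder_def[of w] exp_series_decomposition[OF w(1) elim] P_def by simp
    also have "\<dots> = (\<Sum>n. zeta_term (1 - w) n * exp (- (of_nat (Suc n) * of_real y))) +
      (exp (complex_of_real y) - 1) * exp_remainder (w + 1) (of_real y) / w - 1 / w +
      Gamma w * (((exp (of_real y) - 1) / of_real y - 1) * P)"
      using w0 y by (simp add: field_simps)
    finally show ?case by (simp add: P_def exp_of_real)
  qed
  have "((\<lambda>y. (\<Sum>n. zeta_term (1 - w) n * exp (- (of_nat (Suc n) * of_real y))) +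
      (exp (complex_of_real y) - 1) * exp_remainder (w + 1) (of_real y) / w - 1 / w +
      Gamma w * (of_real ((exp y - 1) / y - 1) * of_real y powr (- w))) \<longlongrightarrow>
      (\<Sum>n. zeta_term (1 - w) n * exp (- (of_nat (Suc n) * of_real 0))) + (exp (of_real 0) - 1) * exp_constant (w + 1) / w - 1 / w + 0) (at_right 0)"
    using w0 by (intro tendsto_add tendsto_diff tendsto_divide tendsto_const 1 2 3) auto
  hence "((\<lambda>y. exp_remainder w (of_real y)) \<longlongrightarrow>
      (\<Sum>n. zeta_term (1 - w) n * exp (- (of_nat (Suc n) * of_real 0))) + (exp (of_real 0) - 1) * exp_constant (w + 1) / w - 1 / w + 0) (at_right 0)"
    using ev by (rule Lim_transform_eventually)
  from tendsto_unique[OF _ this exp_remainder_tendsto[OF w(1)]]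
  show ?thesis using w0 by (simp add: zeta_half_plane_def)
qed

text \<open>Makes the definite description explicit. The two formulas are holomorphic for
  \<open>Re z > 0\<close>, \<open>z \<noteq> 1\<close>, and for \<open>Re z < 1\<close>; they agree
  on the common strip and so glue on the punctured plane. Any competitor agrees for
  \<open>Re z > 1\<close>, hence everywhere by the identity theorem, and at 1 by convention.\<close>

theorem riemann_zeta_eq:
  "riemann_zeta = (\<lambda>z. if z = 1 then 0 else if Re z > 0 then zeta_half_plane z else exp_constant (1 - z))"
  (is "_ = ?f")
proof -
  let ?P = "\<lambda>f. f holomorphic_on (- {1}) \<and>
     (\<forall>s. Re s > 1 \<longrightarrow> (\<lambda>n. 1 / of_nat (Suc n) powr s) sums f s) \<and> f 1 = (0::complex)"
  have hol1: "?f holomorphic_on ({z. Re z > 0} - {1})"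
    by (rule holomorphic_transform[OF holomorphic_zeta_half_plane]) auto
  have "(exp_constant \<circ> (\<lambda>z. 1 - z)) holomorphic_on {z. Re z < 1}"
    by (rule holomorphic_on_compose_gen[OF _ holomorphic_exp_constant]) (auto intro!: holomorphic_intros)
  hence hol2: "?f holomorphic_on {z. Re z < 1}"
    by (rule holomorphic_transform) (use exp_constant_strip[of "1 - z" for z] in auto)
  have "?f holomorphic_on (({z. Re z > 0} - {1}) \<union> {z. Re z < 1})"
    by (intro holomorphic_on_Un hol1 hol2 open_Diff open_halfspace_Re_gt open_halfspace_Re_lt) auto
  also have "({z. Re z > 0} - {1}) \<union> {z. Re z < 1} = - {1}" by auto
  finally have hol: "?f holomorphic_on - {1}" .
  have P: "?P ?f"
  proof (intro conjI allI impI hol)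
    fix s :: complex assume s: "Re s > 1"
    hence "?f s = zeta_half_plane s" by auto
    moreover have "1 / of_nat (Suc n) powr s = of_nat (Suc n) powr - s" for n
      by (simp add: powr_minus divide_inverse)
    ultimately show "(\<lambda>n. 1 / of_nat (Suc n) powr s) sums ?f s"
      using zeta_half_plane_sums[OF s] by (simp only:)
  qed auto
  show ?thesis
    unfolding riemann_zeta_def
  proof (rule the_equality)
    show "?P ?f" by (rule P)
    fix g assume g: "?P g"
    show "g = ?f"
    proof
      fix z
      show "g z = ?f z"
      proof (cases "z = 1")
        case True
        thus ?thesis using g by simp
      next
        case False
        show ?thesis
        proof (rule analytic_continuation_open[of "{z. Re z > 1}" "- {1}" g ?f z])
          show "open {z. Re z > 1}" by (rule open_halfspace_Re_gt)
          show "{z. Re z > 1} \<noteq> {}" by (auto intro!: exI[of _ 2])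
          show "connected (- {1::complex})" by (rule connected_punctured_universe) simp
          show "g holomorphic_on - {1}" using g by blast
          show "?f holomorphic_on - {1}" by (rule hol)
          show "g z = ?f z" if "z \<in> {z. Re z > 1}" for z
            using g P that sums_unique2 by blast
        qed (use False in auto)
      qed
    qed
  qed
qed

corollary riemann_zeta_half_plane: "Re z > 0 \<Longrightarrow> z \<noteq> 1 \<Longrightarrow> riemann_zeta z = zeta_half_plane z"
  by (simp add: riemann_zeta_eq)

corollary riemann_zeta_sums: "Re z > 1 \<Longrightarrow> (\<lambda>n. of_nat (Suc n) powr - z) sums riemann_zeta z"
  using zeta_half_plane_sums[of z] by (subst riemann_zeta_half_plane) auto

corollary exp_constant_eq_zeta: "Re w > 0 \<Longrightarrow> exp_constant w = riemann_zeta (1 - w)"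
  using exp_constant_strip[of w] by (auto simp: riemann_zeta_eq)

corollary riemann_zeta_half_limit:
  "(\<lambda>D. (\<Sum>k=1..D. complex_of_real (real k powr (- 1 / 2))) - of_real (2 * sqrt (real D))) \<longlonglongrightarrow> riemann_zeta (1 / 2)"
proof -
  have "(\<lambda>N. (\<Sum>n<N. of_nat (Suc n) powr - (1 / 2)) + of_nat (Suc N) powr (1 - 1 / 2) / (1 / 2 - 1)) \<longlonglongrightarrow> zeta_half_plane (1 / 2)"
    by (rule zeta_half_plane_limit) auto
  moreover have "of_nat (Suc n) powr - (1 / 2) = complex_of_real (real (Suc n) powr (- 1 / 2))" for n
    by (subst powr_of_real[symmetric]) auto
  moreover have "of_nat (Suc N) powr (1 - 1 / 2) / (1 / 2 - 1) = complex_of_real (- (2 * sqrt (real (Suc N))))" for N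
  proof -
    have "of_nat (Suc N) powr (1 - 1 / 2) = complex_of_real (real (Suc N) powr (1 / 2))"
      by (subst powr_of_real[symmetric]) auto
    thus ?thesis by (simp add: powr_half_sqrt)
  qed
  ultimately have "(\<lambda>N. (\<Sum>n<N. complex_of_real (real (Suc n) powr (- 1 / 2))) + complex_of_real (- (2 * sqrt (real (Suc N))))) \<longlonglongrightarrow> zeta_half_plane (1 / 2)"
    by (simp only:)
  \<comment> \<open>The counterterm has index \<open>N + 1\<close> while the sum stops at
    \<open>N\<close>; the discrepancy tends to 0.\<close>
  moreover have "(\<lambda>N. complex_of_real (2 * sqrt (real (Suc N)) - 2 * sqrt (real N))) \<longlonglongrightarrow> of_real 0"
    by (intro tendsto_of_real) real_asymp
  ultimately have "(\<lambda>N. (\<Sum>n<N. complex_of_real (real (Suc n) powr (- 1 / 2))) + complex_of_real (- (2 * sqrt (real (Suc N)))) +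
      complex_of_real (2 * sqrt (real (Suc N)) - 2 * sqrt (real N))) \<longlonglongrightarrow> zeta_half_plane (1 / 2) + of_real 0"
    by (rule tendsto_add)
  thus ?thesis by (simp add: riemann_zeta_half_plane sum.atLeast1_atMost_eq)
qed

section \<open>Functional equation and the regularized formula\<close>

lemma powr_mult_ii:
  fixes r :: real and a :: complex
  assumes "r \<ge> 0"
  shows "(of_real r * \<i>) powr a = of_real r powr a * exp (\<i> * of_real pi * a / 2)"
    and "(- (of_real r * \<i>)) powr a = of_real r powr a * exp (- (\<i> * of_real pi * a / 2))"
proof -
  have "(of_real r * \<i>) powr a = of_real r powr a * \<i> powr a"
    "(of_real r * - \<i>) powr a = of_real r powr a * (- \<i>) powr a"
    using assms by (intro powr_times_real_left; simp)+
  thus "(of_real r * \<i>) powr a = of_real r powr a * exp (\<i> * of_real pi * a / 2)"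
    "(- (of_real r * \<i>)) powr a = of_real r powr a * exp (- (\<i> * of_real pi * a / 2))"
    by (simp_all add: powr_def mult_ac)
qed

text \<open>At \<open>y = 0\<close> the two bases are opposite imaginary numbers, and their
  principal powers carry conjugate-type phases that add up to a cosine. This is the trigonometric
  factor of the functional equation.\<close>

lemma lipschitz_term_0:
  "lipschitz_term w 0 m = 2 * of_real (2 * pi) powr (- w) * cos (of_real pi * w / 2) * of_nat (Suc m) powr (- w)"
proof -
  define r where "r = 2 * pi * real (Suc m)"
  have r: "r \<ge> 0" by (simp add: r_def)
  have "0 + 2 * of_real pi * \<i> * of_nat (Suc m) = of_real r * \<i>"
    "0 - 2 * of_real pi * \<i> * of_nat (Suc m) = - (of_real r * \<i>)" by (simp_all add: r_def)
  hence "lipschitz_term w 0 m = of_real r powr (- w) * (exp (\<i> * of_real pi * (- w) / 2) + exp (- (\<i> * of_real pi * (- w) / 2)))"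
    unfolding lipschitz_term_def by (simp only: powr_mult_ii[OF r] distrib_left)
  also have "exp (\<i> * of_real pi * (- w) / 2) + exp (- (\<i> * of_real pi * (- w) / 2)) = 2 * cos (of_real pi * w / 2)"
    by (simp add: cos_exp_eq mult_ac)
  also have "of_real r powr (- w) = of_real (2 * pi) powr (- w) * of_nat (Suc m) powr (- w)"
  proof -
    have "complex_of_real r = of_real (2 * pi) * of_nat (Suc m)" by (simp add: r_def)
    thus ?thesis by (simp only:) (rule powr_times_real_left; simp)
  qed
  finally show ?thesis by (simp add: mult_ac)
qed

lemma lipschitz_term_sums_0:
  assumes "Re w > 1"
  shows "(\<lambda>m. lipschitz_term w 0 m) sums (2 * of_real (2 * pi) powr (- w) * cos (of_real pi * w / 2) * riemann_zeta w)"
  unfolding lipschitz_term_0 by (intro sums_mult riemann_zeta_sums assms)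

text \<open>Lipschitz's formula as \<open>y\<close> tends to 0: its left side tends to
  \<open>riemann_zeta (1 - w)\<close>, its right side by dominated convergence to the series at
  \<open>y = 0\<close>, which is a multiple of the Dirichlet series of
  \<open>riemann_zeta w\<close>.\<close>

theorem riemann_zeta_functional_equation:
  assumes w: "Re w > 1"
  shows "riemann_zeta (1 - w) = 2 * of_real (2 * pi) powr (- w) * Gamma w * cos (of_real pi * w / 2) * riemann_zeta w"
proof -
  have "((\<lambda>y. \<Sum>m. lipschitz_term w (of_real y) m) \<longlongrightarrow> (\<Sum>m. lipschitz_term w 0 m)) (at_right (0::real))"
  proof (rule tendsto_suminf_dominated)
    show "summable (\<lambda>m. 2 * exp (pi / 2 * \<bar>Im w\<bar>) * real (Suc m) powr - Re w)"
      by (intro summable_mult powr_nat_summable w)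
    show "eventually (\<lambda>y. \<forall>m. norm (lipschitz_term w (of_real y) m) \<le> 2 * exp (pi / 2 * \<bar>Im w\<bar>) * real (Suc m) powr - Re w) (at_right (0::real))"
      using eventually_at_right_less[of 0]
      by eventually_elim (use w norm_lipschitz_term_sum_le in auto)
    show "((\<lambda>y. lipschitz_term w (of_real y) m) \<longlongrightarrow> lipschitz_term w 0 m) (at_right (0::real))" for m
    proof -
      have nr: "0 + 2 * of_real pi * \<i> * of_nat (Suc m) \<notin> \<real>\<^sub>\<le>\<^sub>0" "0 - 2 * of_real pi * \<i> * of_nat (Suc m) \<notin> \<real>\<^sub>\<le>\<^sub>0"
        by (auto simp: complex_nonpos_Reals_iff simp del: of_nat_Suc)
      have "((\<lambda>y. lipschitz_term w (of_real y) m) \<longlongrightarrow> lipschitz_term w (of_real 0) m) (at_right (0::real))"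
        unfolding lipschitz_term_def using nr by (intro tendsto_intros) auto
      thus ?thesis by simp
    qed
  qed auto
  hence "((\<lambda>y. Gamma w * (\<Sum>m. lipschitz_term w (of_real y) m)) \<longlongrightarrow> Gamma w * (\<Sum>m. lipschitz_term w 0 m)) (at_right (0::real))"
    by (intro tendsto_mult tendsto_const)
  moreover have "eventually (\<lambda>y. Gamma w * (\<Sum>m. lipschitz_term w (of_real y) m) = exp_remainder w (of_real y)) (at_right 0)"
    using eventually_at_right_less[of 0]
    by eventually_elim (simp only: exp_remainder_def lipschitz_formula[OF w])
  ultimately have "((\<lambda>y. exp_remainder w (of_real y)) \<longlongrightarrow> Gamma w * (\<Sum>m. lipschitz_term w 0 m)) (at_right 0)"
    by (rule Lim_transform_eventually)
  moreover have "((\<lambda>y. exp_remainder w (of_real y)) \<longlongrightarrow> riemann_zeta (1 - w)) (at_right 0)"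
    using exp_remainder_tendsto[of w] exp_constant_eq_zeta[of w] w by simp
  ultimately have "riemann_zeta (1 - w) = Gamma w * (\<Sum>m. lipschitz_term w 0 m)"
    using tendsto_unique[of "at_right (0::real)"] by force
  thus ?thesis using lipschitz_term_sums_0[OF w] by (simp add: sums_iff mult_ac)
qed

lemma has_field_derivative_lipschitz_term:
  assumes "Re z \<ge> 0" "Im z = 0"
  shows "((\<lambda>z. lipschitz_term w z m) has_field_derivative - w * lipschitz_term (w + 1) z m) (at z)"
proof -
  have nr: "z + 2 * of_real pi * \<i> * of_nat (Suc m) \<notin> \<real>\<^sub>\<le>\<^sub>0" "z - 2 * of_real pi * \<i> * of_nat (Suc m) \<notin> \<real>\<^sub>\<le>\<^sub>0"
    using assms pi_gt_zero by (auto simp: complex_nonpos_Reals_iff complex_eq_iff simp del: of_nat_Suc)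
  have "((\<lambda>z. lipschitz_term w z m) has_field_derivative (- w * (z + 2 * of_real pi * \<i> * of_nat (Suc m)) powr (- w - 1) +
       - w * (z - 2 * of_real pi * \<i> * of_nat (Suc m)) powr (- w - 1))) (at z)"
    unfolding lipschitz_term_def using nr by (auto intro!: derivative_eq_intros)
  also have "- w * (z + 2 * of_real pi * \<i> * of_nat (Suc m)) powr (- w - 1) +
       - w * (z - 2 * of_real pi * \<i> * of_nat (Suc m)) powr (- w - 1) = - w * lipschitz_term (w + 1) z m"
  proof -
    have e: "- (w + 1) = - w - 1" by simp
    show ?thesis unfolding lipschitz_term_def e by (rule distrib_left[symmetric])
  qed
  finally show ?thesis .
qed

text \<open>Subtracting the value at 0 gains one power of \<open>Suc m\<close> by the mean value
  inequality, because the derivative is a term for \<open>w + 1\<close>. The regularized series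
  therefore converges for \<open>Re w > 0\<close>.\<close>

lemma norm_lipschitz_term_diff_le:
  fixes y :: real
  assumes y: "y \<ge> 0" and w: "Re w \<ge> 0"
  shows "norm (lipschitz_term w (of_real y) m - lipschitz_term w 0 m) \<le>
    norm w * (2 * exp (pi / 2 * \<bar>Im w\<bar>) * real (Suc m) powr - (Re w + 1)) * y"
proof -
  have S: "\<exists>t. z = of_real t \<and> 0 \<le> t" if "z \<in> closed_segment 0 (complex_of_real y)" for z
    using that y closed_segment_of_real[of 0 y, where 'a = complex]
    by (auto simp: closed_segment_eq_real_ivl)
  have "norm (lipschitz_term w (of_real y) m - lipschitz_term w 0 m) \<le>
    norm w * (2 * exp (pi / 2 * \<bar>Im w\<bar>) * real (Suc m) powr - (Re w + 1)) * norm (complex_of_real y - 0)"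
  proof (rule field_differentiable_bound[of "closed_segment 0 (complex_of_real y)" _ "\<lambda>z. - w * lipschitz_term (w + 1) z m"])
    fix z assume "z \<in> closed_segment 0 (complex_of_real y)"
    from S[OF this] obtain t where t: "z = of_real t" "t \<ge> 0" by blast
    show "((\<lambda>z. lipschitz_term w z m) has_field_derivative - w * lipschitz_term (w + 1) z m) (at z within closed_segment 0 (complex_of_real y))"
      using t by (intro has_field_derivative_at_within[OF has_field_derivative_lipschitz_term]) auto
    show "norm (- w * lipschitz_term (w + 1) z m) \<le> norm w * (2 * exp (pi / 2 * \<bar>Im w\<bar>) * real (Suc m) powr - (Re w + 1))"
      using norm_lipschitz_term_sum_le[of t "w + 1" m] t w by (simp add: norm_mult mult_left_mono)
  qed auto
  thus ?thesis using y by simp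
qed

text \<open>Differentiated term by term in \<open>y\<close>, the series becomes Lipschitz's formula
  at \<open>w + 1\<close>, that is, the derivative of \<open>exp_remainder w\<close>. Both sides
  thus differ by a constant; as the series vanishes at 0, the constant is the limit of the remainder
  there.\<close>

theorem regularized_lipschitz_formula:
  fixes y :: real
  assumes w: "Re w > 0" and y: "y > 0"
  shows "(\<lambda>m. Gamma w * (lipschitz_term w (of_real y) m - lipschitz_term w 0 m)) sums
           (exp_remainder w (of_real y) - riemann_zeta (1 - w))"
proof -
  define S where "S = closed_segment (0::complex) (of_real y)"
  have S_eq: "S = complex_of_real ` {0..y}"
    using y closed_segment_of_real[of 0 y] by (simp add: S_def closed_segment_eq_real_ivl)
  have S: "\<exists>t. u = of_real t \<and> 0 \<le> t \<and> t \<le> y" if "u \<in> S" for u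
    using that unfolding S_eq by auto
  let ?f = "\<lambda>m z. Gamma w * (lipschitz_term w z m - lipschitz_term w 0 m)"
  let ?f' = "\<lambda>m z. - Gamma (w + 1) * lipschitz_term (w + 1) z m"
  define g' where "g' = (\<lambda>z. \<Sum>m. ?f' m z)"
  have G: "Gamma (w + 1) = w * Gamma w" by (rule Gamma_plus1[OF not_nonpos_Int_half_plane[OF w]])
  have cS: "convex S" by (simp add: S_def)
  have "\<exists>g. \<forall>x\<in>S. (\<lambda>m. ?f m x) sums g x \<and> (g has_field_derivative g' x) (at x within S)"
  proof (rule has_field_derivative_series[OF cS, of ?f ?f' g' 0])
    fix m z assume z: "z \<in> S"
    from S[OF z] obtain t where t: "z = of_real t" "t \<ge> 0" by blast
    have "(?f m has_field_derivative Gamma w * (- w * lipschitz_term (w + 1) z m)) (at z)"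
      using t by (auto intro!: derivative_eq_intros has_field_derivative_lipschitz_term)
    also have "Gamma w * (- w * lipschitz_term (w + 1) z m) = ?f' m z"
      by (simp add: G mult_ac)
    finally show "(?f m has_field_derivative ?f' m z) (at z within S)"
      by (rule has_field_derivative_at_within)
  next
    let ?B = "\<lambda>m. norm (Gamma (w + 1)) * (2 * exp (pi / 2 * \<bar>Im (w + 1)\<bar>) * real (Suc m) powr - Re (w + 1))"
    show "uniform_limit S (\<lambda>n x. \<Sum>i<n. ?f' i x) g' sequentially"
      unfolding g'_def
    proof (rule Weierstrass_m_test)
      fix m z assume z: "z \<in> S"
      from S[OF z] obtain t where t: "z = of_real t" "t \<ge> 0" by blast
      show "norm (?f' m z) \<le> ?B m"
        unfolding t(1) norm_mult norm_minus_cancel using w t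
        by (intro mult_left_mono norm_lipschitz_term_sum_le) auto
    next
      show "summable ?B" using w by (intro summable_mult powr_nat_summable) auto
    qed
  qed (auto simp: S_def)
  then obtain g where g: "\<And>x. x \<in> S \<Longrightarrow> (\<lambda>m. ?f m x) sums g x"
    "\<And>x. x \<in> S \<Longrightarrow> (g has_field_derivative g' x) (at x within S)" by blast
  have "0 \<in> S" by (simp add: S_def)
  have g0: "g 0 = 0" using g(1)[OF \<open>0 \<in> S\<close>] by (simp add: sums_iff)
  have tS: "of_real t \<in> S" if "0 \<le> t" "t \<le> y" for t
    using that unfolding S_eq by auto
  \<comment> \<open>The segment without 0: the series lives on all of \<open>S\<close>, but the
    remainder has its differential equation only for positive real part. The point 0 enters through
    a limit.\<close>
  define S' where "S' = complex_of_real ` {0<..y}"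
  have S'S: "S' \<subseteq> S" using tS by (auto simp: S'_def)
  have "\<exists>c. \<forall>x\<in>S'. exp_remainder w x - g x = c"
  proof (rule has_field_derivative_zero_constant)
    show "convex S'" unfolding S'_def
      by (rule convex_linear_image) (auto simp: linear_of_real)
    fix z assume z: "z \<in> S'"
    then obtain t where t: "z = of_real t" "t > 0" by (auto simp: S'_def)
    have "g' z = - exp_remainder (w + 1) z"
    proof -
      have "exp_remainder (w + 1) z = Gamma (w + 1) * (\<Sum>m. lipschitz_term (w + 1) z m)"
        unfolding exp_remainder_def t(1) using w t by (intro lipschitz_formula) auto
      moreover have "summable (\<lambda>m. lipschitz_term (w + 1) z m)"
        unfolding t(1) using w t by (intro summable_norm_cancel[OF summable_lipschitz_term]) auto
      hence "g' z = - Gamma (w + 1) * (\<Sum>m. lipschitz_term (w + 1) z m)"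
        unfolding g'_def by (rule suminf_mult)
      ultimately show ?thesis by simp
    qed
    moreover have "(g has_field_derivative g' z) (at z within S')"
      using g(2) z S'S by (meson DERIV_subset subsetD)
    moreover have "(exp_remainder w has_field_derivative - exp_remainder (w + 1) z) (at z within S')"
      using t w by (intro has_field_derivative_at_within[OF has_field_derivative_exp_remainder]) auto
    ultimately show "((\<lambda>x. exp_remainder w x - g x) has_field_derivative 0) (at z within S')"
      using DERIV_diff by fastforce
  qed
  then obtain c where c: "\<And>x. x \<in> S' \<Longrightarrow> exp_remainder w x - g x = c" by blast
  have "((\<lambda>t. g (of_real t)) \<longlongrightarrow> g 0) (at_right (0::real))"
  proof -
    have "continuous (at 0 within S) g" using g(2)[OF \<open>0 \<in> S\<close>] by (rule DERIV_continuous)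
    hence A: "(g \<longlongrightarrow> g 0) (at 0 within S)" by (simp add: continuous_within)
    have B: "filterlim complex_of_real (at 0 within S) (at_right 0)"
      unfolding filterlim_at
    proof
      show "eventually (\<lambda>t. complex_of_real t \<in> S \<and> complex_of_real t \<noteq> 0) (at_right 0)"
        using eventually_at_right_real[OF y] by eventually_elim (use tS in auto)
      show "(complex_of_real \<longlongrightarrow> 0) (at_right 0)" by (auto intro!: tendsto_eq_intros)
    qed
    show ?thesis by (rule filterlim_compose[OF A B])
  qed
  moreover have "((\<lambda>t. exp_remainder w (of_real t)) \<longlongrightarrow> riemann_zeta (1 - w)) (at_right 0)"
    using exp_remainder_tendsto[of w] exp_constant_eq_zeta[of w] w by simp
  ultimately have "((\<lambda>t. exp_remainder w (of_real t) - g (of_real t)) \<longlongrightarrow> riemann_zeta (1 - w) - g 0) (at_right 0)"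
    by (intro tendsto_diff)
  moreover have "eventually (\<lambda>t. exp_remainder w (of_real t) - g (of_real t) = c) (at_right 0)"
    using eventually_at_right_real[OF y] by eventually_elim (use c in \<open>auto simp: S'_def\<close>)
  ultimately have "((\<lambda>t. c) \<longlongrightarrow> riemann_zeta (1 - w) - g 0) (at_right (0::real))"
    by (rule Lim_transform_eventually)
  hence "c = riemann_zeta (1 - w)" using g0 tendsto_unique[OF _ tendsto_const] by force
  moreover have "of_real y \<in> S'" using y by (auto simp: S'_def)
  ultimately have "g (of_real y) = exp_remainder w (of_real y) - riemann_zeta (1 - w)"
    using c[of "of_real y"] by (simp add: algebra_simps)
  with g(1)[of "of_real y"] S'S \<open>of_real y \<in> S'\<close> show ?thesis by auto
qed

section \<open>The Mellin transform of the damped sine series\<close>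

lemma damped_sine_series_sums:
  assumes a: "a > 0"
  shows "(\<lambda>d. complex_of_real (real (Suc d) powr (- 1 / 2) * (exp (- a / real (Suc d)) - 1))) sums
     (of_real (damped_sine_series a) - of_real (2 * sqrt (pi * a)) - riemann_zeta (1 / 2))"
proof -
  have "(\<lambda>D. complex_of_real ((\<Sum>k=1..D. real k powr (- 1 / 2) * exp (- a / real k)) - 2 * sqrt (real D)) -
      ((\<Sum>k=1..D. complex_of_real (real k powr (- 1 / 2))) - of_real (2 * sqrt (real D))))
     \<longlonglongrightarrow> complex_of_real (damped_sine_series a - 2 * sqrt (pi * a)) - riemann_zeta (1 / 2)"
    by (intro tendsto_diff tendsto_of_real damped_sine_series_limit[OF a] riemann_zeta_half_limit)
  moreover have "complex_of_real ((\<Sum>k=1..D. real k powr (- 1 / 2) * exp (- a / real k)) - 2 * sqrt (real D)) -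
      ((\<Sum>k=1..D. complex_of_real (real k powr (- 1 / 2))) - of_real (2 * sqrt (real D))) =
      (\<Sum>d<D. complex_of_real (real (Suc d) powr (- 1 / 2) * (exp (- a / real (Suc d)) - 1)))" for D
    by (simp add: sum.atLeast1_atMost_eq right_diff_distrib sum_subtractf del: of_nat_Suc)
  ultimately show ?thesis by (simp add: sums_def)
qed

lemma abs_damped_term_le:
  assumes "a \<ge> 0"
  shows "\<bar>real (Suc d) powr (- 1 / 2) * (exp (- a / real (Suc d)) - 1)\<bar> \<le> a * real (Suc d) powr (- (3 / 2))"
proof -
  have "0 \<le> a / real (Suc d)" using assms by simp
  hence "\<bar>exp (- (a / real (Suc d))) - 1\<bar> \<le> a / real (Suc d)"
    using exp_ge_add_one_self[of "- (a / real (Suc d))"] by (simp add: abs_if)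
  hence "real (Suc d) powr (- 1 / 2) * \<bar>exp (- (a / real (Suc d))) - 1\<bar> \<le> real (Suc d) powr (- 1 / 2) * (a / real (Suc d))"
    by (intro mult_left_mono) auto
  also have "\<dots> = a * (real (Suc d) powr (- 1 / 2) / real (Suc d) powr 1)" by simp
  also have "real (Suc d) powr (- 1 / 2) / real (Suc d) powr 1 = real (Suc d) powr (- (3 / 2))"
    by (subst powr_diff[symmetric]) simp
  finally show ?thesis by (simp add: abs_mult)
qed

text \<open>Rapid decay from \<open>exp_sqrt_le\<close>. One power of the index, available since
  \<open>N \<ge> 1\<close>, together with the factor \<open>1 / sqrt (Suc m)\<close> makes the
  majorant summable with exponent 3/2. The summability of the undamped-phase majorant is returned as
  well for later use.\<close>

lemma abs_damped_sine_series_le: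
  assumes N: "N \<ge> 1"
  obtains C where "C \<ge> 0" "\<And>a. a > 0 \<Longrightarrow> \<bar>damped_sine_series a\<bar> \<le> C / a ^ N"
    "\<And>a. a > 0 \<Longrightarrow> summable (\<lambda>m. sqrt 2 / sqrt (real (Suc m)) * exp (- 2 * sqrt (pi * a * real (Suc m))))"
proof -
  define B where "B = (\<lambda>m. sqrt 2 * fact (2 * N) / (4 * pi) ^ N * real (Suc m) powr (- (3 / 2)))"
  define C where "C = (\<Sum>m. B m)"
  have sB: "summable B" unfolding B_def by (intro summable_mult powr_nat_summable) auto
  have C: "C \<ge> 0" unfolding C_def by (intro suminf_nonneg sB) (auto simp: B_def)
  define u where "u = (\<lambda>a m. sqrt 2 / sqrt (real (Suc m)) * exp (- 2 * sqrt (pi * a * real (Suc m))))"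
  have u: "0 \<le> u a m" "u a m \<le> B m / a ^ N" if a: "a > 0" for a m
  proof -
    show "0 \<le> u a m" by (simp add: u_def)
    have "u a m \<le> sqrt 2 / sqrt (real (Suc m)) * (fact (2 * N) / (4 * pi * a * real (Suc m)) ^ N)"
      unfolding u_def using exp_sqrt_le[OF a, of "real (Suc m)" N] by (intro mult_left_mono) auto
    also have "\<dots> = sqrt 2 * fact (2 * N) / (4 * pi) ^ N / a ^ N * (1 / (sqrt (real (Suc m)) * real (Suc m) ^ N))"
      by (simp add: power_mult_distrib del: of_nat_Suc)
    also have "\<dots> \<le> sqrt 2 * fact (2 * N) / (4 * pi) ^ N / a ^ N * real (Suc m) powr (- (3 / 2))"
    proof (rule mult_left_mono)
      have "real (Suc m) powr (3 / 2) = real (Suc m) powr (1 / 2) * real (Suc m) powr 1"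
        by (subst powr_add[symmetric]) simp
      also have "\<dots> = sqrt (real (Suc m)) * real (Suc m) ^ 1" by (simp add: powr_half_sqrt)
      also have "\<dots> \<le> sqrt (real (Suc m)) * real (Suc m) ^ N"
        using N by (intro mult_left_mono power_increasing) auto
      finally have "1 / (sqrt (real (Suc m)) * real (Suc m) ^ N) \<le> 1 / real (Suc m) powr (3 / 2)"
        by (intro divide_left_mono) (auto intro!: mult_pos_pos)
      thus "1 / (sqrt (real (Suc m)) * real (Suc m) ^ N) \<le> real (Suc m) powr (- (3 / 2))"
        by (simp only: powr_minus_divide)
    qed (use a in auto)
    also have "\<dots> = B m / a ^ N" by (simp add: B_def)
    finally show "u a m \<le> B m / a ^ N" .
  qed
  have su: "summable (u a)" if a: "a > 0" for a
    by (rule summable_comparison_test'[where N = 0, OF summable_divide[OF sB, of "a ^ N"]]) (use u[OF a] in auto)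
  have le: "(\<Sum>m. u a m) \<le> C / a ^ N" if a: "a > 0" for a
  proof -
    have "(\<Sum>m. u a m) \<le> (\<Sum>m. B m / a ^ N)"
      using u[OF a] by (intro suminf_le su[OF a] summable_divide sB) auto
    thus ?thesis by (simp add: C_def suminf_divide[OF sB])
  qed
  have "\<bar>damped_sine_series a\<bar> \<le> C / a ^ N" if a: "a > 0" for a
  proof -
    have b: "norm (u a m * sin (pi / 4 - 2 * sqrt (pi * a * real (Suc m)))) \<le> u a m" for m
      using u(1)[OF a, of m] by (auto simp: abs_mult intro!: mult_right_le_one_le)
    have s: "summable (\<lambda>m. norm (u a m * sin (pi / 4 - 2 * sqrt (pi * a * real (Suc m)))))"
      by (rule summable_comparison_test'[where N = 0, OF su[OF a]]) (use b in auto)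
    have eq: "damped_sine_series a = (\<Sum>m. u a m * sin (pi / 4 - 2 * sqrt (pi * a * real (Suc m))))"
      by (simp only: damped_sine_series_def u_def)
    have "norm (damped_sine_series a) \<le> (\<Sum>m. norm (u a m * sin (pi / 4 - 2 * sqrt (pi * a * real (Suc m)))))"
      unfolding eq by (rule summable_norm[OF s])
    also have "\<dots> \<le> (\<Sum>m. u a m)" by (intro suminf_le s su[OF a] b)
    also have "\<dots> \<le> C / a ^ N" by (rule le[OF a])
    finally show ?thesis by simp
  qed
  thus ?thesis using that[OF C] su unfolding u_def by blast
qed

section \<open>Interchange of sums, substitution and termwise Mellin transform\<close>

text \<open>A product majorant makes the double series absolutely convergent; the interchange is
  integration of a series with respect to counting measure.\<close>

lemma suminf_swap_dominated:
  fixes f :: "nat \<Rightarrow> nat \<Rightarrow> complex"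
  assumes bound: "\<And>k d. norm (f k d) \<le> A k * B d" and A: "summable A" and B: "summable B"
  shows "summable (\<lambda>k. \<Sum>d. f k d)" "(\<Sum>k. \<Sum>d. f k d) = (\<Sum>d. \<Sum>k. f k d)"
    "summable (\<lambda>d. \<Sum>k. f k d)"
proof -
  have rows: "summable (\<lambda>d. norm (f k d))" for k
    by (rule summable_comparison_test'[where N = 0, OF summable_mult[OF B, of "A k"]]) (use bound in auto)
  have cols: "summable (\<lambda>k. norm (f k d))" for d
    by (rule summable_comparison_test'[where N = 0, OF summable_mult2[OF A, of "B d"]]) (use bound in auto)
  have colsum: "summable (\<lambda>d. \<Sum>k. norm (f k d))"
  proof (rule summable_comparison_test'[where N = 0, OF summable_mult[OF B, of "\<Sum>k. A k"]])
    fix d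
    have "(\<Sum>k. norm (f k d)) \<le> (\<Sum>k. A k * B d)"
      using bound cols by (intro suminf_le summable_mult2 A)
    moreover have "(\<Sum>k. norm (f k d)) \<ge> 0" by (intro suminf_nonneg cols) auto
    ultimately show "norm (\<Sum>k. norm (f k d)) \<le> (\<Sum>k. A k) * B d"
      by (simp add: suminf_mult2[OF A])
  qed
  let ?M = "count_space (UNIV :: nat set)"
  have int: "integrable ?M (\<lambda>k. f k d)" for d
    using cols by (simp add: integrable_count_space_nat_iff)
  have int_norm: "(\<integral>k. norm (f k d) \<partial>?M) = (\<Sum>k. norm (f k d))" for d
    using cols[of d] by (intro integral_count_space_nat) (simp add: integrable_count_space_nat_iff)
  have AE: "AE k in ?M. summable (\<lambda>d. norm (f k d))" using rows by simp
  have sm: "summable (\<lambda>d. \<integral>k. norm (f k d) \<partial>?M)" using colsum by (simp add: int_norm)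
  have I: "integrable ?M (\<lambda>k. \<Sum>d. f k d)" by (rule integrable_suminf[OF int AE sm])
  show "summable (\<lambda>k. \<Sum>d. f k d)"
    using I by (simp add: integrable_count_space_nat_iff summable_norm_cancel)
  have "(\<lambda>d. \<integral>k. f k d \<partial>?M) sums (\<integral>k. (\<Sum>d. f k d) \<partial>?M)" by (rule sums_integral[OF int AE sm])
  hence "(\<lambda>d. \<Sum>k. f k d) sums (\<Sum>k. \<Sum>d. f k d)"
    by (simp only: integral_count_space_nat[OF I] integral_count_space_nat[OF int])
  thus "(\<Sum>k. \<Sum>d. f k d) = (\<Sum>d. \<Sum>k. f k d)" "summable (\<lambda>d. \<Sum>k. f k d)"
    by (simp_all add: sums_iff)
qed

text \<open>Substitution \<open>t = u^2\<close>, stated through the transformed integrand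
  \<open>h\<close> so that integrability is inherited from the simpler side. The equality of
  integrals is shown for real-valued linear images of \<open>f\<close>, then used for the real and
  imaginary parts.\<close>

lemma integral_half_line_square_subst:
  fixes f h :: "real \<Rightarrow> complex"
  assumes h: "integrable half_line h" and eq: "\<And>u. u > 0 \<Longrightarrow> (2 * u) *\<^sub>R f (u\<^sup>2) = h u"
  shows "integrable half_line f" "integral\<^sup>L half_line f = integral\<^sup>L half_line h"
proof -
  have img: "(\<lambda>u::real. u\<^sup>2) ` {0<..} = {0<..}"
  proof (intro equalityI subsetI)
    fix t :: real assume "t \<in> {0<..}"
    hence "t = (sqrt t)\<^sup>2" "sqrt t \<in> {0<..}" by auto
    thus "t \<in> (\<lambda>u. u\<^sup>2) ` {0<..}" by blast
  qed auto
  have inj: "inj_on (\<lambda>u::real. u\<^sup>2) {0<..}" by (auto intro!: inj_onI simp: power2_eq_iff)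
  have der: "((\<lambda>u::real. u\<^sup>2) has_field_derivative 2 * u) (at u within {0<..})" for u
    by (auto intro!: derivative_eq_intros)
  have S: "{0::real<..} \<in> sets lebesgue" by simp
  have "integrable half_line (\<lambda>u. \<bar>2 * u\<bar> *\<^sub>R f (u\<^sup>2))"
    by (subst Bochner_Integration.integrable_cong[OF refl, of _ _ h]) (use eq h in auto)
  hence "(\<lambda>u. \<bar>2 * u\<bar> *\<^sub>R f (u\<^sup>2)) absolutely_integrable_on {0<..}"
    by (simp add: set_integrable_def integrable_restrict_space)
  hence "f absolutely_integrable_on (\<lambda>u. u\<^sup>2) ` {0<..}"
    using absolutely_integrable_change_of_variables_real[OF S der inj, of f] by blast
  thus f: "integrable half_line f"
    by (simp add: img set_integrable_def integrable_restrict_space)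
  have real: "integral\<^sup>L half_line (\<lambda>t. R (f t)) = integral\<^sup>L half_line (\<lambda>u. R (h u))"
    if R: "bounded_linear R" for R :: "complex \<Rightarrow> real"
  proof -
    have "integrable half_line (\<lambda>t. R (f t))" by (rule integrable_bounded_linear[OF R f])
    moreover have "integrable half_line (\<lambda>t. R (h t))" by (rule integrable_bounded_linear[OF R h])
    ultimately have ints: "integrable half_line (\<lambda>t. R (f t))" "integrable half_line (\<lambda>t. R (h t))" by blast+
    have "(\<lambda>t. R (f t)) absolutely_integrable_on (\<lambda>u. u\<^sup>2) ` {0<..}"
      using ints(1) by (simp add: img set_integrable_def integrable_restrict_space)
    hence "integral {0<..} (\<lambda>u. \<bar>2 * u\<bar> * R (f (u\<^sup>2))) = integral ((\<lambda>u. u\<^sup>2) ` {0<..}) (\<lambda>t. R (f t))"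
      using has_absolute_integral_change_of_variables_1'[OF S der inj, of "\<lambda>t. R (f t)"] by blast
    moreover have "integral {0<..} (\<lambda>u. \<bar>2 * u\<bar> * R (f (u\<^sup>2))) = integral {0<..} (\<lambda>u. R (h u))"
    proof (rule integral_cong)
      fix u :: real assume u: "u \<in> {0<..}"
      hence "R (h u) = R ((2 * u) *\<^sub>R f (u\<^sup>2))" using eq[of u] by simp
      also have "\<dots> = 2 * u * R (f (u\<^sup>2))" using linear_simps(5)[OF R, of "2 * u" "f (u\<^sup>2)"] by simp
      finally show "\<bar>2 * u\<bar> * R (f (u\<^sup>2)) = R (h u)" using u by simp
    qed
    ultimately show ?thesis
      using lebesgue_integral_eq_integral[OF ints(1) S] lebesgue_integral_eq_integral[OF ints(2) S] by (simp add: img)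
  qed
  show "integral\<^sup>L half_line f = integral\<^sup>L half_line h"
  proof (rule complex_eqI)
    show "Re (integral\<^sup>L half_line f) = Re (integral\<^sup>L half_line h)"
      using real[OF bounded_linear_Re] integral_Re[OF f] integral_Re[OF h] by simp
    show "Im (integral\<^sup>L half_line f) = Im (integral\<^sup>L half_line h)"
      using real[OF bounded_linear_Im] integral_Im[OF f] integral_Im[OF h] by simp
  qed
qed

lemma powr_exp_sqrt_integral:
  assumes w: "Re w > 0" and c: "Re c > 0"
  shows "integrable half_line (\<lambda>t. of_real t powr (w - 1) * exp (- (c * of_real (sqrt t))))"
    and "integral\<^sup>L half_line (\<lambda>t. of_real t powr (w - 1) * exp (- (c * of_real (sqrt t)))) = 2 * (Gamma (2 * w) * c powr (- (2 * w)))"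
proof -
  have w2: "Re (2 * w) > 0" using w by simp
  have eq: "(2 * u) *\<^sub>R (of_real (u\<^sup>2) powr (w - 1) * exp (- (c * of_real (sqrt (u\<^sup>2))))) =
      2 * (of_real u powr (2 * w - 1) * exp (- (c * of_real u)))" if u: "u > 0" for u
  proof -
    have "complex_of_real (u\<^sup>2) powr (w - 1) = of_real u powr (w - 1) * of_real u powr (w - 1)"
      using powr_times_real_left[of "of_real u" "of_real u" "w - 1"] u by (simp add: power2_eq_square)
    also have "\<dots> = of_real u powr (2 * w - 2)" by (simp flip: powr_add)
    finally have "of_real u * complex_of_real (u\<^sup>2) powr (w - 1) = of_real u powr 1 * of_real u powr (2 * w - 2)"
      using u by simp
    also have "\<dots> = of_real u powr (2 * w - 1)" by (subst powr_add[symmetric]) simp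
    finally have "2 * (of_real u * complex_of_real (u\<^sup>2) powr (w - 1)) * exp (- (c * of_real u)) = 2 * of_real u powr (2 * w - 1) * exp (- (c * of_real u))"
      by simp
    thus ?thesis using u by (simp add: scaleR_conv_of_real mult_ac)
  qed
  note * = integral_half_line_square_subst[where f = "\<lambda>t. of_real t powr (w - 1) * exp (- (c * of_real (sqrt t)))", OF integrable_mult_right[OF integrable_powr_exp[OF w2 c], of 2] eq]
  show "integrable half_line (\<lambda>t. of_real t powr (w - 1) * exp (- (c * of_real (sqrt t))))"
    by (rule *(1))
  show "integral\<^sup>L half_line (\<lambda>t. of_real t powr (w - 1) * exp (- (c * of_real (sqrt t)))) = 2 * (Gamma (2 * w) * c powr (- (2 * w)))"
  proof -
    have A: "integral\<^sup>L half_line (\<lambda>u. of_real u powr (2 * w - 1) * exp (- (c * of_real u))) = Gamma (2 * w) * c powr (- (2 * w))"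
      by (rule Gamma_integral_half_line[OF w2 c])
    have B: "integral\<^sup>L half_line (\<lambda>u. 2 * (of_real u powr (2 * w - 1) * exp (- (c * of_real u)))) =
        2 * integral\<^sup>L half_line (\<lambda>u. of_real u powr (2 * w - 1) * exp (- (c * of_real u)))"
      by (rule integral_mult_right_zero)
    note *(2)
    also note B
    also note A
    finally show ?thesis .
  qed
qed

text \<open>Splits the damped oscillation into exponentials of rates \<open>1 + \<i>\<close> and
  \<open>1 - \<i>\<close>, both of positive real part, to which the Gamma integral applies.\<close>

lemma damped_sine_eq_exp:
  fixes v :: real
  shows "complex_of_real (sqrt 2 * exp (- v) * sin (pi / 4 - v)) =
    ((1 - \<i>) * exp (- ((1 + \<i>) * of_real v)) + (1 + \<i>) * exp (- ((1 - \<i>) * of_real v))) / 2"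
proof (rule complex_eqI)
  have "sqrt 2 * sin (pi / 4 - v) = cos v - sin v" by (simp add: sin_diff sin_45 cos_45 algebra_simps)
  hence "sqrt 2 * exp (- v) * sin (pi / 4 - v) = exp (- v) * (cos v - sin v)" by (metis mult.assoc mult.commute)
  thus "Re (complex_of_real (sqrt 2 * exp (- v) * sin (pi / 4 - v))) =
     Re (((1 - \<i>) * exp (- ((1 + \<i>) * of_real v)) + (1 + \<i>) * exp (- ((1 - \<i>) * of_real v))) / 2)"
    by (simp add: Re_exp Im_exp algebra_simps)
qed (simp add: Re_exp Im_exp algebra_simps)

text \<open>The rates are \<open>sqrt 2 * c\<close> times eighth roots of unity, so their powers
  \<open>- 2 w\<close> have phases \<open>exp (\<mp> \<i> pi w / 2)\<close>. The coefficients
  \<open>1 - \<i>\<close> and \<open>1 + \<i>\<close> shift these by a further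
  \<open>pi / 4\<close>, giving the cosine at \<open>w + 1 / 2\<close>, as in the functional
  equation at that point.\<close>

lemma damped_sine_moment:
  fixes c :: real
  assumes w: "Re w > 0" and c: "c > 0"
  shows "integral\<^sup>L half_line (\<lambda>t. of_real t powr (w - 1) * of_real (sqrt 2 * exp (- (c * sqrt t)) * sin (pi / 4 - c * sqrt t))) =
     2 * of_real (sqrt 2) * Gamma (2 * w) * of_real (2 * c\<^sup>2) powr (- w) * cos (of_real pi * (w + 1 / 2) / 2)"
    and "integrable half_line (\<lambda>t. of_real t powr (w - 1) * of_real (sqrt 2 * exp (- (c * sqrt t)) * sin (pi / 4 - c * sqrt t)))"
proof -
  define p where "p = (1 + \<i>) * of_real c"
  define q where "q = (1 - \<i>) * of_real c"
  have pq: "Re p > 0" "Re q > 0" using c by (auto simp: p_def q_def)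
  let ?E = "\<lambda>k t. of_real t powr (w - 1) * exp (- (k * of_real (sqrt t)))"
  have eq: "(\<lambda>t. of_real t powr (w - 1) * of_real (sqrt 2 * exp (- (c * sqrt t)) * sin (pi / 4 - c * sqrt t))) =
      (\<lambda>t. ((1 - \<i>) / 2) * ?E p t + ((1 + \<i>) / 2) * ?E q t)"
    unfolding damped_sine_eq_exp p_def q_def by (auto simp: fun_eq_iff field_simps)
  note ints = integrable_mult_right[OF powr_exp_sqrt_integral(1)[OF w pq(1)], of "(1 - \<i>) / 2"]
    integrable_mult_right[OF powr_exp_sqrt_integral(1)[OF w pq(2)], of "(1 + \<i>) / 2"]
  show "integrable half_line (\<lambda>t. of_real t powr (w - 1) * of_real (sqrt 2 * exp (- (c * sqrt t)) * sin (pi / 4 - c * sqrt t)))"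
    unfolding eq by (rule Bochner_Integration.integrable_add[OF ints])
  define r where "r = sqrt 2 * c"
  have r: "r > 0" using c by (simp add: r_def)
  have polar: "1 + \<i> = of_real (sqrt 2) * exp (\<i> * of_real (pi / 4))" "1 - \<i> = of_real (sqrt 2) * exp (- (\<i> * of_real (pi / 4)))"
    by (auto simp: complex_eq_iff Re_exp Im_exp cos_45 sin_45)
  have lnp: "Ln p = of_real (ln r) + \<i> * of_real (pi / 4)"
  proof -
    have p: "p = of_real r * exp (\<i> * of_real (pi / 4))" by (simp add: p_def polar(1) r_def)
    show ?thesis unfolding p using r pi_gt_zero by (subst Ln_times_of_real) (auto simp: Ln_of_real intro!: Ln_exp)
  qed
  have lnq: "Ln q = of_real (ln r) - \<i> * of_real (pi / 4)"
  proof -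
    have q: "q = of_real r * exp (- (\<i> * of_real (pi / 4)))" by (simp add: q_def polar(2) r_def)
    have "- (pi / 4) \<le> pi" using pi_ge_zero by linarith
    hence "Ln (exp (- (\<i> * of_real (pi / 4)))) = - (\<i> * of_real (pi / 4))" by (intro Ln_exp) simp_all
    thus ?thesis unfolding q using r by (subst Ln_times_of_real) (auto simp: Ln_of_real)
  qed
  have pq0: "p \<noteq> 0" "q \<noteq> 0" using pq by auto
  have R: "exp (- (2 * w) * of_real (ln r)) = of_real (2 * c\<^sup>2) powr (- w)"
  proof -
    have "2 * c\<^sup>2 = r\<^sup>2" by (simp add: r_def power_mult_distrib)
    moreover have "r\<^sup>2 > 0" using r by simp
    hence "complex_of_real (r\<^sup>2) powr (- w) = exp (- w * of_real (ln (r\<^sup>2)))"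
      unfolding powr_def using r by (simp add: Ln_of_real del: of_real_power)
    moreover have "ln (r\<^sup>2) = 2 * ln r" using r by (simp add: ln_realpow)
    ultimately show ?thesis by (simp add: mult_ac)
  qed
  have pp: "p powr (- (2 * w)) = of_real (2 * c\<^sup>2) powr (- w) * exp (- (\<i> * of_real pi * w / 2))"
    unfolding R[symmetric] unfolding powr_def lnp using pq0 by (simp add: mult_exp_exp algebra_simps)
  have qp: "q powr (- (2 * w)) = of_real (2 * c\<^sup>2) powr (- w) * exp (\<i> * of_real pi * w / 2)"
    unfolding R[symmetric] unfolding powr_def lnq using pq0 by (simp add: mult_exp_exp algebra_simps)
  define Q where "Q = complex_of_real (2 * c\<^sup>2) powr (- w)"
  have "integral\<^sup>L half_line (\<lambda>t. ((1 - \<i>) / 2) * ?E p t + ((1 + \<i>) / 2) * ?E q t) =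
      (1 - \<i>) / 2 * (2 * (Gamma (2 * w) * p powr (- (2 * w)))) + (1 + \<i>) / 2 * (2 * (Gamma (2 * w) * q powr (- (2 * w))))"
    unfolding Bochner_Integration.integral_add[OF ints] integral_mult_right_zero
      powr_exp_sqrt_integral(2)[OF w pq(1)] powr_exp_sqrt_integral(2)[OF w pq(2)] ..
  also have "\<dots> = Gamma (2 * w) * Q * ((1 - \<i>) * exp (- (\<i> * of_real pi * w / 2)) + (1 + \<i>) * exp (\<i> * of_real pi * w / 2))"
    unfolding pp qp Q_def[symmetric] by (simp add: field_simps)
  also have "(1 - \<i>) * exp (- (\<i> * of_real pi * w / 2)) + (1 + \<i>) * exp (\<i> * of_real pi * w / 2) =
      of_real (sqrt 2) * (exp (- (\<i> * (of_real pi * (w + 1 / 2) / 2))) + exp (\<i> * (of_real pi * (w + 1 / 2) / 2)))"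
    unfolding polar by (simp add: mult.assoc mult_exp_exp distrib_left) (simp add: algebra_simps add_divide_distrib)
  also have "exp (- (\<i> * (of_real pi * (w + 1 / 2) / 2))) + exp (\<i> * (of_real pi * (w + 1 / 2) / 2)) = 2 * cos (of_real pi * (w + 1 / 2) / 2)"
    by (simp add: cos_exp_eq)
  finally show "integral\<^sup>L half_line (\<lambda>t. of_real t powr (w - 1) * of_real (sqrt 2 * exp (- (c * sqrt t)) * sin (pi / 4 - c * sqrt t))) =
     2 * of_real (sqrt 2) * Gamma (2 * w) * of_real (2 * c\<^sup>2) powr (- w) * cos (of_real pi * (w + 1 / 2) / 2)"
    unfolding eq Q_def by (simp add: mult_ac)
qed

lemma norm_powr_exp_sqrt_integral:
  fixes c :: real
  assumes w: "Re w > 0" and c: "c > 0"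
  shows "integral\<^sup>L half_line (\<lambda>t. norm (of_real t powr (w - 1) * exp (- (of_real c * of_real (sqrt t))))) =
     2 * Gamma (2 * Re w) * c powr (- (2 * Re w))"
proof -
  have "complex_of_real (integral\<^sup>L half_line (\<lambda>t. norm (of_real t powr (w - 1) * exp (- (of_real c * of_real (sqrt t)))))) =
      integral\<^sup>L half_line (\<lambda>t. complex_of_real (norm (of_real t powr (w - 1) * exp (- (of_real c * of_real (sqrt t))))))"
    by (rule integral_complex_of_real[symmetric])
  also have "\<dots> = integral\<^sup>L half_line (\<lambda>t. of_real t powr (of_real (Re w) - 1) * exp (- (of_real c * of_real (sqrt t))))"
  proof (rule Bochner_Integration.integral_cong[OF refl])
    fix t assume "t \<in> space half_line"
    hence t: "t > 0" by simp
    have "norm (of_real t powr (w - 1) * exp (- (of_real c * of_real (sqrt t)))) = t powr (Re w - 1) * exp (- (c * sqrt t))"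
      using t by (simp add: norm_mult norm_powr_real_powr)
    moreover have "complex_of_real (t powr (Re w - 1)) = of_real t powr (of_real (Re w) - 1)"
      using t powr_of_real[of t "Re w - 1"] by simp
    moreover have "complex_of_real (exp (- (c * sqrt t))) = exp (- (of_real c * of_real (sqrt t)))" by (simp flip: exp_of_real)
    ultimately show "complex_of_real (norm (of_real t powr (w - 1) * exp (- (of_real c * of_real (sqrt t))))) =
       of_real t powr (of_real (Re w) - 1) * exp (- (of_real c * of_real (sqrt t)))"
      by (simp only: of_real_mult)
  qed
  also have "\<dots> = 2 * (Gamma (2 * of_real (Re w)) * of_real c powr (- (2 * of_real (Re w))))"
    using w c by (intro powr_exp_sqrt_integral(2)) auto
  also have "of_real c powr (- (2 * of_real (Re w))) = complex_of_real (c powr (- (2 * Re w)))"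
    using c powr_of_real[of c "- (2 * Re w)"] by simp
  also have "Gamma (2 * of_real (Re w)) = complex_of_real (Gamma (2 * Re w))"
    using Gamma_complex_of_real[of "2 * Re w"] by simp
  also have "2 * (complex_of_real (Gamma (2 * Re w)) * complex_of_real (c powr (- (2 * Re w)))) = complex_of_real (2 * Gamma (2 * Re w) * c powr (- (2 * Re w)))"
    by simp
  finally show ?thesis by (simp only: of_real_eq_iff)
qed

lemma summable_damped_exp:
  assumes "a > 0"
  shows "summable (\<lambda>m. sqrt 2 / sqrt (real (Suc m)) * exp (- 2 * sqrt (pi * a * real (Suc m))))"
proof (rule abs_damped_sine_series_le[OF order_refl])
  fix C assume "\<And>a. a > 0 \<Longrightarrow> summable (\<lambda>m. sqrt 2 / sqrt (real (Suc m)) * exp (- 2 * sqrt (pi * a * real (Suc m))))"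
  thus ?thesis using assms .
qed

text \<open>Integrated term by term, the m-th summand contributes a multiple of
  \<open>Suc m powr (- (w + 1 / 2))\<close>. Hence \<open>Re w > 1 / 2\<close> is the condition both
  for the interchange and for the Dirichlet series of zeta at \<open>w + 1 / 2\<close>, which the
  functional equation reflects to \<open>1 / 2 - w\<close>.\<close>

theorem damped_sine_series_mellin:
  fixes X :: real
  assumes w: "Re w > 1 / 2" and X: "X > 0"
  shows "integrable half_line (\<lambda>t. of_real t powr (w - 1) * of_real (damped_sine_series (t * X)))"
    and "integral\<^sup>L half_line (\<lambda>t. of_real t powr (w - 1) * of_real (damped_sine_series (t * X))) =
      Gamma w * of_real X powr (- w) * riemann_zeta (1 / 2 - w)"
proof -
  define c where "c = (\<lambda>m. 2 * sqrt (pi * X * real (Suc m)))"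
  have c: "c m > 0" for m using X by (simp add: c_def)
  have w0: "Re w > 0" using w by simp
  define f where "f = (\<lambda>m t. of_real (1 / sqrt (real (Suc m))) * (of_real t powr (w - 1) * of_real (sqrt 2 * exp (- (c m * sqrt t)) * sin (pi / 4 - c m * sqrt t))))"
  have fint: "integrable half_line (f m)" for m
    unfolding f_def by (intro integrable_mult_right damped_sine_moment(2) w0 c)
  have fbound': "norm (f m t) \<le> sqrt 2 / sqrt (real (Suc m)) * (norm (complex_of_real t powr (w - 1)) * exp (- (c m * sqrt t)))" for m t
  proof -
    have "norm (f m t) = sqrt 2 / sqrt (real (Suc m)) * (norm (complex_of_real t powr (w - 1)) * exp (- (c m * sqrt t))) * \<bar>sin (pi / 4 - c m * sqrt t)\<bar>"
      by (simp add: f_def norm_mult norm_divide abs_mult del: of_nat_Suc)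
    also have "\<dots> \<le> sqrt 2 / sqrt (real (Suc m)) * (norm (complex_of_real t powr (w - 1)) * exp (- (c m * sqrt t))) * 1"
      by (intro mult_left_mono abs_sin_le_one) auto
    finally show ?thesis by simp
  qed
  have fbound: "norm (f m t) \<le> sqrt 2 / sqrt (real (Suc m)) * norm (of_real t powr (w - 1) * exp (- (of_real (c m) * of_real (sqrt t))))" for m t
    using fbound'[of m t] by (simp add: norm_mult)
  have gint: "integrable half_line (\<lambda>t. sqrt 2 / sqrt (real (Suc m)) * norm (of_real t powr (w - 1) * exp (- (of_real (c m) * of_real (sqrt t)))))" for m
    using w0 c[of m] by (intro integrable_mult_right integrable_norm powr_exp_sqrt_integral(1)) auto
  have cpow: "c m powr (- (2 * Re w)) = (4 * pi * X) powr (- Re w) * real (Suc m) powr (- Re w)" for m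
  proof -
    have "c m powr (- (2 * Re w)) = (c m powr 2) powr (- Re w)" by (simp add: powr_powr)
    also have "c m powr 2 = (c m)\<^sup>2" using c[of m] by simp
    also have "\<dots> = (4 * pi * X) * real (Suc m)" using X by (simp add: c_def power_mult_distrib)
    finally show ?thesis using X by (simp only: powr_mult)
  qed
  have bsum: "summable (\<lambda>m. \<integral>t. norm (f m t) \<partial>half_line)"
  proof (rule summable_comparison_test'[where N = 0])
    let ?K = "2 * sqrt 2 * Gamma (2 * Re w) * (4 * pi * X) powr (- Re w)"
    show "summable (\<lambda>m. ?K * real (Suc m) powr - (Re w + 1 / 2))"
      using w by (intro summable_mult powr_nat_summable) auto
    fix m :: nat
    have "(\<integral>t. norm (f m t) \<partial>half_line) \<le> (\<integral>t. sqrt 2 / sqrt (real (Suc m)) * norm (of_real t powr (w - 1) * exp (- (of_real (c m) * of_real (sqrt t)))) \<partial>half_line)"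
      by (intro integral_mono integrable_norm fint gint fbound)
    also have "\<dots> = sqrt 2 / sqrt (real (Suc m)) * (2 * Gamma (2 * Re w) * c m powr (- (2 * Re w)))"
      by (simp add: norm_powr_exp_sqrt_integral[OF w0 c] del: of_nat_Suc)
    also have "\<dots> = ?K * (real (Suc m) powr (- Re w) * real (Suc m) powr (- (1 / 2)))"
      unfolding cpow by (simp add: powr_minus_divide powr_half_sqrt mult_ac del: of_nat_Suc)
    also have "real (Suc m) powr (- Re w) * real (Suc m) powr (- (1 / 2)) = real (Suc m) powr - (Re w + 1 / 2)"
      by (simp flip: powr_add)
    finally show "norm (\<integral>t. norm (f m t) \<partial>half_line) \<le> ?K * real (Suc m) powr - (Re w + 1 / 2)"
      by (simp add: integral_nonneg_AE)
  qed
  have pt: "(\<lambda>m. f m t) sums (of_real t powr (w - 1) * of_real (damped_sine_series (t * X)))" "summable (\<lambda>m. norm (f m t))" if t: "t > 0" for t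
  proof -
    have ce: "2 * sqrt (pi * (t * X) * real (Suc m)) = c m * sqrt t" for m
      using t X by (simp add: c_def real_sqrt_mult mult_ac)
    have tX: "t * X > 0" using t X by simp
    have s: "summable (\<lambda>m. sqrt 2 / sqrt (real (Suc m)) * exp (- (c m * sqrt t)))"
      using summable_damped_exp[OF tX] by (simp only: mult_minus_left ce)
    show "summable (\<lambda>m. norm (f m t))"
    proof (rule summable_comparison_test'[where N = 0, OF summable_mult2[OF s, of "norm (complex_of_real t powr (w - 1))"]])
      show "norm (norm (f m t)) \<le> sqrt 2 / sqrt (real (Suc m)) * exp (- (c m * sqrt t)) * norm (complex_of_real t powr (w - 1))" for m
        unfolding real_norm_def abs_norm_cancel using fbound'[of m t] by (simp only: mult_ac)
    qed
    have s': "summable (\<lambda>m. sqrt 2 / sqrt (real (Suc m)) * exp (- (c m * sqrt t)) * sin (pi / 4 - c m * sqrt t))"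
    proof (rule summable_comparison_test'[where N = 0, OF s])
      show "norm (sqrt 2 / sqrt (real (Suc m)) * exp (- (c m * sqrt t)) * sin (pi / 4 - c m * sqrt t)) \<le> sqrt 2 / sqrt (real (Suc m)) * exp (- (c m * sqrt t))" for m
        unfolding norm_mult[of _ "sin _"]
        by (rule order_trans[OF mult_left_mono[where b = 1]]) auto
    qed
    have "damped_sine_series (t * X) = (\<Sum>m. sqrt 2 / sqrt (real (Suc m)) * exp (- (c m * sqrt t)) * sin (pi / 4 - c m * sqrt t))"
      unfolding damped_sine_series_def by (simp only: mult_minus_left ce)
    hence "(\<lambda>m. sqrt 2 / sqrt (real (Suc m)) * exp (- (c m * sqrt t)) * sin (pi / 4 - c m * sqrt t)) sums damped_sine_series (t * X)"
      using s' by (simp add: sums_iff)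
    from sums_mult[OF sums_of_real[OF this], of "of_real t powr (w - 1)"]
    show "(\<lambda>m. f m t) sums (of_real t powr (w - 1) * of_real (damped_sine_series (t * X)))"
      by (simp add: f_def mult_ac)
  qed
  have AE: "AE t in half_line. summable (\<lambda>m. norm (f m t))" using pt(2) by (intro AE_I2) auto
  have cong: "(\<Sum>m. f m t) = of_real t powr (w - 1) * of_real (damped_sine_series (t * X))" if "t \<in> space half_line" for t
    using pt(1)[of t] that by (simp add: sums_iff)
  show "integrable half_line (\<lambda>t. of_real t powr (w - 1) * of_real (damped_sine_series (t * X)))"
  proof -
    have "integrable half_line (\<lambda>t. \<Sum>m. f m t) \<longleftrightarrow>
        integrable half_line (\<lambda>t. of_real t powr (w - 1) * of_real (damped_sine_series (t * X)))"
      by (rule Bochner_Integration.integrable_cong[OF refl]) (rule cong)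
    thus ?thesis using integrable_suminf[OF fint AE bsum] by blast
  qed
  define w' where "w' = w + 1 / 2"
  have w': "Re w' > 1" using w by (simp add: w'_def)
  define K where "K = 2 * of_real (sqrt 2) * Gamma (2 * w) * of_real (8 * pi * X) powr (- w) * cos (of_real pi * w' / 2)"
  have Im: "integral\<^sup>L half_line (f m) = K * of_nat (Suc m) powr (- w')" for m
  proof -
    have "integral\<^sup>L half_line (f m) = of_real (1 / sqrt (real (Suc m))) *
        (2 * of_real (sqrt 2) * Gamma (2 * w) * of_real (2 * (c m)\<^sup>2) powr (- w) * cos (of_real pi * w' / 2))"
      unfolding f_def integral_mult_right_zero damped_sine_moment(1)[OF w0 c] w'_def ..
    also have "complex_of_real (2 * (c m)\<^sup>2) powr (- w) = of_real (8 * pi * X) powr (- w) * of_nat (Suc m) powr (- w)"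
    proof -
      have "2 * (c m)\<^sup>2 = 8 * pi * X * real (Suc m)" using X by (simp add: c_def power_mult_distrib)
      hence "complex_of_real (2 * (c m)\<^sup>2) = of_real (8 * pi * X) * of_nat (Suc m)" by (simp only: of_real_mult of_real_of_nat_eq)
      thus ?thesis using X by (simp only:) (rule powr_times_real_left; simp)
    qed
    also have "complex_of_real (1 / sqrt (real (Suc m))) = of_nat (Suc m) powr (- (1 / 2))"
    proof -
      have "1 / sqrt (real (Suc m)) = real (Suc m) powr (- (1 / 2))" by (simp add: powr_minus_divide powr_half_sqrt)
      thus ?thesis using powr_of_real[of "real (Suc m)" "- (1 / 2)"] by simp
    qed
    also have "of_nat (Suc m) powr (- (1 / 2)) * (2 * of_real (sqrt 2) * Gamma (2 * w) * (of_real (8 * pi * X) powr (- w) * of_nat (Suc m) powr (- w)) * cos (of_real pi * w' / 2))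
        = K * (of_nat (Suc m) powr (- (1 / 2)) * of_nat (Suc m) powr (- w))"
      by (simp add: K_def)
    also have "of_nat (Suc m) powr (- (1 / 2)) * of_nat (Suc m) powr (- w) = (of_nat (Suc m) powr (- w') :: complex)"
    proof -
      have e: "- w' = - (1 / 2) + - w" by (simp add: w'_def)
      show ?thesis unfolding e by (rule powr_add[symmetric])
    qed
    finally show ?thesis .
  qed
  have "integral\<^sup>L half_line (\<lambda>t. of_real t powr (w - 1) * of_real (damped_sine_series (t * X))) = integral\<^sup>L half_line (\<lambda>t. \<Sum>m. f m t)"
    by (intro Bochner_Integration.integral_cong refl cong[symmetric])
  also have "\<dots> = (\<Sum>m. K * of_nat (Suc m) powr (- w'))"
    unfolding integral_suminf[OF fint AE bsum] Im ..
  also have "\<dots> = K * riemann_zeta w'"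
    using sums_mult[OF riemann_zeta_sums[OF w'], of K] by (simp add: sums_iff)
  also have "\<dots> = Gamma w * of_real X powr (- w) * (2 * of_real (2 * pi) powr (- w') * Gamma w' * cos (of_real pi * w' / 2) * riemann_zeta w')"
  proof -
    \<comment> \<open>Duplication trades \<open>Gamma (2 * w)\<close> for
      \<open>Gamma w * Gamma w'\<close>; the second factor is absorbed by the functional equation at
      \<open>w'\<close>, the first remains in the result.\<close>
    have dup: "Gamma w * Gamma w' = exp ((1 - 2 * w) * of_real (ln 2)) * of_real (sqrt pi) * Gamma (2 * w)"
      unfolding w'_def using w by (intro Gamma_legendre_duplication not_nonpos_Int_half_plane) auto
    have pr: "complex_of_real r powr a = exp (a * of_real (ln r))" if "r > 0" for r a
      using that by (simp add: powr_def Ln_of_real)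
    have sq: "complex_of_real (sqrt r) = exp (of_real (ln r) / 2)" if "r > 0" for r
    proof -
      have "sqrt r = exp (ln r / 2)" using that by (simp add: ln_sqrt[symmetric])
      thus ?thesis by (simp add: exp_of_real[symmetric])
    qed
    have l8: "ln (8 * pi * X) = 3 * ln 2 + ln pi + ln X"
    proof -
      have "ln (8::real) = 3 * ln 2" using ln_realpow[of 2 3] by simp
      thus ?thesis using X by (simp add: ln_mult)
    qed
    have l2: "ln (2 * pi) = ln 2 + ln pi" by (simp add: ln_mult)
    have "2 * complex_of_real (sqrt 2) * of_real (8 * pi * X) powr (- w) =
        2 * exp ((1 - 2 * w) * of_real (ln 2)) * of_real (sqrt pi) * of_real X powr (- w) * of_real (2 * pi) powr (- w')"
      using X unfolding w'_def by (simp add: pr sq l8 l2 mult_exp_exp del: of_real_mult) (simp add: algebra_simps)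
    hence "K = 2 * exp ((1 - 2 * w) * of_real (ln 2)) * of_real (sqrt pi) * of_real X powr (- w) * of_real (2 * pi) powr (- w') * Gamma (2 * w) * cos (of_real pi * w' / 2)"
      unfolding K_def by (simp add: mult_ac)
    also have "\<dots> = of_real X powr (- w) * 2 * of_real (2 * pi) powr (- w') * (exp ((1 - 2 * w) * of_real (ln 2)) * of_real (sqrt pi) * Gamma (2 * w)) * cos (of_real pi * w' / 2)"
      by (simp only: mult_ac)
    finally show ?thesis unfolding dup[symmetric] by (simp only: mult_ac)
  qed
  also have "2 * of_real (2 * pi) powr (- w') * Gamma w' * cos (of_real pi * w' / 2) * riemann_zeta w' = riemann_zeta (1 - w')"
    by (rule riemann_zeta_functional_equation[OF w', symmetric])
  also have "1 - w' = 1 / 2 - w" by (simp add: w'_def)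
  finally show "integral\<^sup>L half_line (\<lambda>t. of_real t powr (w - 1) * of_real (damped_sine_series (t * X))) =
      Gamma w * of_real X powr (- w) * riemann_zeta (1 / 2 - w)" .
qed

section \<open>Summing the damped sine series\<close>

definition damped_term :: "nat \<Rightarrow> real \<Rightarrow> complex" where
  "damped_term d a = of_real (real (Suc d) powr (- 1 / 2) * (exp (- a / real (Suc d)) - 1))"

lemma norm_damped_term_le: "a \<ge> 0 \<Longrightarrow> norm (damped_term d a) \<le> a * real (Suc d) powr (- (3 / 2))"
  unfolding damped_term_def norm_of_real by (rule abs_damped_term_le)

lemma damped_sine_series_eq:
  assumes "a > 0"
  shows "of_real (damped_sine_series a) = (\<Sum>d. damped_term d a) + of_real (2 * sqrt (pi * a)) + riemann_zeta (1 / 2)"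
    and "summable (\<lambda>d. damped_term d a)"
  using damped_sine_series_sums[OF assms] unfolding damped_term_def by (auto simp: sums_iff)

text \<open>Times the damping factor, a term of S is a difference of two pure exponentials, of rates
  \<open>e + X / Suc d\<close> and \<open>e\<close>. Summation and integration against a power then
  give \<open>exp_series\<close> values and Gamma integrals at these two rates.\<close>

lemma exp_mult_damped_term:
  fixes e t X :: real
  shows "exp (- (of_real e * of_real t)) * damped_term d (t * X) =
    of_real (real (Suc d) powr (- 1 / 2)) * (exp (- (of_real (e + X / real (Suc d)) * of_real t)) - exp (- (of_real e * of_real t)))"
proof -
  have "exp (- (of_real (e + X / real (Suc d)) * complex_of_real t)) = exp (- (of_real e * of_real t)) * of_real (exp (- (t * X) / real (Suc d)))"
    unfolding exp_of_real[symmetric] mult_exp_exp by (rule arg_cong[where f = exp]) (simp add: algebra_simps)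
  thus ?thesis by (simp add: damped_term_def algebra_simps)
qed

section \<open>Abel summation over k\<close>

context
  fixes w :: complex and X :: real
  assumes w: "Re w > 1 / 2" and X: "X > 0"
begin

private definition u where "u d = complex_of_real (real (Suc d) powr (- 1 / 2))"

private lemma w0: "Re w > 0" "Re (w + 1 / 2) > 0" using w by auto

text \<open>The damping allows the three parts of S to be summed separately. The sums over
  \<open>k\<close> and \<open>d\<close> are exchanged by a product majorant: a term of S is at most
  \<open>Suc k * X * Suc d powr (- 3 / 2)\<close>, whose factor \<open>Suc k\<close> raises the
  exponent by one. The part \<open>2 sqrt (pi a)\<close> raises it by 1/2.\<close>

lemma abel_sum_damped_sine_series:
  assumes e: "e > 0"
  shows "(\<Sum>k. of_nat (Suc k) powr (w - 1) * exp (- (of_nat (Suc k) * of_real e)) * of_real (damped_sine_series (real (Suc k) * X))) =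
     (\<Sum>d. u d * (exp_series w (of_real (e + X / real (Suc d))) - exp_series w (of_real e)))
      + of_real (2 * sqrt (pi * X)) * exp_series (w + 1 / 2) (of_real e) + riemann_zeta (1 / 2) * exp_series w (of_real e)"
    (is ?sum)
    and "summable (\<lambda>d. u d * (exp_series w (of_real (e + X / real (Suc d))) - exp_series w (of_real e)))" (is ?summable)
proof -
  define c where "c = (\<lambda>k. of_nat (Suc k) powr (w - 1) * exp (- (of_nat (Suc k) * complex_of_real e)))"
  define f where "f = (\<lambda>k d. c k * damped_term d (real (Suc k) * X))"
  have e': "Re (of_real e) > 0" using e by simp
  have cs: "summable c" unfolding c_def by (rule summable_norm_cancel[OF summable_exp_series[OF e']])
  have csum: "(\<Sum>k. c k) = exp_series w (of_real e)" by (simp add: c_def exp_series_def)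
  have bound: "norm (f k d) \<le> (X * (real (Suc k) powr (Re w + 1 - 1) * exp (- (e * real (Suc k))))) * real (Suc d) powr (- (3 / 2))" for k d
  proof -
    have "norm (f k d) \<le> norm (c k) * (real (Suc k) * X * real (Suc d) powr (- (3 / 2)))"
      unfolding f_def norm_mult using X by (intro mult_left_mono norm_damped_term_le) auto
    also have "norm (c k) = real (Suc k) powr (Re w - 1) * exp (- (e * real (Suc k)))"
      by (simp add: c_def norm_mult norm_powr_real_powr mult_ac del: of_nat_Suc)
    also have "\<dots> * (real (Suc k) * X * real (Suc d) powr (- (3 / 2))) =
        (X * ((real (Suc k) powr (Re w - 1) * real (Suc k) powr 1) * exp (- (e * real (Suc k))))) * real (Suc d) powr (- (3 / 2))"
      by (simp add: mult_ac)
    also have "real (Suc k) powr (Re w - 1) * real (Suc k) powr 1 = real (Suc k) powr (Re w + 1 - 1)"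
      by (subst powr_add[symmetric]) simp
    finally show ?thesis .
  qed
  have sA: "summable (\<lambda>k. X * (real (Suc k) powr (Re w + 1 - 1) * exp (- (e * real (Suc k)))))"
    by (intro summable_mult summable_powr_exp_real e)
  have sB: "summable (\<lambda>d. real (Suc d) powr (- (3 / 2)))" by (rule powr_nat_summable) simp
  note swap = suminf_swap_dominated[of f, OF bound sA sB]
  have inner: "(\<Sum>k. f k d) = u d * (exp_series w (of_real (e + X / real (Suc d))) - exp_series w (of_real e))" for d
  proof -
    define r where "r = e + X / real (Suc d)"
    have r: "Re (of_real r) > 0" using e X by (simp add: r_def add_pos_nonneg)
    have "f k d = u d * (of_nat (Suc k) powr (w - 1) * exp (- (of_nat (Suc k) * complex_of_real r)) - c k)" for k
    proof -
      have comm: "exp (- (of_nat (Suc k) * complex_of_real y)) = exp (- (complex_of_real y * of_real (real (Suc k))))" for y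
        by (simp add: mult.commute)
      have "f k d = of_nat (Suc k) powr (w - 1) * (exp (- (complex_of_real e * of_real (real (Suc k)))) * damped_term d (real (Suc k) * X))"
        by (simp only: f_def c_def comm mult.assoc)
      also have "\<dots> = of_nat (Suc k) powr (w - 1) * (u d * (exp (- (of_nat (Suc k) * complex_of_real r)) - exp (- (of_nat (Suc k) * complex_of_real e))))"
        unfolding exp_mult_damped_term comm u_def r_def ..
      also have "\<dots> = u d * (of_nat (Suc k) powr (w - 1) * exp (- (of_nat (Suc k) * complex_of_real r)) - c k)"
        unfolding c_def by (simp only: right_diff_distrib mult.left_commute)
      finally show ?thesis .
    qed
    hence "(\<Sum>k. f k d) = (\<Sum>k. u d * (of_nat (Suc k) powr (w - 1) * exp (- (of_nat (Suc k) * complex_of_real r)) - c k))"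
      by (simp only:)
    also have "\<dots> = u d * (exp_series w (of_real r) - exp_series w (of_real e))"
      unfolding csum[symmetric] exp_series_def[of w "of_real r"]
      by (intro sums_unique[symmetric] sums_mult sums_diff summable_sums cs summable_norm_cancel[OF summable_exp_series[OF r]])
    finally show ?thesis by (simp only: r_def)
  qed
  show ?summable using swap(3) unfolding inner .
  have sqrt_term: "c k * of_real (2 * sqrt (pi * (real (Suc k) * X))) =
      of_real (2 * sqrt (pi * X)) * (of_nat (Suc k) powr (w + 1 / 2 - 1) * exp (- (of_nat (Suc k) * complex_of_real e)))" for k
  proof -
    have "complex_of_real (sqrt (real (Suc k))) = of_nat (Suc k) powr (1 / 2)"
      using powr_of_real[of "real (Suc k)" "1 / 2"] by (simp add: powr_half_sqrt)
    hence "of_nat (Suc k) powr (w - 1) * complex_of_real (sqrt (real (Suc k))) = of_nat (Suc k) powr (w - 1 + 1 / 2)"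
      by (simp only: powr_add)
    also have "w - 1 + 1 / 2 = w + 1 / 2 - 1" by simp
    finally have "of_nat (Suc k) powr (w - 1) * complex_of_real (sqrt (real (Suc k))) = of_nat (Suc k) powr (w + 1 / 2 - 1)" .
    moreover have "2 * sqrt (pi * (real (Suc k) * X)) = sqrt (real (Suc k)) * (2 * sqrt (pi * X))"
      by (simp add: real_sqrt_mult mult_ac del: of_nat_Suc)
    hence "c k * of_real (2 * sqrt (pi * (real (Suc k) * X))) =
       of_real (2 * sqrt (pi * X)) * ((of_nat (Suc k) powr (w - 1) * complex_of_real (sqrt (real (Suc k)))) * exp (- (of_nat (Suc k) * complex_of_real e)))"
      unfolding c_def by (simp only: of_real_mult mult_ac)
    ultimately show ?thesis by (simp only:)
  qed
  have "c k * of_real (damped_sine_series (real (Suc k) * X)) =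
      (\<Sum>d. f k d) + of_real (2 * sqrt (pi * X)) * (of_nat (Suc k) powr (w + 1 / 2 - 1) * exp (- (of_nat (Suc k) * complex_of_real e)))
      + riemann_zeta (1 / 2) * c k" for k
  proof -
    have a: "real (Suc k) * X > 0" using X by simp
    have "(\<Sum>d. f k d) = c k * (\<Sum>d. damped_term d (real (Suc k) * X))"
      unfolding f_def by (rule suminf_mult[OF damped_sine_series_eq(2)[OF a]])
    thus ?thesis unfolding damped_sine_series_eq(1)[OF a] sqrt_term[symmetric]
      by (simp add: distrib_left mult.commute)
  qed
  hence "(\<Sum>k. c k * of_real (damped_sine_series (real (Suc k) * X))) =
      (\<Sum>k. (\<Sum>d. f k d) + of_real (2 * sqrt (pi * X)) * (of_nat (Suc k) powr (w + 1 / 2 - 1) * exp (- (of_nat (Suc k) * complex_of_real e)))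
      + riemann_zeta (1 / 2) * c k)"
    by (simp only:)
  also have "\<dots> = (\<Sum>k. \<Sum>d. f k d) + of_real (2 * sqrt (pi * X)) * exp_series (w + 1 / 2) (of_real e) + riemann_zeta (1 / 2) * (\<Sum>k. c k)"
    unfolding exp_series_def
    by (intro sums_unique[symmetric] sums_add sums_mult summable_sums swap(1) cs summable_norm_cancel[OF summable_exp_series[OF e']])
  finally show ?sum unfolding swap(2) inner csum unfolding c_def .
qed

text \<open>Term for term the counterpart of the preceding sum: each \<open>exp_series\<close> is
  replaced by its pole part.\<close>

lemma abel_integral_damped_sine_series:
  assumes e: "e > 0"
  shows "integral\<^sup>L half_line (\<lambda>t. of_real t powr (w - 1) * exp (- (of_real e * of_real t)) * of_real (damped_sine_series (t * X))) =
     (\<Sum>d. u d * (Gamma w * of_real (e + X / real (Suc d)) powr (- w) - Gamma w * of_real e powr (- w)))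
      + of_real (2 * sqrt (pi * X)) * (Gamma (w + 1 / 2) * of_real e powr (- (w + 1 / 2))) + riemann_zeta (1 / 2) * (Gamma w * of_real e powr (- w))"
    (is ?int)
    and "summable (\<lambda>d. u d * (Gamma w * of_real (e + X / real (Suc d)) powr (- w) - Gamma w * of_real e powr (- w)))" (is ?summable)
proof -
  define c where "c = (\<lambda>t. of_real t powr (w - 1) * exp (- (complex_of_real e * of_real t)))"
  define f where "f = (\<lambda>d t. c t * damped_term d (t * X))"
  have e': "Re (of_real e) > 0" using e by simp
  have r': "Re (of_real (e + X / real (Suc d))) > 0" for d using e X by (simp add: add_pos_nonneg)
  have cint: "integrable half_line c" unfolding c_def by (rule integrable_powr_exp[OF w0(1) e'])
  have feq: "f d = (\<lambda>t. u d * (of_real t powr (w - 1) * exp (- (of_real (e + X / real (Suc d)) * of_real t)) - c t))" for d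
  proof
    fix t
    have "f d t = of_real t powr (w - 1) * (exp (- (complex_of_real e * of_real t)) * damped_term d (t * X))"
      by (simp add: f_def c_def)
    thus "f d t = u d * (of_real t powr (w - 1) * exp (- (of_real (e + X / real (Suc d)) * of_real t)) - c t)"
      unfolding exp_mult_damped_term c_def u_def by (simp only: right_diff_distrib mult_ac)
  qed
  have fint: "integrable half_line (f d)" for d
    unfolding feq by (intro integrable_mult_right Bochner_Integration.integrable_diff cint integrable_powr_exp[OF w0(1) r'])
  have fval: "integral\<^sup>L half_line (f d) = u d * (Gamma w * of_real (e + X / real (Suc d)) powr (- w) - Gamma w * of_real e powr (- w))" for d
  proof -
    have "integral\<^sup>L half_line (f d) = u d * (integral\<^sup>L half_line (\<lambda>t. of_real t powr (w - 1) * exp (- (of_real (e + X / real (Suc d)) * of_real t))) - integral\<^sup>L half_line c)"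
      unfolding feq integral_mult_right_zero
      by (subst Bochner_Integration.integral_diff[OF integrable_powr_exp[OF w0(1) r'] cint]) simp
    thus ?thesis unfolding Gamma_integral_half_line[OF w0(1) r'] c_def Gamma_integral_half_line[OF w0(1) e'] .
  qed
  \<comment> \<open>The exponent for \<open>w + 1\<close> accommodates the factor \<open>t\<close>
    in the bound on \<open>damped_term\<close>.\<close>
  define g where "g = (\<lambda>t. norm (of_real t powr (w + 1 - 1) * exp (- (complex_of_real e * of_real t))))"
  have w1: "Re (w + 1) > 0" using w by simp
  have gint: "integrable half_line g" unfolding g_def by (intro integrable_norm integrable_powr_exp w1 e')
  have fbound: "norm (f d t) \<le> X * real (Suc d) powr (- (3 / 2)) * g t" if t: "t > 0" for d t
  proof -
    have "norm (f d t) \<le> norm (c t) * (t * X * real (Suc d) powr (- (3 / 2)))"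
      unfolding f_def norm_mult using X t by (intro mult_left_mono norm_damped_term_le) auto
    also have "\<dots> = X * real (Suc d) powr (- (3 / 2)) * (norm (complex_of_real t) * norm (c t))" using t by simp
    also have "norm (complex_of_real t) * norm (c t) = g t"
      using t by (simp add: g_def c_def norm_mult[symmetric] powr_diff mult.assoc[symmetric] del: of_real_mult norm_of_real)
    finally show ?thesis .
  qed
  have sB: "summable (\<lambda>d. real (Suc d) powr (- (3 / 2)))" by (rule powr_nat_summable) simp
  have AE: "AE t in half_line. summable (\<lambda>d. norm (f d t))"
  proof (rule AE_I2)
    fix t assume "t \<in> space half_line"
    hence t: "t > 0" by simp
    show "summable (\<lambda>d. norm (f d t))"
    proof (rule summable_comparison_test'[where N = 0, OF summable_mult2[OF summable_mult[OF sB, of X], of "g t"]])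
      show "norm (norm (f d t)) \<le> X * real (Suc d) powr (- (3 / 2)) * g t" for d
        unfolding real_norm_def abs_norm_cancel by (rule fbound[OF t])
    qed
  qed
  have bsum: "summable (\<lambda>d. \<integral>t. norm (f d t) \<partial>half_line)"
  proof (rule summable_comparison_test'[where N = 0, OF summable_mult2[OF summable_mult[OF sB, of X], of "integral\<^sup>L half_line g"]])
    fix d
    have "(\<integral>t. norm (f d t) \<partial>half_line) \<le> (\<integral>t. X * real (Suc d) powr (- (3 / 2)) * g t \<partial>half_line)"
      by (intro integral_mono_AE integrable_norm fint integrable_mult_right gint AE_I2) (use fbound in auto)
    also have "\<dots> = X * real (Suc d) powr (- (3 / 2)) * integral\<^sup>L half_line g" by (rule integral_mult_right_zero)
    finally show "norm (\<integral>t. norm (f d t) \<partial>half_line) \<le> X * real (Suc d) powr (- (3 / 2)) * integral\<^sup>L half_line g"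
      by (simp add: integral_nonneg_AE)
  qed
  have sumint: "integrable half_line (\<lambda>t. \<Sum>d. f d t)" by (rule integrable_suminf[OF fint AE bsum])
  show ?summable using summable_integral[OF fint AE bsum] unfolding fval .
  define h where "h = (\<lambda>t. of_real t powr (w + 1 / 2 - 1) * exp (- (complex_of_real e * of_real t)))"
  have hint: "integrable half_line h" unfolding h_def by (rule integrable_powr_exp[OF w0(2) e'])
  have "integral\<^sup>L half_line (\<lambda>t. c t * of_real (damped_sine_series (t * X))) =
      integral\<^sup>L half_line (\<lambda>t. (\<Sum>d. f d t) + of_real (2 * sqrt (pi * X)) * h t + riemann_zeta (1 / 2) * c t)"
  proof (rule Bochner_Integration.integral_cong[OF refl])
    fix t assume "t \<in> space half_line"
    hence t: "t > 0" by simp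
    have a: "t * X > 0" using X t by simp
    have 1: "(\<Sum>d. f d t) = c t * (\<Sum>d. damped_term d (t * X))"
      unfolding f_def by (rule suminf_mult[OF damped_sine_series_eq(2)[OF a]])
    have "complex_of_real (sqrt t) = of_real t powr (1 / 2)"
      using powr_of_real[of t "1 / 2"] t by (simp add: powr_half_sqrt)
    hence "of_real t powr (w - 1) * complex_of_real (sqrt t) = of_real t powr (w - 1 + 1 / 2)"
      by (simp only: powr_add)
    also have "w - 1 + 1 / 2 = w + 1 / 2 - 1" by simp
    finally have "c t * complex_of_real (sqrt t) = h t" by (simp add: c_def h_def mult_ac)
    moreover have "2 * sqrt (pi * (t * X)) = sqrt t * (2 * sqrt (pi * X))"
      by (simp add: real_sqrt_mult mult_ac)
    hence "c t * of_real (2 * sqrt (pi * (t * X))) = of_real (2 * sqrt (pi * X)) * (c t * of_real (sqrt t))"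
      by (simp only: of_real_mult mult_ac)
    ultimately have 2: "c t * of_real (2 * sqrt (pi * (t * X))) = of_real (2 * sqrt (pi * X)) * h t" by (simp only:)
    show "c t * of_real (damped_sine_series (t * X)) = (\<Sum>d. f d t) + of_real (2 * sqrt (pi * X)) * h t + riemann_zeta (1 / 2) * c t"
      unfolding damped_sine_series_eq(1)[OF a] 1 2[symmetric] by (simp add: distrib_left mult.commute)
  qed
  also have "\<dots> = integral\<^sup>L half_line (\<lambda>t. \<Sum>d. f d t) + of_real (2 * sqrt (pi * X)) * integral\<^sup>L half_line h + riemann_zeta (1 / 2) * integral\<^sup>L half_line c"
    using sumint hint cint by (simp add: Bochner_Integration.integral_add)
  also have "integral\<^sup>L half_line (\<lambda>t. \<Sum>d. f d t) = (\<Sum>d. integral\<^sup>L half_line (f d))"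
    by (rule integral_suminf[OF fint AE bsum])
  also have "integral\<^sup>L half_line h = Gamma (w + 1 / 2) * of_real e powr (- (w + 1 / 2))"
    unfolding h_def by (rule Gamma_integral_half_line[OF w0(2) e'])
  also have "integral\<^sup>L half_line c = Gamma w * of_real e powr (- w)"
    unfolding c_def by (rule Gamma_integral_half_line[OF w0(1) e'])
  finally show ?int unfolding fval unfolding c_def .
qed

text \<open>Subtraction turns every \<open>exp_series\<close> into \<open>exp_remainder\<close>,
  which has a limit at 0; all singularities in \<open>e\<close> have disappeared.\<close>

lemma abel_difference_damped_sine_series:
  assumes e: "e > 0"
  shows "(\<Sum>k. of_nat (Suc k) powr (w - 1) * exp (- (of_nat (Suc k) * of_real e)) * of_real (damped_sine_series (real (Suc k) * X))) -
     integral\<^sup>L half_line (\<lambda>t. of_real t powr (w - 1) * exp (- (of_real e * of_real t)) * of_real (damped_sine_series (t * X))) =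
     (\<Sum>d. u d * (exp_remainder w (of_real (e + X / real (Suc d))) - exp_remainder w (of_real e)))
      + of_real (2 * sqrt (pi * X)) * exp_remainder (w + 1 / 2) (of_real e) + riemann_zeta (1 / 2) * exp_remainder w (of_real e)"
proof -
  have "(\<Sum>d. u d * (exp_series w (of_real (e + X / real (Suc d))) - exp_series w (of_real e))) -
      (\<Sum>d. u d * (Gamma w * of_real (e + X / real (Suc d)) powr (- w) - Gamma w * of_real e powr (- w))) =
      (\<Sum>d. u d * (exp_series w (of_real (e + X / real (Suc d))) - exp_series w (of_real e)) -
         u d * (Gamma w * of_real (e + X / real (Suc d)) powr (- w) - Gamma w * of_real e powr (- w)))"
    by (rule suminf_diff[OF abel_sum_damped_sine_series(2)[OF e] abel_integral_damped_sine_series(2)[OF e]])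
  also have "(\<lambda>d. u d * (exp_series w (of_real (e + X / real (Suc d))) - exp_series w (of_real e)) -
         u d * (Gamma w * of_real (e + X / real (Suc d)) powr (- w) - Gamma w * of_real e powr (- w))) =
      (\<lambda>d. u d * (exp_remainder w (of_real (e + X / real (Suc d))) - exp_remainder w (of_real e)))"
    unfolding exp_remainder_def by (simp only: right_diff_distrib) (simp add: fun_eq_iff)
  finally have D: "(\<Sum>d. u d * (exp_remainder w (of_real (e + X / real (Suc d))) - exp_remainder w (of_real e))) =
      (\<Sum>d. u d * (exp_series w (of_real (e + X / real (Suc d))) - exp_series w (of_real e))) -
      (\<Sum>d. u d * (Gamma w * of_real (e + X / real (Suc d)) powr (- w) - Gamma w * of_real e powr (- w)))" ..
  have ring: "(S + a * P + z * Q) - (T + a * P' + z * Q') = (S - T) + a * (P - P') + z * (Q - Q')"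
    for S T a P P' z Q Q' :: complex by (simp add: algebra_simps)
  show ?thesis
    unfolding abel_sum_damped_sine_series(1)[OF e] abel_integral_damped_sine_series(1)[OF e] D
    unfolding exp_remainder_def by (rule ring)
qed

lemma summable_damped_sine_series:
  "summable (\<lambda>k. norm (of_nat (Suc k) powr (w - 1) * complex_of_real (damped_sine_series (real (Suc k) * X))))"
proof -
  \<comment> \<open>Large enough that \<open>Re w - 1 - N \<le> - 2\<close>.\<close>
  define N where "N = nat \<lceil>Re w\<rceil> + 1"
  have N: "Re w \<le> real N - 1" "N \<ge> 1" using w by (auto simp: N_def)
  obtain C where C: "C \<ge> 0" "\<And>a. a > 0 \<Longrightarrow> \<bar>damped_sine_series a\<bar> \<le> C / a ^ N"
    by (rule abs_damped_sine_series_le[OF N(2)]) blast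
  show ?thesis
  proof (rule summable_comparison_test'[where N = 0, OF summable_mult[OF powr_nat_summable[of 2], of "C / X ^ N"]])
    fix k :: nat
    have "norm (of_nat (Suc k) powr (w - 1) * complex_of_real (damped_sine_series (real (Suc k) * X))) =
        real (Suc k) powr (Re w - 1) * \<bar>damped_sine_series (real (Suc k) * X)\<bar>"
      by (simp add: norm_mult norm_powr_real_powr del: of_nat_Suc)
    also have "\<dots> \<le> real (Suc k) powr (Re w - 1) * (C / (real (Suc k) * X) ^ N)"
      using X by (intro mult_left_mono C(2)) auto
    also have "\<dots> = C / X ^ N * (real (Suc k) powr (Re w - 1) / real (Suc k) powr real N)"
      by (simp add: power_mult_distrib powr_realpow mult_ac del: of_nat_Suc)
    also have "real (Suc k) powr (Re w - 1) / real (Suc k) powr real N = real (Suc k) powr (Re w - 1 - real N)"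
      by (rule powr_diff[symmetric])
    also have "C / X ^ N * real (Suc k) powr (Re w - 1 - real N) \<le> C / X ^ N * real (Suc k) powr - 2"
      using C(1) X N by (intro mult_left_mono powr_mono) auto
    finally show "norm (norm (of_nat (Suc k) powr (w - 1) * complex_of_real (damped_sine_series (real (Suc k) * X)))) \<le> C / X ^ N * real (Suc k) powr - 2"
      by simp
  qed simp
qed

theorem sum_damped_sine_series:
  "(\<lambda>k. of_nat (Suc k) powr (w - 1) * of_real (damped_sine_series (real (Suc k) * X))) sums
     (Gamma w * of_real X powr (- w) * riemann_zeta (1 / 2 - w)
      + (\<Sum>d. of_real (real (Suc d) powr (- 1 / 2)) * (exp_remainder w (of_real (X / real (Suc d))) - riemann_zeta (1 - w)))
      + of_real (2 * sqrt (pi * X)) * riemann_zeta (1 / 2 - w) + riemann_zeta (1 / 2) * riemann_zeta (1 - w))"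
proof -
  define e where "e = (\<lambda>n. 1 / real (Suc n))"
  have e: "e n > 0" "e n \<le> 1" for n by (simp_all add: e_def)
  have elim: "e \<longlonglongrightarrow> 0" unfolding e_def using LIMSEQ_inverse_real_of_nat by (simp add: inverse_eq_divide)
  have eright: "filterlim e (at_right 0) sequentially"
    unfolding filterlim_at using elim e by (auto intro!: always_eventually simp: less_imp_neq[symmetric])
  define D where "D = (\<lambda>t. complex_of_real (damped_sine_series (t * X)))"
  have lim1: "(\<lambda>n. \<Sum>k. of_nat (Suc k) powr (w - 1) * exp (- (of_nat (Suc k) * of_real (e n))) * D (real (Suc k))) \<longlonglongrightarrow>
      (\<Sum>k. of_nat (Suc k) powr (w - 1) * exp (- (of_nat (Suc k) * of_real 0)) * D (real (Suc k)))"
  proof (rule tendsto_suminf_dominated[OF _ _ summable_damped_sine_series[folded D_def]])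
    show "(\<lambda>n. of_nat (Suc k) powr (w - 1) * exp (- (of_nat (Suc k) * of_real (e n))) * D (real (Suc k))) \<longlonglongrightarrow>
        of_nat (Suc k) powr (w - 1) * exp (- (of_nat (Suc k) * of_real 0)) * D (real (Suc k))" for k
      by (intro tendsto_intros elim)
    show "eventually (\<lambda>n. \<forall>k. norm (of_nat (Suc k) powr (w - 1) * exp (- (of_nat (Suc k) * of_real (e n))) * D (real (Suc k))) \<le>
        norm (of_nat (Suc k) powr (w - 1) * complex_of_real (damped_sine_series (real (Suc k) * X)))) sequentially"
    proof (intro always_eventually allI)
      fix n k
      have "0 \<le> real (Suc k) * e n" using e(1)[of n] by (intro mult_nonneg_nonneg) auto
      hence "norm (exp (- (of_nat (Suc k) * complex_of_real (e n)))) \<le> 1" by simp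
      hence "norm (of_nat (Suc k) powr (w - 1) * D (real (Suc k))) * norm (exp (- (of_nat (Suc k) * complex_of_real (e n)))) \<le>
          norm (of_nat (Suc k) powr (w - 1) * D (real (Suc k))) * 1"
        by (intro mult_left_mono) auto
      thus "norm (of_nat (Suc k) powr (w - 1) * exp (- (of_nat (Suc k) * of_real (e n))) * D (real (Suc k))) \<le>
        norm (of_nat (Suc k) powr (w - 1) * complex_of_real (damped_sine_series (real (Suc k) * X)))"
        by (simp only: norm_mult D_def mult_ac mult_1)
    qed
  qed simp
  have Dint: "integrable half_line (\<lambda>t. of_real t powr (w - 1) * D t)"
    unfolding D_def by (rule damped_sine_series_mellin(1)[OF w X])
  have lim2: "(\<lambda>n. integral\<^sup>L half_line (\<lambda>t. of_real t powr (w - 1) * exp (- (of_real (e n) * of_real t)) * D t)) \<longlonglongrightarrow>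
      integral\<^sup>L half_line (\<lambda>t. of_real t powr (w - 1) * D t)"
  proof (rule integral_dominated_convergence[where w = "\<lambda>t. norm (of_real t powr (w - 1) * D t)"])
    show meas: "(\<lambda>t. of_real t powr (w - 1) * D t) \<in> borel_measurable half_line" using Dint by auto
    show "(\<lambda>t. of_real t powr (w - 1) * exp (- (of_real (e n) * of_real t)) * D t) \<in> borel_measurable half_line" for n
    proof -
      have "(\<lambda>t. exp (- (complex_of_real (e n) * of_real t))) \<in> borel_measurable half_line"
        by (rule continuous_imp_measurable_on_sets_lebesgue) (auto intro!: continuous_intros)
      from borel_measurable_times[OF this meas] show ?thesis by (simp add: mult_ac)
    qed
    show "integrable half_line (\<lambda>t. norm (of_real t powr (w - 1) * D t))" by (rule integrable_norm[OF Dint])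
    show "AE t in half_line. norm (of_real t powr (w - 1) * exp (- (of_real (e n) * of_real t)) * D t) \<le> norm (of_real t powr (w - 1) * D t)" for n
    proof (rule AE_I2)
      fix t assume "t \<in> space half_line"
      hence "0 \<le> e n * t" using e(1)[of n] by (intro mult_nonneg_nonneg) auto
      hence "norm (exp (- (of_real (e n) * complex_of_real t))) \<le> 1" by simp
      hence "norm (of_real t powr (w - 1) * D t) * norm (exp (- (of_real (e n) * complex_of_real t))) \<le> norm (of_real t powr (w - 1) * D t) * 1"
        by (intro mult_left_mono) auto
      thus "norm (of_real t powr (w - 1) * exp (- (of_real (e n) * of_real t)) * D t) \<le> norm (of_real t powr (w - 1) * D t)"
        by (simp only: norm_mult mult_ac mult_1)
    qed
    show "AE t in half_line. (\<lambda>n. of_real t powr (w - 1) * exp (- (of_real (e n) * of_real t)) * D t) \<longlonglongrightarrow> of_real t powr (w - 1) * D t"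
    proof (rule AE_I2)
      fix t
      have "(\<lambda>n. of_real t powr (w - 1) * exp (- (of_real (e n) * of_real t)) * D t) \<longlonglongrightarrow> of_real t powr (w - 1) * exp (- (of_real 0 * of_real t)) * D t"
        by (intro tendsto_intros elim)
      thus "(\<lambda>n. of_real t powr (w - 1) * exp (- (of_real (e n) * of_real t)) * D t) \<longlonglongrightarrow> of_real t powr (w - 1) * D t" by simp
    qed
  qed
  define K where "K = lipschitz_bound (w + 1)"
  have K: "K \<ge> 0" unfolding K_def using w by (intro lipschitz_bound_nonneg) auto
  have z: "(\<lambda>n. exp_remainder w' (of_real (e n))) \<longlonglongrightarrow> riemann_zeta (1 - w')" if "Re w' > 0" for w'
    using filterlim_compose[OF exp_remainder_tendsto[OF that] eright] exp_constant_eq_zeta[OF that] by simp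
  \<comment> \<open>The arguments of the two remainders differ by \<open>X / Suc d\<close> for every
    \<open>n\<close>, so \<open>exp_remainder_diff_le\<close> gives a majorant of exponent 3/2
    independent of the damping.\<close>
  have lim3: "(\<lambda>n. \<Sum>d. u d * (exp_remainder w (of_real (e n + X / real (Suc d))) - exp_remainder w (of_real (e n)))) \<longlonglongrightarrow>
      (\<Sum>d. u d * (exp_remainder w (of_real (X / real (Suc d))) - riemann_zeta (1 - w)))"
  proof (rule tendsto_suminf_dominated)
    show "summable (\<lambda>d. K * X * real (Suc d) powr - (3 / 2))" by (intro summable_mult powr_nat_summable) simp
    show "eventually (\<lambda>n. \<forall>d. norm (u d * (exp_remainder w (of_real (e n + X / real (Suc d))) - exp_remainder w (of_real (e n)))) \<le>
        K * X * real (Suc d) powr - (3 / 2)) sequentially"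
    proof (intro always_eventually allI)
      fix n d
      have nu: "norm (u d) = real (Suc d) powr (- 1 / 2)" by (simp add: u_def)
      have Xd: "X / real (Suc d) > 0" using X by simp
      have "norm (exp_remainder w (of_real (e n + X / real (Suc d))) - exp_remainder w (of_real (e n))) \<le> K * \<bar>e n + X / real (Suc d) - e n\<bar>"
        unfolding K_def using e(1)[of n] Xd by (intro exp_remainder_diff_le[OF w0(1)]) auto
      also have "\<bar>e n + X / real (Suc d) - e n\<bar> = X / real (Suc d)" using X by simp
      finally have "norm (u d) * norm (exp_remainder w (of_real (e n + X / real (Suc d))) - exp_remainder w (of_real (e n))) \<le> norm (u d) * (K * (X / real (Suc d)))"
        by (intro mult_left_mono) auto
      also note nu
      also have "real (Suc d) powr (- 1 / 2) * (K * (X / real (Suc d))) = K * X * (real (Suc d) powr (- 1 / 2) / real (Suc d) powr 1)" by simp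
      also have "real (Suc d) powr (- 1 / 2) / real (Suc d) powr 1 = real (Suc d) powr - (3 / 2)" by (subst powr_diff[symmetric]) simp
      finally show "norm (u d * (exp_remainder w (of_real (e n + X / real (Suc d))) - exp_remainder w (of_real (e n)))) \<le> K * X * real (Suc d) powr - (3 / 2)"
        by (simp only: norm_mult nu)
    qed
    fix d
    have "Re (complex_of_real (X / real (Suc d))) > 0" using X by simp
    hence C1: "isCont (exp_remainder w) (of_real (X / real (Suc d)))"
      using has_field_derivative_exp_remainder[OF _ w0(1)] DERIV_isCont by blast
    have "(\<lambda>n. complex_of_real (e n + X / real (Suc d))) \<longlonglongrightarrow> of_real (0 + X / real (Suc d))"
      by (intro tendsto_of_real tendsto_add elim tendsto_const)
    hence C2: "(\<lambda>n. complex_of_real (e n + X / real (Suc d))) \<longlonglongrightarrow> of_real (X / real (Suc d))"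
      by (simp only: add_0)
    note A = isCont_tendsto_compose[OF C1 C2]
    show "(\<lambda>n. u d * (exp_remainder w (of_real (e n + X / real (Suc d))) - exp_remainder w (of_real (e n)))) \<longlonglongrightarrow>
        u d * (exp_remainder w (of_real (X / real (Suc d))) - riemann_zeta (1 - w))"
      by (rule tendsto_mult[OF tendsto_const tendsto_diff[OF A z[OF w0(1)]]])
  qed simp
  have "(\<lambda>n. (\<Sum>k. of_nat (Suc k) powr (w - 1) * exp (- (of_nat (Suc k) * of_real (e n))) * D (real (Suc k))) -
      integral\<^sup>L half_line (\<lambda>t. of_real t powr (w - 1) * exp (- (of_real (e n) * of_real t)) * D t)) \<longlonglongrightarrow>
      (\<Sum>d. u d * (exp_remainder w (of_real (X / real (Suc d))) - riemann_zeta (1 - w)))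
      + of_real (2 * sqrt (pi * X)) * riemann_zeta (1 - (w + 1 / 2)) + riemann_zeta (1 / 2) * riemann_zeta (1 - w)"
    unfolding D_def abel_difference_damped_sine_series[OF e(1)]
    by (rule tendsto_add[OF tendsto_add[OF lim3 tendsto_mult[OF tendsto_const z[OF w0(2)]]] tendsto_mult[OF tendsto_const z[OF w0(1)]]])
  moreover have "(\<lambda>n. (\<Sum>k. of_nat (Suc k) powr (w - 1) * exp (- (of_nat (Suc k) * of_real (e n))) * D (real (Suc k))) -
      integral\<^sup>L half_line (\<lambda>t. of_real t powr (w - 1) * exp (- (of_real (e n) * of_real t)) * D t)) \<longlonglongrightarrow>
      (\<Sum>k. of_nat (Suc k) powr (w - 1) * exp (- (of_nat (Suc k) * of_real 0)) * D (real (Suc k))) -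
      integral\<^sup>L half_line (\<lambda>t. of_real t powr (w - 1) * D t)"
    by (rule tendsto_diff[OF lim1 lim2])
  ultimately have eq: "(\<Sum>d. u d * (exp_remainder w (of_real (X / real (Suc d))) - riemann_zeta (1 - w)))
      + of_real (2 * sqrt (pi * X)) * riemann_zeta (1 - (w + 1 / 2)) + riemann_zeta (1 / 2) * riemann_zeta (1 - w) =
      (\<Sum>k. of_nat (Suc k) powr (w - 1) * exp (- (of_nat (Suc k) * of_real 0)) * D (real (Suc k))) -
      integral\<^sup>L half_line (\<lambda>t. of_real t powr (w - 1) * D t)"
    by (rule LIMSEQ_unique)
  have half: "1 - (w + 1 / 2) = 1 / 2 - w" by simp
  have M: "integral\<^sup>L half_line (\<lambda>t. of_real t powr (w - 1) * D t) = Gamma w * of_real X powr (- w) * riemann_zeta (1 / 2 - w)"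
    unfolding D_def by (rule damped_sine_series_mellin(2)[OF w X])
  have "(\<Sum>k. of_nat (Suc k) powr (w - 1) * D (real (Suc k))) =
      Gamma w * of_real X powr (- w) * riemann_zeta (1 / 2 - w)
      + (\<Sum>d. u d * (exp_remainder w (of_real (X / real (Suc d))) - riemann_zeta (1 - w)))
      + of_real (2 * sqrt (pi * X)) * riemann_zeta (1 / 2 - w) + riemann_zeta (1 / 2) * riemann_zeta (1 - w)"
    using eq unfolding half M by (simp add: algebra_simps)
  moreover have "summable (\<lambda>k. of_nat (Suc k) powr (w - 1) * D (real (Suc k)))"
    unfolding D_def by (rule summable_norm_cancel[OF summable_damped_sine_series])
  ultimately show ?thesis unfolding D_def u_def by (simp only: sums_iff)
qed

end

section \<open>Divisor sums\<close>

text \<open>Rearrangement along the bijection taking \<open>(d, m)\<close> to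
  \<open>(d m, d)\<close>, from pairs of positive integers onto pairs of a number and a divisor. The
  power bound factorises over \<open>d\<close> and \<open>m\<close>: the sum over \<open>m\<close>
  needs \<open>\<alpha> > 1\<close>, the one over \<open>d\<close> needs
  \<open>\<alpha> - Re s > 1\<close>.\<close>

lemma divisor_sigma_sums:
  fixes F :: "nat \<Rightarrow> complex"
  assumes bound: "\<And>n. n \<ge> 1 \<Longrightarrow> norm (F n) \<le> C * real n powr - \<alpha>" and \<alpha>: "\<alpha> > 1" "\<alpha> > Re s + 1"
  shows "(\<lambda>n. divisor_sigma s (Suc n) * F (Suc n)) sums (\<Sum>d. \<Sum>m. of_nat (Suc d) powr s * F (Suc d * Suc m))"
    and "summable (\<lambda>d. \<Sum>m. of_nat (Suc d) powr s * F (Suc d * Suc m))"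
    and "summable (\<lambda>m. F (Suc d * Suc m))"
proof -
  define f where "f = (\<lambda>(n, d). of_nat d powr s * F n)"
  define P where "P = (SIGMA n:{1..}. {d::nat. d dvd n})"
  define g where "g = (\<lambda>(d, m). (Suc d * Suc m, Suc d))"
  define A where "A = (\<lambda>d. C * real (Suc d) powr - (\<alpha> - Re s))"
  define B where "B = (\<lambda>m. real (Suc m) powr - \<alpha>)"
  have C: "C \<ge> 0" using order_trans[OF norm_ge_zero bound[of 1]] by simp
  have sA: "summable A" unfolding A_def using \<alpha> by (intro summable_mult powr_nat_summable) auto
  have sB: "summable B" unfolding B_def using \<alpha> by (intro powr_nat_summable) auto
  have A0: "A d \<ge> 0" and B0: "B m \<ge> 0" for d m using C by (auto simp: A_def B_def)
  have gb: "norm (f (g (d, m))) \<le> A d * B m" for d m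
  proof -
    have "norm (f (g (d, m))) = real (Suc d) powr Re s * norm (F (Suc d * Suc m))"
      unfolding f_def g_def by (simp add: norm_mult norm_powr_real_powr del: of_nat_Suc mult_Suc mult_Suc_right)
    also have "\<dots> \<le> real (Suc d) powr Re s * (C * real (Suc d * Suc m) powr - \<alpha>)"
      by (intro mult_left_mono bound) auto
    also have "real (Suc d * Suc m) powr - \<alpha> = real (Suc d) powr - \<alpha> * real (Suc m) powr - \<alpha>"
      unfolding of_nat_mult by (rule powr_mult)
    also have "real (Suc d) powr Re s * (C * (real (Suc d) powr - \<alpha> * real (Suc m) powr - \<alpha>)) =
        C * (real (Suc d) powr Re s * real (Suc d) powr - \<alpha>) * real (Suc m) powr - \<alpha>" by simp
    also have "real (Suc d) powr Re s * real (Suc d) powr - \<alpha> = real (Suc d) powr - (\<alpha> - Re s)"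
      by (subst powr_add[symmetric]) simp
    finally show ?thesis by (simp add: A_def B_def)
  qed
  have rows: "summable (\<lambda>m. norm (f (g (d, m))))" for d
    by (rule summable_comparison_test'[where N = 0, OF summable_mult[OF sB, of "A d"]]) (use gb in auto)
  have absAB: "(\<lambda>x. norm (case x of (d, m) \<Rightarrow> A d * B m)) summable_on UNIV \<times> UNIV"
    unfolding Infinite_Sum.abs_summable_on_Sigma_iff
  proof (intro conjI ballI)
    have "(\<lambda>m. norm (A d * B m)) summable_on UNIV" for d
      using A0 B0 by (intro norm_summable_imp_summable_on) (auto simp: abs_mult intro!: summable_mult sB)
    thus "(\<lambda>m. norm (case (d, m) of (d, m) \<Rightarrow> A d * B m)) summable_on UNIV" for d by simp
    have "infsum (\<lambda>m. norm (A d * B m)) UNIV = A d * suminf B" for d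
    proof -
      have "(\<lambda>m. A d * B m) sums (A d * suminf B)" by (intro sums_mult summable_sums sB)
      hence "((\<lambda>m. A d * B m) has_sum (A d * suminf B)) UNIV"
        using A0 B0 by (intro sums_nonneg_imp_has_sum) auto
      thus ?thesis using A0 B0 by (simp add: infsumI abs_mult)
    qed
    moreover have "(\<lambda>d. norm (A d * suminf B)) summable_on UNIV"
      using A0 suminf_nonneg[OF sB] B0 by (intro norm_summable_imp_summable_on) (auto simp: abs_mult intro!: summable_mult2 sA)
    ultimately show "(\<lambda>d. norm (infsum (\<lambda>m. norm (case (d, m) of (d, m) \<Rightarrow> A d * B m)) UNIV)) summable_on UNIV" by simp
  qed
  have "(\<lambda>x. norm (f (g x))) summable_on UNIV \<times> UNIV"
  proof (rule Infinite_Sum.abs_summable_on_comparison_test[OF absAB])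
    fix x :: "nat \<times> nat"
    show "norm (f (g x)) \<le> norm (case x of (d, m) \<Rightarrow> A d * B m)"
      using gb[of "fst x" "snd x"] A0 B0 by (cases x) (auto simp: abs_mult)
  qed
  hence "(\<lambda>x. f (g x)) summable_on UNIV \<times> UNIV" by (rule abs_summable_summable)
  then obtain S where S: "((\<lambda>x. f (g x)) has_sum S) (UNIV \<times> UNIV)" by (auto simp: summable_on_def)
  have "((\<lambda>d. \<Sum>m. f (g (d, m))) has_sum S) UNIV"
  proof (rule has_sum_SigmaD[OF S])
    show "((\<lambda>m. f (g (d, m))) has_sum (\<Sum>m. f (g (d, m)))) UNIV" for d
      by (intro norm_summable_imp_has_sum rows summable_sums summable_norm_cancel[OF rows])
  qed
  hence "(\<lambda>d. \<Sum>m. f (g (d, m))) sums S" by (rule has_sum_imp_sums)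
  hence 1: "(\<lambda>d. \<Sum>m. of_nat (Suc d) powr s * F (Suc d * Suc m)) sums S"
    by (simp add: f_def g_def del: mult_Suc mult_Suc_right)
  thus "summable (\<lambda>d. \<Sum>m. of_nat (Suc d) powr s * F (Suc d * Suc m))" by (rule sums_summable)
  have "bij_betw g (UNIV \<times> UNIV) P"
  proof (rule bij_betwI')
    fix x y :: "nat \<times> nat"
    show "g x = g y \<longleftrightarrow> x = y" by (cases x; cases y) (auto simp: g_def simp del: mult_Suc mult_Suc_right)
    show "g x \<in> P" by (cases x) (auto simp: g_def P_def simp del: mult_Suc mult_Suc_right)
  next
    fix y assume "y \<in> P"
    then obtain n d where y: "y = (n, d)" "n \<ge> 1" "d dvd n" by (auto simp: P_def)
    then obtain m where m: "n = d * m" by auto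
    hence "d \<ge> 1" "m \<ge> 1" using y(2) by (auto simp: Suc_le_eq)
    hence "g (d - 1, m - 1) = y" by (simp add: g_def y m del: mult_Suc mult_Suc_right)
    thus "\<exists>x\<in>UNIV \<times> UNIV. y = g x" by blast
  qed
  with S have "(f has_sum S) P" by (simp add: has_sum_reindex_bij_betw)
  hence "((\<lambda>n. divisor_sigma s n * F n) has_sum S) {1..}"
    unfolding P_def
  proof (rule has_sum_SigmaD)
    fix n :: nat assume "n \<in> {1..}"
    hence "finite {d. d dvd n}" by auto
    thus "((\<lambda>d. f (n, d)) has_sum (divisor_sigma s n * F n)) {d. d dvd n}"
      by (intro has_sum_finiteI) (auto simp: divisor_sigma_def f_def sum_distrib_right)
  qed
  moreover have "bij_betw Suc UNIV {1..}" by (rule bij_betwI[of _ _ _ "\<lambda>n. n - 1"]) auto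
  ultimately have "((\<lambda>n. divisor_sigma s (Suc n) * F (Suc n)) has_sum S) UNIV"
    using has_sum_reindex_bij_betw[of Suc UNIV "{1..}" "\<lambda>n. divisor_sigma s n * F n" S] by simp
  hence "(\<lambda>n. divisor_sigma s (Suc n) * F (Suc n)) sums S" by (rule has_sum_imp_sums)
  thus "(\<lambda>n. divisor_sigma s (Suc n) * F (Suc n)) sums (\<Sum>d. \<Sum>m. of_nat (Suc d) powr s * F (Suc d * Suc m))"
    using 1 by (simp add: sums_iff)
  show "summable (\<lambda>m. F (Suc d * Suc m))"
  proof (rule summable_norm_cancel, rule summable_comparison_test'[where N = 0, OF summable_mult[OF sB, of "C * real (Suc d) powr - \<alpha>"]])
    fix m
    have "norm (F (Suc d * Suc m)) \<le> C * real (Suc d * Suc m) powr - \<alpha>" by (intro bound) auto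
    also have "real (Suc d * Suc m) powr - \<alpha> = real (Suc d) powr - \<alpha> * real (Suc m) powr - \<alpha>"
      unfolding of_nat_mult by (rule powr_mult)
    finally show "norm (norm (F (Suc d * Suc m))) \<le> C * real (Suc d) powr - \<alpha> * B m"
      by (simp add: B_def mult.assoc)
  qed
qed

text \<open>The common value of the two kinds of bracketed terms in the theorem, for \<open>n < x\<close> and \<open>n \<ge> x\<close>.\<close>
definition koshliakov_term :: "complex \<Rightarrow> real \<Rightarrow> nat \<Rightarrow> complex" where
  "koshliakov_term w x n = ((of_real x + \<i> * of_nat n) powr (- w) + (of_real x - \<i> * of_nat n) powr (- w)) / 2
     - cos (of_real pi * w / 2) * of_nat n powr (- w)"

text \<open>Scaling by \<open>r = 2 * pi / Suc d\<close> takes \<open>x + \<i> n\<close> and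
  \<open>x - \<i> n\<close>, for \<open>n = d m\<close>, to the bases occurring in the m-th
  Lipschitz term at \<open>y = 2 pi x / d\<close>. Positive real factors come out of principal
  powers without a phase.\<close>

lemma koshliakov_term_lipschitz:
  assumes x: "x > 0"
  shows "koshliakov_term w x (Suc d * Suc m) = of_real (2 * pi) powr w / 2 * of_nat (Suc d) powr (- w) *
    (lipschitz_term w (of_real (2 * pi * x / real (Suc d))) m - lipschitz_term w 0 m)"
proof -
  define r where "r = 2 * pi / real (Suc d)"
  have r: "r > 0" by (simp add: r_def)
  define P where "P = (of_real x + \<i> * of_nat (Suc d * Suc m)) powr (- w)"
  define Q where "Q = (of_real x - \<i> * of_nat (Suc d * Suc m)) powr (- w)"
  have arg: "of_real (2 * pi * x / real (Suc d)) + 2 * of_real pi * \<i> * of_nat (Suc m) = of_real r * (of_real x + \<i> * of_nat (Suc d * Suc m))"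
     "of_real (2 * pi * x / real (Suc d)) - 2 * of_real pi * \<i> * of_nat (Suc m) = of_real r * (of_real x - \<i> * of_nat (Suc d * Suc m))"
    unfolding r_def of_nat_mult by (simp_all add: field_simps del: of_nat_Suc)
  have pm: "(of_real r * z) powr (- w) = of_real r powr (- w) * z powr (- w)" for z
    using r by (intro powr_times_real_left) auto
  have L1: "lipschitz_term w (of_real (2 * pi * x / real (Suc d))) m = of_real r powr (- w) * (P + Q)"
    unfolding lipschitz_term_def arg pm P_def Q_def by (rule distrib_left[symmetric])
  have rp: "of_real r powr (- w) = of_real (2 * pi) powr (- w) * of_nat (Suc d) powr w"
  proof -
    have "of_real (2 * pi) powr (- w) = (of_real r * of_nat (Suc d)) powr (- w)"
      by (rule arg_cong[where f = "\<lambda>z. z powr (- w)"]) (simp add: r_def del: of_nat_Suc)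
    also have "\<dots> = of_real r powr (- w) * of_nat (Suc d) powr (- w)"
      using r by (intro powr_times_real_left) auto
    finally show ?thesis by (simp add: powr_minus field_simps del: of_nat_Suc)
  qed
  have np: "of_nat (Suc d * Suc m) powr (- w) = of_nat (Suc d) powr (- w) * (of_nat (Suc m) powr (- w) :: complex)"
    unfolding of_nat_mult by (intro powr_times_real_left) auto
  define a where "a = complex_of_real (2 * pi) powr w"
  define b where "b = (of_nat (Suc d) :: complex) powr w"
  define c where "c = (of_nat (Suc m) :: complex) powr (- w)"
  define C where "C = cos (complex_of_real pi * w / 2)"
  have ab: "a \<noteq> 0" "b \<noteq> 0" by (auto simp: a_def b_def simp del: of_nat_Suc)
  have inv: "complex_of_real (2 * pi) powr (- w) = inverse a" "(of_nat (Suc d) :: complex) powr (- w) = inverse b"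
    by (simp_all only: powr_minus a_def b_def)
  have "a / 2 * inverse b * (inverse a * b * (P + Q) - 2 * inverse a * C * c) = (P + Q) / 2 - C * (inverse b * c)"
    using ab by (simp add: field_simps)
  thus ?thesis
    unfolding koshliakov_term_def L1 lipschitz_term_0 rp np inv a_def[symmetric] b_def[symmetric] c_def[symmetric] C_def[symmetric]
      P_def[symmetric] Q_def[symmetric] by (rule sym)
qed

text \<open>Case of divisor 1 (index 0) of \<open>koshliakov_term_lipschitz\<close>. With
  \<open>w = s + 1 / 2\<close> the exponent \<open>Re w + 1\<close> exceeds \<open>Re s + 1\<close>,
  as the divisor rearrangement demands.\<close>

lemma norm_koshliakov_term_le:
  assumes x: "x > 0" and w: "Re w > 0"
  obtains C where "\<And>n. n \<ge> 1 \<Longrightarrow> norm (koshliakov_term w x n) \<le> C * real n powr - (Re w + 1)"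
proof
  fix n :: nat assume "n \<ge> 1"
  then obtain m where n: "n = Suc m" by (cases n) auto
  have "koshliakov_term w x n = of_real (2 * pi) powr w / 2 * (lipschitz_term w (of_real (2 * pi * x)) m - lipschitz_term w 0 m)"
    using koshliakov_term_lipschitz[OF x, of w 0 m] by (simp add: n)
  hence "norm (koshliakov_term w x n) = norm (complex_of_real (2 * pi) powr w / 2) * norm (lipschitz_term w (of_real (2 * pi * x)) m - lipschitz_term w 0 m)"
    by (simp only: norm_mult)
  also have "\<dots> \<le> norm (complex_of_real (2 * pi) powr w / 2) *
      (norm w * (2 * exp (pi / 2 * \<bar>Im w\<bar>) * real (Suc m) powr - (Re w + 1)) * (2 * pi * x))"
    using x w by (intro mult_left_mono norm_lipschitz_term_diff_le) auto
  also have "\<dots> = norm (complex_of_real (2 * pi) powr w / 2) * (norm w * (2 * exp (pi / 2 * \<bar>Im w\<bar>)) * (2 * pi * x)) * real n powr - (Re w + 1)"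
    unfolding n by (simp only: mult_ac)
  finally show "norm (koshliakov_term w x n) \<le> norm (complex_of_real (2 * pi) powr w / 2) * (norm w * (2 * exp (pi / 2 * \<bar>Im w\<bar>)) * (2 * pi * x)) * real n powr - (Re w + 1)" .
qed

text \<open>For fixed divisor \<open>d\<close> the sum over the cofactor is the regularized
  Lipschitz formula at \<open>2 pi x / d\<close>, and the powers of \<open>d\<close> combine to
  exponent \<open>s - w = - 1 / 2\<close>. The value is stated after multiplication by
  \<open>Gamma w\<close>, the form in which the theorem contains it.\<close>

theorem sum_divisor_sigma_koshliakov_term:
  assumes s: "Re s > 0" and x: "x > 0"
  defines "w \<equiv> s + 1 / 2"
  shows "\<exists>T. (\<lambda>n. divisor_sigma s (Suc n) * koshliakov_term w x (Suc n)) sums T \<and>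
     Gamma w * T = of_real (2 * pi) powr w / 2 *
       (\<Sum>d. of_real (real (Suc d) powr (- 1 / 2)) * (exp_remainder w (of_real (2 * pi * x / real (Suc d))) - riemann_zeta (1 - w)))"
proof -
  have w: "Re w > 0" using s by (simp add: w_def)
  obtain C where C: "\<And>n. n \<ge> 1 \<Longrightarrow> norm (koshliakov_term w x n) \<le> C * real n powr - (Re w + 1)"
    by (rule norm_koshliakov_term_le[OF x w]) blast
  have \<alpha>: "Re w + 1 > 1" "Re w + 1 > Re s + 1" using w by (auto simp: w_def)
  note S = divisor_sigma_sums[of "koshliakov_term w x" C "Re w + 1" s, OF C \<alpha>]
  define T where "T = (\<Sum>d. \<Sum>m. of_nat (Suc d) powr s * koshliakov_term w x (Suc d * Suc m))"
  define R where "R = (\<lambda>d. exp_remainder w (of_real (2 * pi * x / real (Suc d))) - riemann_zeta (1 - w))"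
  define A where "A = complex_of_real (2 * pi) powr w / 2"
  have inner: "Gamma w * (\<Sum>m. of_nat (Suc d) powr s * koshliakov_term w x (Suc d * Suc m)) =
      A * (of_real (real (Suc d) powr (- 1 / 2)) * R d)" for d
  proof -
    have "2 * pi * x / real (Suc d) > 0" using x by simp
    hence "(\<lambda>m. Gamma w * (lipschitz_term w (of_real (2 * pi * x / real (Suc d))) m - lipschitz_term w 0 m)) sums R d"
      unfolding R_def by (rule regularized_lipschitz_formula[OF w])
    hence "(\<lambda>m. of_nat (Suc d) powr s * (A * of_nat (Suc d) powr (- w)) * (Gamma w * (lipschitz_term w (of_real (2 * pi * x / real (Suc d))) m - lipschitz_term w 0 m)))
        sums (of_nat (Suc d) powr s * (A * of_nat (Suc d) powr (- w)) * R d)"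
      by (rule sums_mult)
    also have "(\<lambda>m. of_nat (Suc d) powr s * (A * of_nat (Suc d) powr (- w)) * (Gamma w * (lipschitz_term w (of_real (2 * pi * x / real (Suc d))) m - lipschitz_term w 0 m))) =
        (\<lambda>m. Gamma w * (of_nat (Suc d) powr s * koshliakov_term w x (Suc d * Suc m)))"
      unfolding koshliakov_term_lipschitz[OF x] A_def by (simp only: mult_ac)
    also have "of_nat (Suc d) powr s * (A * of_nat (Suc d) powr (- w)) * R d = A * ((of_nat (Suc d) powr s * of_nat (Suc d) powr (- w)) * R d)"
      by (simp only: mult_ac)
    also have "of_nat (Suc d) powr s * of_nat (Suc d) powr (- w) = complex_of_real (real (Suc d) powr (- 1 / 2))"
    proof -
      have "of_nat (Suc d) powr s * of_nat (Suc d) powr (- w) = (of_nat (Suc d) :: complex) powr (s + - w)"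
        by (rule powr_add[symmetric])
      also have "s + - w = complex_of_real (- 1 / 2)" by (simp add: w_def)
      also have "(of_nat (Suc d) :: complex) = of_real (real (Suc d))" by simp
      also have "complex_of_real (real (Suc d)) powr complex_of_real (- 1 / 2) = of_real (real (Suc d) powr (- 1 / 2))"
        by (rule powr_of_real) simp
      finally show ?thesis by (simp only: of_real_of_nat_eq)
    qed
    finally have "(\<lambda>m. Gamma w * (of_nat (Suc d) powr s * koshliakov_term w x (Suc d * Suc m))) sums
      (A * (of_real (real (Suc d) powr (- 1 / 2)) * R d))" .
    hence "(\<Sum>m. Gamma w * (of_nat (Suc d) powr s * koshliakov_term w x (Suc d * Suc m))) = A * (of_real (real (Suc d) powr (- 1 / 2)) * R d)"
      by (rule sums_unique[symmetric])
    thus ?thesis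
      by (subst (asm) suminf_mult) (auto intro!: summable_mult S(3) simp del: mult_Suc mult_Suc_right of_nat_Suc)
  qed
  have A0: "A \<noteq> 0" by (simp add: A_def)
  have "(\<Sum>d. Gamma w * (\<Sum>m. of_nat (Suc d) powr s * koshliakov_term w x (Suc d * Suc m))) = Gamma w * T"
    unfolding T_def by (rule suminf_mult[OF S(2)])
  moreover have "summable (\<lambda>d. A * (of_real (real (Suc d) powr (- 1 / 2)) * R d))"
    unfolding inner[symmetric] by (rule summable_mult[OF S(2)])
  hence "summable (\<lambda>d. of_real (real (Suc d) powr (- 1 / 2)) * R d)"
    using A0 by (simp only: summable_cmult_iff) blast
  hence "(\<Sum>d. A * (of_real (real (Suc d) powr (- 1 / 2)) * R d)) = A * (\<Sum>d. of_real (real (Suc d) powr (- 1 / 2)) * R d)"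
    by (rule suminf_mult)
  ultimately have "Gamma w * T = A * (\<Sum>d. of_real (real (Suc d) powr (- 1 / 2)) * R d)"
    unfolding inner by (rule trans[OF sym])
  moreover have "(\<lambda>n. divisor_sigma s (Suc n) * koshliakov_term w x (Suc n)) sums T"
    unfolding T_def by (rule S(1))
  ultimately show ?thesis unfolding A_def R_def by blast
qed

text \<open>For fixed divisor \<open>d\<close> the sum over the cofactor is S at
  \<open>2 pi x d\<close>, since \<open>2 sqrt (pi (2 pi x) n) = 2 pi sqrt (2 n x)\<close>. The
  \<open>sqrt 2\<close> built into S accounts for the factor in front.\<close>

theorem sum_divisor_sigma_damped_sine:
  assumes s: "Re s > 0" and x: "x > 0"
  defines "w \<equiv> s + 1 / 2"
  shows "(\<lambda>n. divisor_sigma s (Suc n) / complex_of_real (sqrt (real (Suc n)))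
              * complex_of_real (exp (- 2 * pi * sqrt (2 * real (Suc n) * x)))
              * complex_of_real (sin (pi / 4 - 2 * pi * sqrt (2 * real (Suc n) * x)))) sums
     (1 / complex_of_real (sqrt 2) * (\<Sum>k. of_nat (Suc k) powr (w - 1) * of_real (damped_sine_series (real (Suc k) * (2 * pi * x)))))"
proof -
  define f where "f = (\<lambda>n. 1 / sqrt (real n) * exp (- 2 * pi * sqrt (2 * real n * x)) * sin (pi / 4 - 2 * pi * sqrt (2 * real n * x)))"
  define F where "F = (\<lambda>n. complex_of_real (f n))"
  \<comment> \<open>\<open>N \<ge> Re s + 1\<close>, so that the decay exponent
    \<open>N + 1 / 2\<close>, the half coming from \<open>1 / sqrt n\<close>, exceeds
    \<open>Re s + 1\<close>.\<close>
  define N where "N = nat \<lceil>Re s\<rceil> + 1"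
  have N: "real N \<ge> Re s + 1" "real N \<ge> 1" using s by (auto simp: N_def)
  define \<alpha> where "\<alpha> = real N + 1 / 2"
  have \<alpha>: "\<alpha> > 1" "\<alpha> > Re s + 1" using N by (auto simp: \<alpha>_def)
  define C where "C = fact (2 * N) / (4 * pi * (2 * pi * x)) ^ N"
  have v: "2 * sqrt (pi * (2 * pi * x) * r) = 2 * pi * sqrt (2 * r * x)" if "r \<ge> 0" for r
  proof -
    have "pi * (2 * pi * x) * r = pi\<^sup>2 * (2 * r * x)" by (simp add: power2_eq_square)
    thus ?thesis by (simp add: real_sqrt_mult)
  qed
  have bound: "norm (F n) \<le> C * real n powr - \<alpha>" if n: "n \<ge> 1" for n
  proof -
    have n0: "real n > 0" using n by simp
    have e: "exp (- 2 * pi * sqrt (2 * real n * x)) \<le> C / real n ^ N"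
    proof -
      have "exp (- 2 * sqrt (pi * (2 * pi * x) * real n)) \<le> fact (2 * N) / (4 * pi * (2 * pi * x) * real n) ^ N"
        using x n by (intro exp_sqrt_le) auto
      also have "\<dots> = C / real n ^ N" unfolding C_def power_mult_distrib[of _ "real n"] by simp
      also have "- 2 * sqrt (pi * (2 * pi * x) * real n) = - 2 * pi * sqrt (2 * real n * x)"
        using v[of "real n"] by simp
      finally show ?thesis .
    qed
    have "norm (F n) = 1 / sqrt (real n) * exp (- 2 * pi * sqrt (2 * real n * x)) * \<bar>sin (pi / 4 - 2 * pi * sqrt (2 * real n * x))\<bar>"
      unfolding F_def f_def norm_of_real abs_mult by simp
    also have "\<dots> \<le> 1 / sqrt (real n) * (C / real n ^ N) * 1"
    proof (rule mult_mono)
      show "1 / sqrt (real n) * exp (- 2 * pi * sqrt (2 * real n * x)) \<le> 1 / sqrt (real n) * (C / real n ^ N)"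
        by (rule mult_left_mono[OF e]) simp
    qed (use x in \<open>auto simp: C_def\<close>)
    also have "\<dots> = C * (real n powr - real N * real n powr - (1 / 2))"
    proof -
      have "real n powr - real N = 1 / real n ^ N" "real n powr - (1 / 2) = 1 / sqrt (real n)"
        using n0 by (simp_all only: powr_minus_divide powr_realpow powr_half_sqrt[OF less_imp_le])
      thus ?thesis by simp
    qed
    also have "real n powr - real N * real n powr - (1 / 2) = real n powr - \<alpha>"
      by (subst powr_add[symmetric]) (simp add: \<alpha>_def)
    finally show ?thesis .
  qed
  note S = divisor_sigma_sums[of F C \<alpha> s, OF bound \<alpha>]
  have inner: "(\<Sum>m. of_nat (Suc d) powr s * F (Suc d * Suc m)) =
      1 / complex_of_real (sqrt 2) * (of_nat (Suc d) powr (w - 1) * of_real (damped_sine_series (real (Suc d) * (2 * pi * x))))" for d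
  proof -
    define D where "D = real (Suc d)"
    have D: "D > 0" by (simp add: D_def)
    have f_eq: "f (Suc d * Suc m) = 1 / sqrt 2 * (1 / sqrt D) * (sqrt 2 / sqrt (real (Suc m)) * exp (- 2 * sqrt (pi * (D * (2 * pi * x)) * real (Suc m))) *
       sin (pi / 4 - 2 * sqrt (pi * (D * (2 * pi * x)) * real (Suc m))))" for m
    proof -
      have a: "2 * sqrt (pi * (D * (2 * pi * x)) * real (Suc m)) = 2 * pi * sqrt (2 * real (Suc d * Suc m) * x)"
      proof -
        have e: "pi * (D * (2 * pi * x)) * real (Suc m) = pi * (2 * pi * x) * real (Suc d * Suc m)"
          unfolding of_nat_mult D_def by (simp only: mult_ac)
        show ?thesis unfolding e by (rule v) simp
      qed
      have b: "sqrt (real (Suc d * Suc m)) = sqrt D * sqrt (real (Suc m))"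
        unfolding of_nat_mult D_def by (rule real_sqrt_mult)
      have "f (Suc d * Suc m) = 1 / (sqrt D * sqrt (real (Suc m))) * exp (- (2 * pi * sqrt (2 * real (Suc d * Suc m) * x))) * sin (pi / 4 - 2 * pi * sqrt (2 * real (Suc d * Suc m) * x))"
        unfolding f_def b by simp
      thus ?thesis unfolding a[symmetric] by simp
    qed
    have sumF: "summable (\<lambda>m. f (Suc d * Suc m))"
      using S(3)[of d] unfolding F_def by (simp only: summable_complex_of_real)
    have "summable (\<lambda>m. sqrt 2 / sqrt (real (Suc m)) * exp (- 2 * sqrt (pi * (D * (2 * pi * x)) * real (Suc m))) *
       sin (pi / 4 - 2 * sqrt (pi * (D * (2 * pi * x)) * real (Suc m))))"
      using sumF D unfolding f_eq by (subst (asm) summable_cmult_iff) auto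
    hence "(\<Sum>m. f (Suc d * Suc m)) = 1 / sqrt 2 * (1 / sqrt D) * damped_sine_series (D * (2 * pi * x))"
      unfolding f_eq damped_sine_series_def by (rule suminf_mult)
    hence "(\<Sum>m. F (Suc d * Suc m)) = of_real (1 / sqrt 2 * (1 / sqrt D) * damped_sine_series (D * (2 * pi * x)))"
      unfolding F_def suminf_of_real[OF sumF, symmetric] by (simp only:)
    also have "\<dots> = 1 / complex_of_real (sqrt 2) * (of_real (1 / sqrt D) * of_real (damped_sine_series (D * (2 * pi * x))))"
      by simp
    also have "complex_of_real (1 / sqrt D) = of_nat (Suc d) powr (- (1 / 2))"
    proof -
      have "1 / sqrt D = D powr (- (1 / 2))" using D by (simp add: powr_minus_divide powr_half_sqrt)
      thus ?thesis using powr_of_real[of D "- (1 / 2)"] by (simp add: D_def)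
    qed
    finally have "of_nat (Suc d) powr s * (\<Sum>m. F (Suc d * Suc m)) =
        1 / complex_of_real (sqrt 2) * ((of_nat (Suc d) powr s * of_nat (Suc d) powr (- (1 / 2))) * of_real (damped_sine_series (D * (2 * pi * x))))"
      by (simp only: mult_ac)
    also have "of_nat (Suc d) powr s * of_nat (Suc d) powr (- (1 / 2)) = (of_nat (Suc d) :: complex) powr (s + - (1 / 2))"
      by (rule powr_add[symmetric])
    also have "s + - (1 / 2) = w - 1" by (simp add: w_def)
    finally have e: "of_nat (Suc d) powr s * (\<Sum>m. F (Suc d * Suc m)) = 1 / complex_of_real (sqrt 2) * (of_nat (Suc d) powr (w - 1) * of_real (damped_sine_series (D * (2 * pi * x))))" .
    have "(\<Sum>m. of_nat (Suc d) powr s * F (Suc d * Suc m)) = of_nat (Suc d) powr s * (\<Sum>m. F (Suc d * Suc m))" by (rule suminf_mult[OF S(3)])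
    also note e
    finally show ?thesis unfolding D_def .
  qed
  have X: "2 * pi * x > 0" and w: "Re w > 1 / 2" using x s by (auto simp: w_def)
  have "summable (\<lambda>k. of_nat (Suc k) powr (w - 1) * complex_of_real (damped_sine_series (real (Suc k) * (2 * pi * x))))"
    by (rule summable_norm_cancel[OF summable_damped_sine_series[OF w X]])
  hence "(\<Sum>d. \<Sum>m. of_nat (Suc d) powr s * F (Suc d * Suc m)) =
      1 / complex_of_real (sqrt 2) * (\<Sum>k. of_nat (Suc k) powr (w - 1) * of_real (damped_sine_series (real (Suc k) * (2 * pi * x))))"
    unfolding inner by (rule suminf_mult)
  moreover have "divisor_sigma s n / complex_of_real (sqrt (real n))
              * complex_of_real (exp (- 2 * pi * sqrt (2 * real n * x)))
              * complex_of_real (sin (pi / 4 - 2 * pi * sqrt (2 * real n * x))) = divisor_sigma s n * F n" for n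
    by (simp add: F_def f_def)
  ultimately show ?thesis using S(1) by (simp only:)
qed

section \<open>The two bracketed expressions\<close>

context
  fixes s :: complex and x :: real and n :: nat and w :: complex and X :: complex
  assumes x: "x > 0" and n: "n \<ge> 1"
  defines "w \<equiv> s + 1 / 2" and "X \<equiv> complex_of_real x"
begin

lemma cos_eq_sin_shift: "sin (of_real pi / 4 - of_real pi * s / 2) = cos (of_real pi * w / 2)"
proof -
  have "of_real pi / 4 - of_real pi * s / 2 = of_real pi / 2 - of_real pi * w / 2"
    by (simp add: w_def field_simps)
  thus ?thesis by (simp only:) (simp add: sin_diff sin_of_real[symmetric] cos_of_real[symmetric])
qed

text \<open>Here \<open>x\<close> is factored out of \<open>x + \<i> n\<close> and
  \<open>x - \<i> n\<close>. As \<open>x\<close> is positive, this commutes with the principal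
  power.\<close>

lemma small_term_eq_koshliakov_term:
  "1 / of_nat n powr w * (- sin (of_real pi / 4 - of_real pi * s / 2)
      + of_nat n powr w / (2 * X powr w) * ((1 + \<i> * of_nat n / X) powr (- w) + (1 - \<i> * of_nat n / X) powr (- w))) =
    koshliakov_term w x n"
proof -
  have X0: "X \<noteq> 0" using x by (simp add: X_def)
  have n0: "(of_nat n :: complex) powr w \<noteq> 0" using n by simp
  have "X powr (- w) * (1 + \<i> * of_nat n / X) powr (- w) = (X * (1 + \<i> * of_nat n / X)) powr (- w)"
    "X powr (- w) * (1 - \<i> * of_nat n / X) powr (- w) = (X * (1 - \<i> * of_nat n / X)) powr (- w)"
    using x by (intro powr_times_real_left[symmetric]; simp add: X_def)+
  moreover have "X * (1 + \<i> * of_nat n / X) = of_real x + \<i> * of_nat n" "X * (1 - \<i> * of_nat n / X) = of_real x - \<i> * of_nat n"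
    using X0 by (simp_all add: field_simps X_def)
  ultimately have "(of_real x + \<i> * of_nat n) powr (- w) + (of_real x - \<i> * of_nat n) powr (- w) =
      X powr (- w) * ((1 + \<i> * of_nat n / X) powr (- w) + (1 - \<i> * of_nat n / X) powr (- w))"
    by (simp add: distrib_left)
  moreover have ring: "1 / N * (- c + N / (2 * Q) * S) = inverse Q * S / 2 - c * inverse N"
    if "N \<noteq> 0" "Q \<noteq> 0" for N Q c S :: complex
    using that by (simp add: field_simps)
  moreover have "X powr w \<noteq> 0" using X0 by simp
  ultimately show ?thesis
    unfolding koshliakov_term_def cos_eq_sin_shift powr_minus[of X w] powr_minus[of "of_nat n" w]
    using n0 by (simp only: ring)
qed

text \<open>Here \<open>n\<close> is factored out after a quarter turn:
  \<open>n + \<i> x = \<i> (x - \<i> n)\<close> and \<open>x + \<i> n = \<i> (n - \<i> x)\<close>.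
  All four numbers have positive real part, so their principal logarithms differ by exactly
  \<open>\<i> pi / 2\<close>. The resulting phases \<open>exp (\<mp> \<i> \<theta>)\<close> are
  undone by \<open>cos \<theta> + \<i> sin \<theta>\<close> and
  \<open>cos \<theta> - \<i> sin \<theta>\<close>.\<close>

lemma large_term_eq_koshliakov_term:
  "1 / of_nat n powr w * (cos (of_real pi / 4 + of_real pi * s / 2) * ((1 + \<i> * X / of_nat n) powr (- w) + (1 - \<i> * X / of_nat n) powr (- w) - 2)
      + \<i> * sin (of_real pi / 4 + of_real pi * s / 2) * ((1 + \<i> * X / of_nat n) powr (- w) - (1 - \<i> * X / of_nat n) powr (- w))) =
    2 * koshliakov_term w x n"
proof -
  define \<theta> where "\<theta> = of_real pi * w / 2"
  have \<theta>: "of_real pi / 4 + of_real pi * s / 2 = \<theta>" by (simp add: \<theta>_def w_def field_simps)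
  define p where "p = (of_real x - \<i> * of_nat n) powr (- w)"
  define q where "q = (of_real x + \<i> * of_nat n) powr (- w)"
  define a where "a = (1 + \<i> * X / of_nat n) powr (- w)"
  define b where "b = (1 - \<i> * X / of_nat n) powr (- w)"
  define m where "m = (of_nat n :: complex) powr (- w)"
  have n0: "(of_nat n :: complex) \<noteq> 0" using n by simp
  have "Ln (of_nat n + \<i> * X) = Ln (of_real x - \<i> * of_nat n) + \<i> * of_real pi / 2"
  proof -
    have "of_nat n + \<i> * X = \<i> * (of_real x - \<i> * of_nat n)" by (simp add: X_def algebra_simps)
    moreover have "of_real x - \<i> * of_nat n \<noteq> 0" using x by (simp add: complex_eq_iff)
    ultimately show ?thesis using x by (simp add: Ln_times_ii)
  qed
  moreover have nz: "of_nat n + \<i> * X \<noteq> 0" "of_real x - \<i> * of_nat n \<noteq> 0" "of_nat n - \<i> * X \<noteq> 0" "of_real x + \<i> * of_nat n \<noteq> 0"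
    using x n by (auto simp: complex_eq_iff X_def)
  ultimately have P: "(of_nat n + \<i> * X) powr (- w) = p * exp (- (\<i> * \<theta>))"
    unfolding p_def \<theta>_def by (simp add: powr_def mult_exp_exp) (simp add: algebra_simps)
  have "Ln (of_real x + \<i> * of_nat n) = Ln (of_nat n - \<i> * X) + \<i> * of_real pi / 2"
  proof -
    have "of_real x + \<i> * of_nat n = \<i> * (of_nat n - \<i> * X)" by (simp add: X_def algebra_simps)
    thus ?thesis using nz x by (simp add: Ln_times_ii X_def)
  qed
  hence Q: "(of_nat n - \<i> * X) powr (- w) = q * exp (\<i> * \<theta>)"
    unfolding q_def \<theta>_def using nz by (simp add: powr_def mult_exp_exp) (simp add: algebra_simps)
  have "m * a = (of_nat n * (1 + \<i> * X / of_nat n)) powr (- w)" "m * b = (of_nat n * (1 - \<i> * X / of_nat n)) powr (- w)"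
    unfolding m_def a_def b_def by (intro powr_times_real_left[symmetric]; simp)+
  moreover have "of_nat n * (1 + \<i> * X / of_nat n) = of_nat n + \<i> * X" "of_nat n * (1 - \<i> * X / of_nat n) = of_nat n - \<i> * X"
    using n0 by (simp_all add: field_simps)
  ultimately have ma: "m * a = p * exp (- (\<i> * \<theta>))" and mb: "m * b = q * exp (\<i> * \<theta>)" using P Q by simp_all
  have e: "exp (- (\<i> * \<theta>)) * exp (\<i> * \<theta>) = 1" by (simp add: mult_exp_exp)
  have "m * (cos \<theta> * (a + b - 2) + \<i> * sin \<theta> * (a - b)) = (m * a) * (cos \<theta> + \<i> * sin \<theta>) + (m * b) * (cos \<theta> - \<i> * sin \<theta>) - 2 * cos \<theta> * m"
    by (simp add: algebra_simps)
  also have "\<dots> = p * (exp (- (\<i> * \<theta>)) * exp (\<i> * \<theta>)) + q * (exp (- (\<i> * \<theta>)) * exp (\<i> * \<theta>)) - 2 * cos \<theta> * m"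
    unfolding ma mb exp_Euler[symmetric] exp_minus_Euler[symmetric] by (simp only: mult_ac)
  also have "\<dots> = 2 * koshliakov_term w x n"
    unfolding e unfolding koshliakov_term_def p_def q_def m_def \<theta>_def by (simp add: field_simps)
  finally show ?thesis
    unfolding \<theta> a_def b_def m_def by (simp add: powr_minus divide_inverse)
qed

end

section \<open>Constants and assembly\<close>

text \<open>The constants of the theorem against those of the derivation at
  \<open>X = 2 pi x\<close>. Once every power is written as an exponential of a combination of
  \<open>ln 2\<close>, \<open>ln pi\<close> and \<open>ln x\<close>, the first two identities
  compare exponents.\<close>

lemma prefactor_identities:
  fixes s :: complex and x :: real
  assumes x: "x > 0"
  defines "w \<equiv> s + 1 / 2"
  shows "4 * of_real pi / (2 powr (s + 3) * of_real pi powr (s + 3 / 2) * of_real x powr w) =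
      1 / complex_of_real (sqrt 2) * of_real (2 * pi * x) powr (- w)"
    and "1 / (2 powr s * of_real pi powr w) * (of_real (2 * pi) powr w / 2) = 1 / complex_of_real (sqrt 2)"
    and "1 / sqrt 2 * (2 * sqrt (pi * (2 * pi * x))) = 4 * pi * (sqrt x / 2)"
proof -
  have pr: "complex_of_real r powr a = exp (a * of_real (ln r))" if "r > 0" for r a
    using that by (simp add: powr_def Ln_of_real)
  have pr2: "2 powr a = exp (a * of_real (ln 2))" for a :: complex using pr[of 2 a] by simp
  have e2: "(2::complex) = exp (of_real (ln 2))" using pr2[of 1] by simp
  have epi: "complex_of_real pi = exp (of_real (ln pi))" using pr[of pi 1] by simp
  have sq: "complex_of_real (sqrt 2) = exp (of_real (ln 2) / 2)"
  proof -
    have "sqrt 2 = exp (ln 2 / 2)" by (simp add: ln_sqrt[symmetric])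
    thus ?thesis by (simp add: exp_of_real[symmetric])
  qed
  have l1: "ln (2 * pi) = ln 2 + ln pi" by (simp add: ln_mult)
  have l2: "ln (2 * pi * x) = ln 2 + ln pi + ln x" using x by (simp add: ln_mult)
  have four: "4 * complex_of_real pi = exp (2 * of_real (ln 2) + of_real (ln pi))"
  proof -
    have "4 * complex_of_real pi = 2 * 2 * complex_of_real pi" by simp
    also have "\<dots> = exp (of_real (ln 2)) * exp (of_real (ln 2)) * exp (of_real (ln pi))" by (simp only: e2 epi)
    finally show ?thesis by (simp add: mult_exp_exp)
  qed
  have x2: "2 * pi * x > 0" using x by simp
  show "4 * of_real pi / (2 powr (s + 3) * of_real pi powr (s + 3 / 2) * of_real x powr w) =
      1 / complex_of_real (sqrt 2) * of_real (2 * pi * x) powr (- w)"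
    unfolding four pr2 pr[OF pi_gt_zero] pr[OF x] pr[OF x2] sq l2 mult_exp_exp exp_diff[symmetric]
      inverse_eq_divide[symmetric] exp_minus[symmetric]
    by (rule arg_cong[where f = exp]) (simp add: w_def algebra_simps add_divide_distrib)
  have "2 powr s * of_real pi powr w * 2 * exp (- (of_real (ln 2) / 2)) = of_real (2 * pi) powr w"
  proof -
    have p2: "2 * pi > 0" by simp
    have "2 powr s * of_real pi powr w * 2 * exp (- (of_real (ln 2) / 2)) =
       exp (s * of_real (ln 2)) * exp (w * of_real (ln pi)) * exp (of_real (ln 2)) * exp (- (of_real (ln 2) / 2))"
      unfolding pr2 pr[OF pi_gt_zero] e2[symmetric] ..
    also have "\<dots> = of_real (2 * pi) powr w"
      unfolding pr[OF p2] l1 mult_exp_exp by (rule arg_cong[where f = exp]) (simp add: w_def algebra_simps)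
    finally show ?thesis .
  qed
  hence K: "of_real (2 * pi) powr w = 2 powr s * of_real pi powr w * 2 * exp (- (of_real (ln 2) / 2))" by (rule sym)
  have nz: "(2::complex) powr s \<noteq> 0" "complex_of_real pi powr w \<noteq> 0" by simp_all
  have inv: "exp (- (of_real (ln 2) / 2)) = 1 / complex_of_real (sqrt 2)"
    unfolding sq by (simp only: exp_minus inverse_eq_divide)
  have ring: "1 / (a * b) * (a * b * 2 * c / 2) = c" if "a \<noteq> 0" "b \<noteq> 0" for a b c :: complex
    using that by (simp add: field_simps)
  show "1 / (2 powr s * of_real pi powr w) * (of_real (2 * pi) powr w / 2) = 1 / complex_of_real (sqrt 2)"
    unfolding K inv by (rule ring[OF nz])
  have "pi * (2 * pi * x) = pi\<^sup>2 * (2 * x)" by (simp add: power2_eq_square)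
  hence "sqrt (pi * (2 * pi * x)) = pi * (sqrt 2 * sqrt x)" by (simp add: real_sqrt_mult)
  thus "1 / sqrt 2 * (2 * sqrt (pi * (2 * pi * x))) = 4 * pi * (sqrt x / 2)" by simp
qed

theorem theorem1p3:
  fixes s :: complex and x :: real
  assumes "Re s > 0" and "x > 0"
  shows
    "let
       X = complex_of_real x;
       P = complex_of_real pi;
       L = (\<lambda>n::nat. divisor_sigma s n / complex_of_real (sqrt (real n))
              * complex_of_real (exp (- 2 * pi * sqrt (2 * real n * x)))
              * complex_of_real (sin (pi / 4 - 2 * pi * sqrt (2 * real n * x))));
       A = (\<lambda>n::nat. divisor_sigma s n / of_nat n powr (s + 1/2)
              * (- sin (P / 4 - P * s / 2)
                 + of_nat n powr (s + 1/2) / (2 * X powr (s + 1/2))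
                   * ((1 + \<i> * of_nat n / X) powr (- (s + 1/2))
                      + (1 - \<i> * of_nat n / X) powr (- (s + 1/2)))));
       B = (\<lambda>n::nat. divisor_sigma s n / of_nat n powr (s + 1/2)
              * (cos (P / 4 + P * s / 2)
                   * ((1 + \<i> * X / of_nat n) powr (- (s + 1/2))
                      + (1 - \<i> * X / of_nat n) powr (- (s + 1/2)) - 2)
                 + \<i> * sin (P / 4 + P * s / 2)
                   * ((1 + \<i> * X / of_nat n) powr (- (s + 1/2))
                      - (1 - \<i> * X / of_nat n) powr (- (s + 1/2)))))
     in
       summable (\<lambda>n. L (Suc n)) \<and>
       summable (\<lambda>n. if x \<le> real n then B n else 0) \<and>
       (\<Sum>n. L (Suc n)) =
         4 * P * (complex_of_real (sqrt x) / 2 * riemann_zeta (- s)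
                  + riemann_zeta (1/2) / (4 * P * complex_of_real (sqrt 2)) * riemann_zeta (1/2 - s)
                  + Gamma (s + 1/2) * riemann_zeta (- s)
                    / (2 powr (s + 3) * P powr (s + 3/2) * X powr (s + 1/2)))
         + Gamma (s + 1/2) / (2 powr s * P powr (s + 1/2))
           * ((\<Sum>n | 1 \<le> n \<and> real n < x. A n)
              + 1/2 * (\<Sum>n. if x \<le> real n then B n else 0))"
proof -
  define w where "w = s + 1 / 2"
  define X where "X = complex_of_real x"
  define P where "P = complex_of_real pi"
  define L where "L = (\<lambda>n::nat. divisor_sigma s n / complex_of_real (sqrt (real n))
              * complex_of_real (exp (- 2 * pi * sqrt (2 * real n * x)))
              * complex_of_real (sin (pi / 4 - 2 * pi * sqrt (2 * real n * x))))"
  define A where "A = (\<lambda>n::nat. divisor_sigma s n / of_nat n powr (s + 1/2)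
              * (- sin (P / 4 - P * s / 2)
                 + of_nat n powr (s + 1/2) / (2 * X powr (s + 1/2))
                   * ((1 + \<i> * of_nat n / X) powr (- (s + 1/2))
                      + (1 - \<i> * of_nat n / X) powr (- (s + 1/2)))))"
  define B where "B = (\<lambda>n::nat. divisor_sigma s n / of_nat n powr (s + 1/2)
              * (cos (P / 4 + P * s / 2)
                   * ((1 + \<i> * X / of_nat n) powr (- (s + 1/2))
                      + (1 - \<i> * X / of_nat n) powr (- (s + 1/2)) - 2)
                 + \<i> * sin (P / 4 + P * s / 2)
                   * ((1 + \<i> * X / of_nat n) powr (- (s + 1/2))
                      - (1 - \<i> * X / of_nat n) powr (- (s + 1/2)))))"
  \<comment> \<open>Both brackets reduce to this one sequence, with factors 1 and 2, so the cut at
    \<open>x\<close> merely splits a single convergent series.\<close>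
  define E where "E = (\<lambda>n. divisor_sigma s n * koshliakov_term w x n)"
  define R where "R = (\<Sum>d. of_real (real (Suc d) powr (- 1 / 2)) * (exp_remainder w (of_real (2 * pi * x / real (Suc d))) - riemann_zeta (1 - w)))"
  note s = assms(1) and x = assms(2)
  have w: "Re w > 1 / 2" and x2: "2 * pi * x > 0" using s x by (auto simp: w_def)
  have AE: "A n = E n" if n: "n \<ge> 1" for n
  proof -
    have "A n = divisor_sigma s n * (1 / of_nat n powr (s + 1/2) * (- sin (P / 4 - P * s / 2)
                 + of_nat n powr (s + 1/2) / (2 * X powr (s + 1/2))
                   * ((1 + \<i> * of_nat n / X) powr (- (s + 1/2))
                      + (1 - \<i> * of_nat n / X) powr (- (s + 1/2)))))"
      unfolding A_def by simp
    thus ?thesis unfolding E_def w_def P_def X_def small_term_eq_koshliakov_term[OF x n] .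
  qed
  have BE: "B n = 2 * E n" if n: "n \<ge> 1" for n
  proof -
    have "B n = divisor_sigma s n * (1 / of_nat n powr (s + 1/2) * (cos (P / 4 + P * s / 2)
                   * ((1 + \<i> * X / of_nat n) powr (- (s + 1/2))
                      + (1 - \<i> * X / of_nat n) powr (- (s + 1/2)) - 2)
                 + \<i> * sin (P / 4 + P * s / 2)
                   * ((1 + \<i> * X / of_nat n) powr (- (s + 1/2))
                      - (1 - \<i> * X / of_nat n) powr (- (s + 1/2)))))"
      unfolding B_def by simp
    thus ?thesis unfolding E_def w_def P_def X_def large_term_eq_koshliakov_term[OF x n] by simp
  qed
  obtain T where T: "(\<lambda>n. E (Suc n)) sums T" "Gamma w * T = of_real (2 * pi) powr w / 2 * R"
    using sum_divisor_sigma_koshliakov_term[OF s x] unfolding E_def R_def w_def by blast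
  \<comment> \<open>Reindexed to start at 0 with value 0. The index 0 belongs to neither part:
    \<open>S\<close> starts at 1, and \<open>x > 0\<close> excludes 0 from the tail.\<close>
  define E0 where "E0 = (\<lambda>n. if n = 0 then 0 else E n)"
  have E0: "E0 sums T"
    using T(1) sums_Suc_iff[of E0 T] by (simp add: E0_def)
  define S where "S = {n. 1 \<le> n \<and> real n < x}"
  have finS: "finite S"
    by (rule finite_subset[of _ "{..nat \<lceil>x\<rceil>}"]) (auto simp: S_def le_nat_iff le_ceiling_iff)
  have SE: "(\<lambda>n. if n \<in> S then E n else 0) sums (\<Sum>n\<in>S. E n)"
    by (rule sums_If_finite_set[OF finS])
  have "(\<lambda>n. 2 * (E0 n - (if n \<in> S then E n else 0))) sums (2 * (T - (\<Sum>n\<in>S. E n)))"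
    by (intro sums_mult sums_diff E0 SE)
  also have "(\<lambda>n. 2 * (E0 n - (if n \<in> S then E n else 0))) = (\<lambda>n. if x \<le> real n then B n else 0)"
  proof
    fix n :: nat
    show "2 * (E0 n - (if n \<in> S then E n else 0)) = (if x \<le> real n then B n else 0)"
      using x BE[of n] by (cases "n = 0") (auto simp: E0_def S_def)
  qed
  finally have Bsums: "(\<lambda>n. if x \<le> real n then B n else 0) sums (2 * (T - (\<Sum>n\<in>S. E n)))" .
  have Tsplit: "(\<Sum>n | 1 \<le> n \<and> real n < x. A n) + 1/2 * (\<Sum>n. if x \<le> real n then B n else 0) = T"
  proof -
    have "(\<Sum>n | 1 \<le> n \<and> real n < x. A n) = (\<Sum>n\<in>S. E n)"
      unfolding S_def by (intro sum.cong) (auto simp: AE)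
    thus ?thesis unfolding sums_unique[OF Bsums, symmetric] by (simp add: field_simps)
  qed
  have Lsums: "(\<lambda>n. L (Suc n)) sums (1 / complex_of_real (sqrt 2) * (\<Sum>k. of_nat (Suc k) powr (w - 1) * of_real (damped_sine_series (real (Suc k) * (2 * pi * x)))))"
    unfolding L_def w_def by (rule sum_divisor_sigma_damped_sine[OF s x])
  define Z where "Z = riemann_zeta (- s)"
  define Y where "Y = riemann_zeta (1 / 2) * riemann_zeta (1 / 2 - s)"
  have zs: "1 / 2 - w = - s" "1 - w = 1 / 2 - s" by (simp_all add: w_def)
  have "(\<Sum>n. L (Suc n)) = 1 / complex_of_real (sqrt 2) * (Gamma w * of_real (2 * pi * x) powr (- w) * Z + R
      + of_real (2 * sqrt (pi * (2 * pi * x))) * Z + Y)"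
    using sums_unique[OF Lsums] sums_unique[OF sum_damped_sine_series[OF w x2]]
    unfolding R_def Z_def Y_def zs by (simp only:)
  also have "\<dots> = of_real (1 / sqrt 2 * (2 * sqrt (pi * (2 * pi * x)))) * Z + Y / of_real (sqrt 2)
      + Gamma w * Z * (1 / complex_of_real (sqrt 2) * of_real (2 * pi * x) powr (- w)) + 1 / of_real (sqrt 2) * R"
    by (simp add: distrib_left mult_ac)
  also have "\<dots> = of_real (4 * pi * (sqrt x / 2)) * Z + Y / of_real (sqrt 2)
      + Gamma w * Z * (4 * of_real pi / (2 powr (s + 3) * of_real pi powr (s + 3 / 2) * of_real x powr w))
      + 1 / (2 powr s * of_real pi powr w) * (of_real (2 * pi) powr w / 2) * R"
    unfolding prefactor_identities(3)[OF x] prefactor_identities(1)[OF x, of s, folded w_def] prefactor_identities(2)[OF x, of s, folded w_def] ..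
  also have "1 / (2 powr s * of_real pi powr w) * (of_real (2 * pi) powr w / 2) * R = Gamma w / (2 powr s * P powr w) * T"
  proof -
    have "1 / (2 powr s * P powr w) * (of_real (2 * pi) powr w / 2) * R = (Gamma w * T) / (2 powr s * P powr w)"
      unfolding T(2) by simp
    thus ?thesis by (simp add: P_def)
  qed
  also have "of_real (4 * pi * (sqrt x / 2)) * Z + Y / of_real (sqrt 2)
      + Gamma w * Z * (4 * of_real pi / (2 powr (s + 3) * of_real pi powr (s + 3 / 2) * of_real x powr w)) =
      4 * P * (complex_of_real (sqrt x) / 2 * riemann_zeta (- s)
                  + riemann_zeta (1/2) / (4 * P * complex_of_real (sqrt 2)) * riemann_zeta (1/2 - s)
                  + Gamma w * riemann_zeta (- s) / (2 powr (s + 3) * P powr (s + 3/2) * X powr w))"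
  proof -
    have P0: "P \<noteq> 0" by (simp add: P_def)
    have "Y / of_real (sqrt 2) = 4 * P * (riemann_zeta (1/2) / (4 * P * complex_of_real (sqrt 2)) * riemann_zeta (1/2 - s))"
      using P0 by (simp add: Y_def)
    thus ?thesis unfolding distrib_left by (simp add: P_def X_def Z_def mult_ac)
  qed
  finally have main: "(\<Sum>n. L (Suc n)) =
         4 * P * (complex_of_real (sqrt x) / 2 * riemann_zeta (- s)
                  + riemann_zeta (1/2) / (4 * P * complex_of_real (sqrt 2)) * riemann_zeta (1/2 - s)
                  + Gamma (s + 1/2) * riemann_zeta (- s)
                    / (2 powr (s + 3) * P powr (s + 3/2) * X powr (s + 1/2)))
         + Gamma (s + 1/2) / (2 powr s * P powr (s + 1/2))
           * ((\<Sum>n | 1 \<le> n \<and> real n < x. A n)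
              + 1/2 * (\<Sum>n. if x \<le> real n then B n else 0))"
    unfolding Tsplit w_def .
  show ?thesis
    using sums_summable[OF Lsums] sums_summable[OF Bsums] main
    unfolding Let_def L_def A_def B_def P_def X_def by blast
qed

end
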